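(* Let $\mathfrak M$ be a B-regular weight matrix and $U\in\mathscr D(\mathbb{R}^n)$. Then a function $f:U\to\mathbb R$ belongs to $\mathcal B^{(\mathfrak M)}(U)$ if and only if $f$ is $(\mathfrak M)$-almost analytically extendable.
   Context: A weight sequence is $\mathbf M=(M_k)_{k\in\mathbb N}$ with $M_0=1$, $\mu_k:=M_k/M_{k-1}$ satisfying $1\le\mu_1\le\mu_2\le\cdots$, and $M_k^{1/k}\to\infty$; write $m_k=M_k/k!$ (similarly $\mathbf N\leftrightarrow\mathbf n$). A weight matrix is a family of weight sequences totally ordered by the pointwise order. For a positive sequence $\mathbf m$ with $m_0=1$, $m_k^{1/k}\to\infty$ and $m_{k+1}/m_k\to\infty$ define $h_{\mathbf m}(t)=\inf_k m_kt^k$ ($t>0$), $h_{\mathbf m}(0)=0$, $\overline\Gamma_{\mathbf m}(t)=\min\{k:h_{\mathbf m}(t)=m_kt^k\}$, $\underline\Gamma_{\mathbf m}(t)=\min\{k:m_{k+1}/m_k\ge1/t\}$. A weight matrix $\mathfrak M$ is B-regular if: (0) $m_k^{1/k}\to\infty$ for all $\mathbf M\in\mathfrak M$; (3) for all $\mathbf M\in\mathfrak M$ there are $\mathbf N\in\mathfrak M$ and $C\ge1$ with $N_{j+1}\le C^{j}M_j$ for all $j$; (4) for all $\mathbf M\in\mathfrak M$ there are $\mathbf N\in\mathfrak M$ and $C\ge1$ with $\overline\Gamma_{\mathbf m}(Ct)\le\underline\Gamma_{\mathbf n}(t)$ for all $t>0$. $\mathscr D(\mathbb R^n)$ is the set of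 non-empty bounded open quasiconvex $U\subseteq\mathbb R^n$: there is $C$ such that any $x,y\in U$ can be joined by a rectifiable path in $U$ of length $\le C|x-y|$. $\mathcal B^{(\mathfrak M)}(U)$ is the set of $f\in C^\infty(U)$ with $\sup_{x\in U,\alpha\in\mathbb N^n}|\partial^\alpha f(x)|/(\rho^{|\alpha|}M_{|\alpha|})<\infty$ for all $\mathbf M\in\mathfrak M$ and all $\rho>0$. $f:U\to\mathbb R$ has an $(h,\rho)$-almost analytic extension if there are $F\in C^1_c(\mathbb C^n)$ and $C\ge1$ with $F|_U=f$ and $|\overline\partial F(z)|\le C\,h(\rho\,d(z,\overline U))$ for $z\in\mathbb C^n$, $d(z,\overline U)=\inf_{x\in\overline U}|z-x|$. $f$ is $(\mathfrak M)$-almost analytically extendable if for all $\mathbf M\in\mathfrak M$ and all $\rho>0$ it has an $(h_{\mathbf m},\rho)$-almost analytic extension. *)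

theory Defs
  imports "HOL-Analysis.Analysis"
begin

definition weight_sequence :: "(nat \<Rightarrow> real) \<Rightarrow> bool" where
  "weight_sequence M \<longleftrightarrow>
     M 0 = 1 \<and> (\<forall>k. M k > 0) \<and>
     1 \<le> M 1 / M 0 \<and>
     (\<forall>k\<ge>1. M k / M (k - 1) \<le> M (k + 1) / M k) \<and>
     filterlim (\<lambda>k. root k (M k)) at_top sequentially"

definition small_seq :: "(nat \<Rightarrow> real) \<Rightarrow> nat \<Rightarrow> real" where
  "small_seq M k = M k / fact k"

definition weight_matrix :: "(nat \<Rightarrow> real) set \<Rightarrow> bool" where
  "weight_matrix W \<longleftrightarrow> W \<noteq> {} \<and> (\<forall>M\<in>W. weight_sequence M) \<and>
     (\<forall>M\<in>W. \<forall>N\<in>W. (\<forall>k. M k \<le> N k) \<or> (\<forall>k. N k \<le> M k))"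

definition h_fun :: "(nat \<Rightarrow> real) \<Rightarrow> real \<Rightarrow> real" where
  "h_fun m t = (if t > 0 then (INF k. m k * t ^ k) else 0)"

definition Gamma_over :: "(nat \<Rightarrow> real) \<Rightarrow> real \<Rightarrow> nat" where
  "Gamma_over m t = (LEAST k. h_fun m t = m k * t ^ k)"

definition Gamma_under :: "(nat \<Rightarrow> real) \<Rightarrow> real \<Rightarrow> nat" where
  "Gamma_under m t = (LEAST k. m (k + 1) / m k \<ge> 1 / t)"

definition B_regular :: "(nat \<Rightarrow> real) set \<Rightarrow> bool" where
  "B_regular W \<longleftrightarrow> weight_matrix W \<and>
     (\<forall>M\<in>W. filterlim (\<lambda>k. root k (small_seq M k)) at_top sequentially) \<and>
     (\<forall>M\<in>W. \<exists>N\<in>W. \<exists>C\<ge>1. \<forall>j. N (j + 1) \<le> C ^ j * M j) \<and>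
     (\<forall>M\<in>W. \<exists>N\<in>W. \<exists>C\<ge>1. \<forall>t>0.
        Gamma_over (small_seq M) (C * t) \<le> Gamma_under (small_seq N) t)"

definition polygonal_sums :: "(real \<Rightarrow> 'a::metric_space) \<Rightarrow> real set" where
  "polygonal_sums g = {(\<Sum>i<length ts - 1. dist (g (ts ! i)) (g (ts ! (i + 1)))) | ts.
       sorted ts \<and> set ts \<subseteq> {0..1}}"

definition rectifiable_path :: "(real \<Rightarrow> 'a::metric_space) \<Rightarrow> bool" where
  "rectifiable_path g \<longleftrightarrow> path g \<and> bdd_above (polygonal_sums g)"

definition path_length :: "(real \<Rightarrow> 'a::metric_space) \<Rightarrow> real" where
  "path_length g = Sup (polygonal_sums g)"

definition quasiconvex_domain :: "(real ^ 'n) set \<Rightarrow> bool" where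
  "quasiconvex_domain U \<longleftrightarrow> U \<noteq> {} \<and> open U \<and> bounded U \<and>
     (\<exists>C. \<forall>x\<in>U. \<forall>y\<in>U. \<exists>g. rectifiable_path g \<and> path_image g \<subseteq> U \<and>
        pathstart g = x \<and> pathfinish g = y \<and> path_length g \<le> C * dist x y)"

definition partial :: "'n \<Rightarrow> (real ^ 'n \<Rightarrow> real) \<Rightarrow> real ^ 'n \<Rightarrow> real" where
  "partial j f x = deriv (\<lambda>t. f (x + t *\<^sub>R axis j 1)) 0"

fun partials :: "'n list \<Rightarrow> (real ^ 'n \<Rightarrow> real) \<Rightarrow> real ^ 'n \<Rightarrow> real" where
  "partials [] f = f"
| "partials (j # js) f = partial j (partials js f)"

definition smooth_on :: "(real ^ 'n) set \<Rightarrow> (real ^ 'n \<Rightarrow> real) \<Rightarrow> bool" where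
  "smooth_on U f \<longleftrightarrow> (\<forall>js. continuous_on U (partials js f) \<and>
     (\<forall>j. \<forall>x\<in>U. ((\<lambda>t. partials js f (x + t *\<^sub>R axis j 1))
                    has_real_derivative partials (j # js) f x) (at 0)))"

definition mi_order :: "('n::finite \<Rightarrow> nat) \<Rightarrow> nat" where
  "mi_order \<alpha> = (\<Sum>j\<in>UNIV. \<alpha> j)"

definition pderiv_mi :: "('n::finite \<Rightarrow> nat) \<Rightarrow> (real ^ 'n \<Rightarrow> real) \<Rightarrow> real ^ 'n \<Rightarrow> real" where
  "pderiv_mi \<alpha> f = partials (SOME js. \<forall>j. count (mset js) j = \<alpha> j) f"

definition B_class :: "(nat \<Rightarrow> real) set \<Rightarrow> (real ^ 'n::finite) set \<Rightarrow> (real ^ 'n \<Rightarrow> real) set" where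
  "B_class W U = {f. smooth_on U f \<and>
     (\<forall>M\<in>W. \<forall>\<rho>>0. \<exists>C. \<forall>x\<in>U. \<forall>\<alpha>.
        \<bar>pderiv_mi \<alpha> f x\<bar> \<le> C * (\<rho> ^ mi_order \<alpha> * M (mi_order \<alpha>)))}"

definition embed_real :: "real ^ 'n \<Rightarrow> complex ^ 'n" where
  "embed_real x = (\<chi> j. complex_of_real (x $ j))"

definition C1c :: "(complex ^ 'n::finite \<Rightarrow> complex) \<Rightarrow> bool" where
  "C1c F \<longleftrightarrow> (\<exists>F'. (\<forall>z. (F has_derivative blinfun_apply (F' z)) (at z)) \<and> continuous_on UNIV F')
     \<and> compact (closure {z. F z \<noteq> 0})"

text \<open>Wirtinger derivative \<open>\<partial>/\<partial>z\<^sub>j\<^sup>- = (\<partial>/\<partial>x\<^sub>j + i \<partial>/\<partial>y\<^sub>j)/2\<close>, collected into a vector.\<close>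
definition dbar :: "(complex ^ 'n::finite \<Rightarrow> complex) \<Rightarrow> complex ^ 'n \<Rightarrow> complex ^ 'n" where
  "dbar F z = (\<chi> j. (frechet_derivative F (at z) (axis j 1)
                      + \<i> * frechet_derivative F (at z) (axis j \<i>)) / 2)"

definition almost_analytic_ext ::
  "(real \<Rightarrow> real) \<Rightarrow> real \<Rightarrow> (real ^ 'n::finite) set \<Rightarrow> (real ^ 'n \<Rightarrow> real) \<Rightarrow> bool" where
  "almost_analytic_ext h \<rho> U f \<longleftrightarrow>
     (\<exists>F C. C1c F \<and> C \<ge> 1 \<and> (\<forall>x\<in>U. F (embed_real x) = complex_of_real (f x)) \<and>
        (\<forall>z. norm (dbar F z) \<le> C * h (\<rho> * infdist z (embed_real ` closure U))))"

definition M_almost_analytic_extendable ::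
  "(nat \<Rightarrow> real) set \<Rightarrow> (real ^ 'n::finite) set \<Rightarrow> (real ^ 'n \<Rightarrow> real) \<Rightarrow> bool" where
  "M_almost_analytic_extendable W U f \<longleftrightarrow>
     (\<forall>M\<in>W. \<forall>\<rho>>0. almost_analytic_ext (h_fun (small_seq M)) \<rho> U f)"

end

theory Submission
  imports Defs
begin

text \<open>
  Let \<open>F\<close> be an almost analytic extension of \<open>f\<close>. Averaging \<open>F\<close> against \<open>cis (- t)\<close> over a circle of
  radius \<open>r\<close> in the \<open>j\<close>-th variable and dividing by \<open>r\<close> gives \<open>\<partial>\<^sub>j F\<close> if \<open>F\<close> is holomorphic; in general
  the derivative of this average with respect to \<open>r\<close> is an average of \<open>\<partial>\<^sup>-F\<close>. Since \<open>\<partial>\<^sup>-F\<close> is flat on \<open>U\<close>,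
  the iterated averages converge uniformly on \<open>U\<close> as \<open>r \<rightarrow> 0\<close>; their limits are the partial
  derivatives of \<open>f\<close>, and comparing radius \<open>0\<close> with radius \<open>1\<close> bounds them.

  Conversely, condition (4) yields a log-convex sequence \<open>l \<le> m\<close> such that the derivatives of \<open>f\<close> of
  order \<open>k\<close> are bounded by \<open>A \<sigma>\<^sup>k k! l\<^sub>k\<close> for all \<open>\<sigma> > 0\<close>, and condition (3) makes \<open>m\<close> absorb powers of
  the distance. At scale \<open>\<delta>\<close> one uses Taylor polynomials of \<open>f\<close>, evaluated at complex points, whose degree
  minimises \<open>l\<^sub>k (\<tau> \<delta>)\<^sup>k\<close>; by quasiconvexity, any two of them with base points within distance \<open>O(\<delta>)\<close>
  agree up to \<open>h (\<tau> \<delta>)\<close>, times a power of \<open>1/\<delta>\<close>. For \<open>\<delta> = \<delta>\<^sub>0, \<delta>\<^sub>0/4, \<delta>\<^sub>0/16, \<dots>\<close> the current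
  function is overwritten, ball by ball along a \<open>\<delta>\<close>-net of \<open>U\<close>, by these polynomials, using smooth cut-offs.
  The increments are summable in the \<open>C\<^sup>1\<close> norm, and near \<open>U\<close> every stage is close in that norm to a holomorphic
  polynomial, which bounds \<open>\<partial>\<^sup>-\<close> of the limit.
\<close>

section \<open>Circle averages of almost holomorphic functions\<close>

text \<open>Each average costs a factor \<open>1/r\<close>, which flatness of matching order pays
  for; what remains is proportional to \<open>r\<close>, hence summable over the radii
  \<open>(1/2) ^ i\<close>. In the converse every step loses powers of the scale: one in the error
  of the Taylor polynomials, because first derivatives are approximated as well, one in the
  derivative of a cut-off, and \<open>CARD('n)\<close> in the number of balls. One more power is
  kept for summability. This is the shift \<open>CARD('n) + 3\<close> for which condition (3) is
  iterated. Since the number of balls can be paid for, plain overwriting is good enough: neither a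
  partition of unity nor bounded overlap enters. Scales shrink by the factor 4 because a cut-off is
  supported in a ball of 3 times its scale: wherever a stage changes anything, the point is so close
  to \<open>U\<close> that the preceding stage is already near a Taylor polynomial.\<close>

lemma norm_axis: "norm (axis j x :: 'a::real_normed_vector ^ 'n::finite) = norm x"
proof -
  have "(\<lambda>i. norm ((axis j x :: 'a ^ 'n) $ i)) = (\<lambda>i. if i = j then norm x else 0)"
    by (auto simp: axis_def)
  then show ?thesis
    by (simp add: norm_vec_def L2_set_def if_distrib [where f = "\<lambda>x. x\<^sup>2"] cong: if_cong)
qed

lemma bounded_linear_axis: "bounded_linear (axis j :: 'a::real_normed_vector \<Rightarrow> 'a ^ 'n::finite)"
proof (rule bounded_linear_intro [where K = 1])
  show "axis j (x + y) = axis j x + (axis j y :: 'a ^ 'n)" for x y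
    by (auto simp: vec_eq_iff axis_def)
  show "axis j (r *\<^sub>R x) = r *\<^sub>R (axis j x :: 'a ^ 'n)" for r x
    by (auto simp: vec_eq_iff axis_def)
qed (simp add: norm_axis)

lemmas axis_add = linear_add [OF bounded_linear.linear [OF bounded_linear_axis]]
lemmas axis_scaleR = linear_scale [OF bounded_linear.linear [OF bounded_linear_axis]]
lemmas axis_zero = linear_0 [OF bounded_linear.linear [OF bounded_linear_axis]]
lemmas continuous_on_axis [continuous_intros] = bounded_linear.continuous_on [OF bounded_linear_axis]

section \<open>Continuously differentiable functions and the Wirtinger components of a
  derivative\<close>

definition C1_with :: "(complex ^ 'n \<Rightarrow> complex) \<Rightarrow> (complex ^ 'n \<Rightarrow> (complex ^ 'n) \<Rightarrow>\<^sub>L complex) \<Rightarrow> bool"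
  where "C1_with G G' \<longleftrightarrow>
    (\<forall>z. (G has_derivative blinfun_apply (G' z)) (at z)) \<and> continuous_on UNIV G'"

text \<open>It acts on the derivative, a linear map, and not on the function: it is thereby linear
  itself and commutes with integrals and differences of derivatives.\<close>

definition dbar_comp :: "'n \<Rightarrow> ((complex ^ 'n) \<Rightarrow>\<^sub>L complex) \<Rightarrow> complex" where
  "dbar_comp j L = (L (axis j 1) + \<i> * L (axis j \<i>)) / 2"

lemma C1_withD:
  assumes "C1_with G G'"
  shows "(G has_derivative blinfun_apply (G' z)) (at z within S)"
    and "continuous_on S G'" and "continuous_on S G"
proof -
  show d: "(G has_derivative blinfun_apply (G' z)) (at z within S)" for z S
    using assms by (simp add: C1_with_def has_derivative_at_withinI)
  show "continuous_on S G'"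
    using assms by (auto simp: C1_with_def intro: continuous_on_subset)
  show "continuous_on S G"
    by (rule has_derivative_continuous_on [OF d])
qed

lemma C1_with_compose_continuous:
  assumes "C1_with G G'" "continuous_on S u"
  shows "continuous_on S (\<lambda>x. G (u x))" "continuous_on S (\<lambda>x. G' (u x))"
  using continuous_on_compose2 [OF C1_withD(3) [OF assms(1), of UNIV] assms(2)]
    continuous_on_compose2 [OF C1_withD(2) [OF assms(1), of UNIV] assms(2)] by auto

lemma dbar_comp_nth:
  assumes "C1_with G G'"
  shows "dbar_comp j (G' z) = dbar G z $ j"
proof -
  have "blinfun_apply (G' z) = frechet_derivative G (at z)"
    using assms by (intro frechet_derivative_at C1_withD)
  then show ?thesis
    by (simp add: dbar_comp_def dbar_def)
qed

lemma norm_dbar_comp_le: "C1_with G G' \<Longrightarrow> norm (dbar_comp j (G' z)) \<le> norm (dbar G z)"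
  by (simp add: dbar_comp_nth Finite_Cartesian_Product.norm_nth_le)

text \<open>Polar form of the Wirtinger operator: along a circle in the \<open>j\<close>-th variable
  the two terms on the left are the radial derivative and, up to the factors \<open>\<i>\<close> and
  radius, the angular one.\<close>

lemma dbar_comp_rotate:
  "blinfun_apply L (axis j (cis t)) + \<i> * L (axis j (\<i> * cis t)) = 2 * cis (- t) * dbar_comp j L"
proof -
  have 1: "axis j (cis t) = cos t *\<^sub>R axis j 1 + sin t *\<^sub>R axis j \<i>"
  proof -
    have "cis t = cos t *\<^sub>R 1 + sin t *\<^sub>R \<i>"
      by (simp add: complex_eq_iff)
    then show ?thesis
      by (simp only: axis_add axis_scaleR)
  qed
  have 2: "axis j (\<i> * cis t) = cos t *\<^sub>R axis j \<i> - sin t *\<^sub>R axis j 1"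
  proof -
    have "\<i> * cis t = cos t *\<^sub>R \<i> + (- sin t) *\<^sub>R 1"
      by (simp add: complex_eq_iff)
    then have "axis j (\<i> * cis t) = cos t *\<^sub>R axis j \<i> + (- sin t) *\<^sub>R axis j 1"
      by (simp only: axis_add axis_scaleR)
    then show ?thesis by simp
  qed
  have 3: "cis (- t) = of_real (cos t) - \<i> * of_real (sin t)"
    by (simp add: complex_eq_iff)
  show ?thesis
    unfolding 1 2 3 dbar_comp_def blinfun.bilinear_simps
    by (simp add: scaleR_conv_of_real algebra_simps)
qed

text \<open>For holomorphic \<open>G\<close> this is the \<open>k\<close>-th Taylor coefficient in the \<open>j\<close>-th variable, for every \<open>r\<close>.\<close>

definition circ_coeff :: "nat \<Rightarrow> 'n \<Rightarrow> real \<Rightarrow> (complex ^ 'n \<Rightarrow> complex) \<Rightarrow> complex ^ 'n \<Rightarrow> complex" where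
  "circ_coeff k j r G z =
     (1 / (2 * pi * r ^ k)) *\<^sub>R integral {0..2*pi} (\<lambda>t. cis (- (real k * t)) * G (z + axis j (r *\<^sub>R cis t)))"

definition circ_coeff' where
  "circ_coeff' k j r G' z =
     (1 / (2 * pi * r ^ k)) *\<^sub>R integral {0..2*pi}
        (\<lambda>t. blinfun_mult_right (cis (- (real k * t))) o\<^sub>L G' (z + axis j (r *\<^sub>R cis t)))"

lemma continuous_on_cis_mult [continuous_intros]: "continuous_on S (\<lambda>t. cis (c * t))"
  by (intro continuous_on_cis continuous_intros)

lemma has_derivative_circ_integrand:
  assumes "C1_with G G'"
  shows "((\<lambda>z. c * G (z + a)) has_derivative
            blinfun_apply (blinfun_mult_right c o\<^sub>L G' (z + a))) (at z within S)"
proof -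
  have "(G has_derivative G' (z + a)) (at (z + a) within (\<lambda>z. z + a) ` S)"
    using assms C1_withD by blast
  then have "((\<lambda>z. G (z + a)) has_derivative G' (z + a)) (at z within S)"
    by (auto intro!: has_derivative_in_compose [where g = G and f = "\<lambda>z. z + a", THEN has_derivative_eq_rhs] derivative_eq_intros)
  then have "((\<lambda>z. c * G (z + a)) has_derivative (\<lambda>x. c * G' (z + a) x)) (at z within S)"
    by (rule has_derivative_mult_right)
  then show ?thesis
    by (rule has_derivative_eq_rhs) (auto simp: fun_eq_iff)
qed

lemma C1_with_circ_coeff:
  assumes G: "C1_with G G'"
  shows "C1_with (circ_coeff k j r G) (circ_coeff' k j r G')"
proof -
  note G1 [continuous_intros] = C1_with_compose_continuous [OF G]
  have c: "continuous_on (UNIV \<times> cbox 0 (2*pi)) (\<lambda>(z, t). blinfun_mult_right (cis (- (real k * t))) o\<^sub>L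
       G' (z + axis j (r *\<^sub>R cis t)))"
    unfolding case_prod_unfold
    by (intro continuous_intros continuous_on_cis)
  have "((\<lambda>z. integral (cbox 0 (2*pi)) (\<lambda>t. cis (- (real k * t)) * G (z + axis j (r *\<^sub>R cis t)))) has_derivative
     blinfun_apply (integral (cbox 0 (2*pi)) (\<lambda>t. blinfun_mult_right (cis (- (real k * t))) o\<^sub>L
       G' (z + axis j (r *\<^sub>R cis t))))) (at z within UNIV)" for z
    by (rule leibniz_rule [OF _ _ c])
      (auto intro!: has_derivative_circ_integrand G integrable_continuous_real continuous_intros continuous_on_cis)
  then have "(circ_coeff k j r G has_derivative circ_coeff' k j r G' z) (at z)" for z
    unfolding circ_coeff_def circ_coeff'_def blinfun.scaleR_left
    by (intro has_derivative_scaleR_right) simp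
  moreover have "continuous_on UNIV (circ_coeff' k j r G')"
    unfolding circ_coeff'_def
    using integral_continuous_on_param [OF c]
    by (intro continuous_intros) simp
  ultimately show ?thesis
    unfolding C1_with_def by blast
qed

lemma circ_coeff'_apply:
  assumes "C1_with G G'"
  shows "circ_coeff' k j r G' z v =
     (1 / (2 * pi * r ^ k)) *\<^sub>R integral {0..2*pi}
        (\<lambda>t. cis (- (real k * t)) * G' (z + axis j (r *\<^sub>R cis t)) v)"
proof -
  have "blinfun_apply (integral {0..2*pi} (\<lambda>t. blinfun_mult_right (cis (- (real k * t))) o\<^sub>L G' (z + axis j (r *\<^sub>R cis t)))) v
     = integral {0..2*pi} (\<lambda>t. (blinfun_mult_right (cis (- (real k * t))) o\<^sub>L G' (z + axis j (r *\<^sub>R cis t))) v)"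
    by (rule blinfun_apply_integral)
      (intro integrable_continuous_real continuous_intros continuous_on_cis C1_with_compose_continuous [OF assms])
  then show ?thesis
    unfolding circ_coeff'_def blinfun.scaleR_left by simp
qed

lemma circ_coeff_bound:
  assumes c: "continuous_on UNIV G" and r: "r > 0"
    and B: "\<And>t. norm (G (z + axis j (r *\<^sub>R cis t))) \<le> B"
  shows "norm (circ_coeff k j r G z) \<le> B / r ^ k"
proof -
  have "norm (integral {0..2*pi} (\<lambda>t. cis (- (real k * t)) * G (z + axis j (r *\<^sub>R cis t)))) \<le> B * (2*pi - 0)"
    by (rule integral_bound)
      (auto intro!: continuous_intros continuous_on_cis continuous_on_compose2 [OF c] simp: norm_mult B)
  then show ?thesis
    using r by (simp add: circ_coeff_def field_simps)
qed

lemma dbar_comp_circ_coeff: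
  assumes "C1_with G G'"
  shows "dbar_comp l (circ_coeff' k j r G' z) = circ_coeff k j r (\<lambda>z. dbar_comp l (G' z)) z"
proof -
  have i: "(\<lambda>t. cis (- (real k * t)) * G' (z + axis j (r *\<^sub>R cis t)) v) integrable_on {0..2*pi}" for v
    by (intro integrable_continuous_real continuous_intros continuous_on_cis C1_with_compose_continuous [OF assms])
  have "integral {0..2*pi} (\<lambda>t. cis (- (real k * t)) * dbar_comp l (G' (z + axis j (r *\<^sub>R cis t)))) =
      integral {0..2*pi} (\<lambda>t. (1/2) * (cis (- (real k * t)) * G' (z + axis j (r *\<^sub>R cis t)) (axis l 1))
         + (\<i>/2) * (cis (- (real k * t)) * G' (z + axis j (r *\<^sub>R cis t)) (axis l \<i>)))"
    by (intro integral_cong) (simp add: dbar_comp_def field_simps)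
  also have "\<dots> = (1/2) * integral {0..2*pi} (\<lambda>t. cis (- (real k * t)) * G' (z + axis j (r *\<^sub>R cis t)) (axis l 1))
         + (\<i>/2) * integral {0..2*pi} (\<lambda>t. cis (- (real k * t)) * G' (z + axis j (r *\<^sub>R cis t)) (axis l \<i>))"
    by (subst integral_add) (simp_all only: integrable_on_mult_right i integral_mult_right)
  finally show ?thesis
    unfolding dbar_comp_def [of l "circ_coeff' k j r G' z"] circ_coeff'_apply [OF assms] circ_coeff_def
    by (simp only: scaleR_conv_of_real) (simp add: ring_distribs add_divide_distrib)
qed

text \<open>Integration by parts in the angle. The boundary terms cancel because
  \<open>cis (- (real k * t))\<close> has period \<open>2*pi\<close> for a natural number
  \<open>k\<close>.\<close>

lemma circ_ibp:
  assumes G: "C1_with G G'"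
  shows "r *\<^sub>R integral {0..2*pi} (\<lambda>t. cis (- (real k * t)) * G' (z + axis j (r *\<^sub>R cis t)) (axis j (\<i> * cis t)))
     = \<i> * of_nat k * integral {0..2*pi} (\<lambda>t. cis (- (real k * t)) * G (z + axis j (r *\<^sub>R cis t)))"
    (is "r *\<^sub>R integral _ ?f = _ * integral _ ?g")
proof -
  note [continuous_intros] = C1_with_compose_continuous [OF G]
  have f: "?f integrable_on {0..2*pi}" and g: "?g integrable_on {0..2*pi}"
    by (intro integrable_continuous_real continuous_intros continuous_on_cis)+
  have d: "((\<lambda>t. cis (- (real k * t)) * G (z + axis j (r *\<^sub>R cis t))) has_vector_derivative
      (r *\<^sub>R ?f t - \<i> * of_nat k * ?g t)) (at t within S)" for t S
  proof -
    have 1: "((\<lambda>t. z + axis j (r *\<^sub>R cis t)) has_vector_derivative r *\<^sub>R axis j (\<i> * cis t)) (at t within S)"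
    proof -
      have "(cis has_vector_derivative \<i> * cis t) (at t within S)"
        unfolding has_vector_derivative_def
        by (auto intro!: derivative_eq_intros simp: fun_eq_iff scaleR_conv_of_real)
      then have "((\<lambda>t. axis j (r *\<^sub>R cis t)) has_vector_derivative axis j (r *\<^sub>R (\<i> * cis t))) (at t within S)"
        by (intro bounded_linear.has_vector_derivative [OF bounded_linear_axis]
            bounded_linear.has_vector_derivative [OF bounded_linear_scaleR_right])
      then show ?thesis
        using has_vector_derivative_add [OF has_vector_derivative_const [of z]]
        by (fastforce simp: axis_scaleR)
    qed
    have 2: "((\<lambda>t. G (z + axis j (r *\<^sub>R cis t))) has_vector_derivative
        G' (z + axis j (r *\<^sub>R cis t)) (r *\<^sub>R axis j (\<i> * cis t))) (at t within S)"
      using vector_derivative_diff_chain_within [OF 1 C1_withD(1) [OF G]] by (simp add: o_def)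
    have 3: "((\<lambda>t. cis (- (real k * t))) has_vector_derivative - (\<i> * of_nat k * cis (- (real k * t)))) (at t within S)"
      unfolding has_vector_derivative_def
      by (auto intro!: derivative_eq_intros simp: fun_eq_iff scaleR_conv_of_real)
    show ?thesis
      using has_vector_derivative_mult [OF 3 2]
      by (rule has_vector_derivative_eq_rhs) (simp add: blinfun.scaleR_right algebra_simps)
  qed
  have "((\<lambda>t. r *\<^sub>R ?f t - \<i> * of_nat k * ?g t) has_integral
      (cis (- (real k * (2*pi))) * G (z + axis j (r *\<^sub>R cis (2*pi))) - cis (- (real k * 0)) * G (z + axis j (r *\<^sub>R cis 0)))) {0..2*pi}"
    by (rule fundamental_theorem_of_calculus) (auto intro: d)
  moreover have "cis (- (real k * (2*pi))) = 1"
  proof -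
    have "cis (real k * (2*pi)) = 1"
      using Complex.DeMoivre [of "2*pi" k] by simp
    then show ?thesis
      by (metis cis_inverse inverse_1)
  qed
  ultimately have "integral {0..2*pi} (\<lambda>t. r *\<^sub>R ?f t - \<i> * of_nat k * ?g t) = 0"
    by (simp add: integral_unique)
  then show ?thesis
    using f g by (simp add: integral_diff integrable_cmul integrable_on_mult_right)
qed

text \<open>By \<open>dbar_comp_rotate\<close> the radial derivative \<open>D\<close> of the
  integral is \<open>2 * H - \<i> * E\<close>, with \<open>E\<close> the angular term. By
  \<open>circ_ibp\<close> the latter contributes \<open>k * I / r\<close>, which cancels against the
  derivative of the prefactor \<open>1 / r ^ k\<close>. Only the average of the dbar derivative
  survives.\<close>

lemma circ_coeff_has_vector_derivative:
  assumes G: "C1_with G G'" and r: "r > 0"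
  shows "((\<lambda>r. circ_coeff k j r G z) has_vector_derivative
           (2 * r) *\<^sub>R circ_coeff (Suc k) j r (\<lambda>z. dbar_comp j (G' z)) z) (at r within S)"
proof -
  let ?u = "\<lambda>s t. z + axis j (s *\<^sub>R cis t)"
  note [continuous_intros] = C1_with_compose_continuous [OF G]
  define I where "I s = integral {0..2*pi} (\<lambda>t. cis (- (real k * t)) * G (?u s t))" for s
  define D where "D s = integral {0..2*pi} (\<lambda>t. cis (- (real k * t)) * G' (?u s t) (axis j (cis t)))" for s
  define E where "E s = integral {0..2*pi} (\<lambda>t. cis (- (real k * t)) * G' (?u s t) (axis j (\<i> * cis t)))" for s
  define H where "H s = integral {0..2*pi} (\<lambda>t. cis (- (real (Suc k) * t)) * dbar_comp j (G' (?u s t)))" for s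
  have c: "continuous_on (UNIV \<times> cbox 0 (2*pi)) (\<lambda>(s, t). cis (- (real k * t)) * G' (?u s t) (axis j (cis t)))"
    unfolding case_prod_unfold
    by (intro continuous_intros continuous_on_cis)
  have I': "(I has_vector_derivative D s) (at s within UNIV)" for s
    unfolding I_def D_def
  proof (simp only: flip: box_real, rule leibniz_rule_vector_derivative [OF _ _ c])
    fix s t :: real
    have 1: "((\<lambda>s. z + axis j (s *\<^sub>R cis t)) has_vector_derivative axis j (cis t)) (at s within UNIV)"
      unfolding has_vector_derivative_def
      by (auto intro!: derivative_eq_intros simp: axis_scaleR)
    have "((\<lambda>s. G (?u s t)) has_vector_derivative
        G' (?u s t) (axis j (cis t))) (at s within UNIV)"
      using vector_derivative_diff_chain_within [OF 1 C1_withD(1) [OF G]] by (simp add: o_def)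
    then show "((\<lambda>s. cis (- (real k * t)) * G (?u s t)) has_vector_derivative
        cis (- (real k * t)) * G' (?u s t) (axis j (cis t))) (at s within UNIV)"
      by (rule has_vector_derivative_mult_right)
  qed (auto intro!: integrable_continuous_real continuous_intros continuous_on_cis)
  have "D r + \<i> * E r = integral {0..2*pi} (\<lambda>t. cis (- (real k * t)) * G' (?u r t) (axis j (cis t)) +
      \<i> * (cis (- (real k * t)) * G' (?u r t) (axis j (\<i> * cis t))))"
    unfolding D_def E_def
    by (subst integral_add)
      (auto intro!: integrable_continuous_real continuous_intros continuous_on_cis)
  also have "\<dots> = integral {0..2*pi} (\<lambda>t. 2 * (cis (- (real (Suc k) * t)) * dbar_comp j (G' (?u r t))))"
  proof (intro integral_cong)
    fix t
    let ?L = "G' (?u r t)"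
    have "cis (- (real k * t)) * ?L (axis j (cis t)) + \<i> * (cis (- (real k * t)) * ?L (axis j (\<i> * cis t)))
       = cis (- (real k * t)) * (?L (axis j (cis t)) + \<i> * ?L (axis j (\<i> * cis t)))"
      by (simp add: algebra_simps)
    also have "\<dots> = 2 * ((cis (- (real k * t)) * cis (- t)) * dbar_comp j ?L)"
      unfolding dbar_comp_rotate by simp
    also have "cis (- (real k * t)) * cis (- t) = cis (- (real (Suc k) * t))"
      by (simp add: cis_mult algebra_simps)
    finally show "cis (- (real k * t)) * ?L (axis j (cis t)) + \<i> * (cis (- (real k * t)) * ?L (axis j (\<i> * cis t)))
       = 2 * (cis (- (real (Suc k) * t)) * dbar_comp j ?L)" .
  qed
  also have "\<dots> = 2 * H r"
    unfolding H_def by simp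
  finally have DE: "D r = 2 * H r - \<i> * E r"
    by (simp add: algebra_simps)
  have "r *\<^sub>R E r = \<i> * of_nat k * I r"
    unfolding E_def I_def by (rule circ_ibp [OF G])
  then have E: "E r = \<i> * of_nat k * I r / of_real r"
    using r by (simp add: scaleR_conv_of_real field_simps)
  have "((\<lambda>s. (1 / (2 * pi * s ^ k)) *\<^sub>R I s) has_vector_derivative
      (1 / (2 * pi * r ^ k)) *\<^sub>R D r + (- (real k) / (2 * pi * r ^ Suc k)) *\<^sub>R I r) (at r)"
  proof (rule has_vector_derivative_scaleR)
    show "((\<lambda>s. 1 / (2 * pi * s ^ k)) has_field_derivative - (real k) / (2 * pi * r ^ Suc k)) (at r)"
    proof -
      have h: "real n * (r ^ (n - Suc 0) * r) = real n * r ^ n" for n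
        by (cases n) auto
      show ?thesis
        using r
        by (cases k) (auto intro!: derivative_eq_intros simp: divide_simps, simp only: h, simp add: algebra_simps)
    qed
  qed (use I' in auto)
  moreover have "(1 / (2 * pi * r ^ k)) *\<^sub>R D r + (- (real k) / (2 * pi * r ^ Suc k)) *\<^sub>R I r
      = (2 * r) *\<^sub>R ((1 / (2 * pi * r ^ Suc k)) *\<^sub>R H r)"
    unfolding DE E using r by (simp add: scaleR_conv_of_real field_simps)
  ultimately show ?thesis
    unfolding circ_coeff_def I_def H_def by (simp only: has_vector_derivative_at_within)
qed

lemma circ_coeff_0: "circ_coeff 0 j 0 G z = G z"
  by (simp add: circ_coeff_def axis_zero)

lemma continuous_on_circ_coeff_0:
  assumes G: "C1_with G G'"
  shows "continuous_on S (\<lambda>r. circ_coeff 0 j r G z)"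
proof -
  note [continuous_intros] = C1_with_compose_continuous [OF G]
  have "continuous_on (S \<times> cbox 0 (2*pi)) (\<lambda>(s, t). cis (- (real 0 * t)) * G (z + axis j (s *\<^sub>R cis t)))"
    unfolding case_prod_unfold
    by (intro continuous_intros continuous_on_cis)
  from integral_continuous_on_param [OF this]
  have "continuous_on S (\<lambda>r. (1 / (2 * pi)) *\<^sub>R integral (cbox 0 (2*pi)) (\<lambda>t. cis (- (real 0 * t)) * G (z + axis j (r *\<^sub>R cis t))))"
    by (intro continuous_on_scaleR continuous_on_const)
  then show ?thesis
    by (simp add: circ_coeff_def)
qed

lemma continuous_on_dbar_comp:
  assumes G: "C1_with G G'"
  shows "continuous_on S (\<lambda>z. dbar_comp j (G' z))"
  unfolding dbar_comp_def by (intro continuous_intros C1_with_compose_continuous [OF G]) auto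

text \<open>The derivative in the radius \<open>x\<close> is at most
  \<open>2 * x * B / x ^ Suc k\<close>. For \<open>k = 0\<close> no negative power of
  \<open>x\<close> is left, so \<open>s = 0\<close> is allowed; this compares an average with the
  value at the centre.\<close>

lemma circ_coeff_radius_diff:
  assumes G: "C1_with G G'" and s: "0 \<le> s" "s < r" "k = 0 \<or> 0 < s"
    and B: "\<And>\<rho> t. 0 < \<rho> \<Longrightarrow> \<rho> \<le> r \<Longrightarrow> norm (dbar_comp j (G' (z + axis j (\<rho> *\<^sub>R cis t)))) \<le> B"
  shows "norm (circ_coeff k j r G z - circ_coeff k j s G z) \<le> 2 * B / s ^ k * (r - s)"
proof -
  have B0: "0 \<le> B"
    using B [of r 0] s norm_ge_zero order_trans by (meson order.strict_trans1 order_refl)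
  have bd: "norm ((2 * x) *\<^sub>R circ_coeff (Suc k) j x (\<lambda>z. dbar_comp j (G' z)) z) \<le> 2 * B / s ^ k"
    if x: "s < x" "x < r" for x
  proof -
    have x0: "x > 0" using x s by linarith
    have "norm (circ_coeff (Suc k) j x (\<lambda>z. dbar_comp j (G' z)) z) \<le> B / x ^ Suc k"
      using x x0 by (intro circ_coeff_bound continuous_on_dbar_comp [OF G] B) auto
    then have "2 * x * norm (circ_coeff (Suc k) j x (\<lambda>z. dbar_comp j (G' z)) z) \<le> 2 * x * (B / x ^ Suc k)"
      using x0 by (intro mult_left_mono) auto
    also have "\<dots> = 2 * B / x ^ k"
      using x0 by simp
    also have "\<dots> \<le> 2 * B / s ^ k"
      using s x B0 by (cases "k = 0") (auto intro!: divide_left_mono power_mono mult_pos_pos)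
    finally show ?thesis
      using x0 by simp
  qed
  have "norm (circ_coeff k j r G z - circ_coeff k j s G z) \<le> 2 * B / s ^ k * r - 2 * B / s ^ k * s"
  proof (rule differentiable_bound_general [where
        f' = "\<lambda>x. (2 * x) *\<^sub>R circ_coeff (Suc k) j x (\<lambda>z. dbar_comp j (G' z)) z" and \<phi>' = "\<lambda>_. 2 * B / s ^ k"])
    show "continuous_on {s..r} (\<lambda>r. circ_coeff k j r G z)"
    proof (cases "k = 0")
      case True
      then show ?thesis by (auto intro: continuous_on_circ_coeff_0 [OF G])
    next
      case False
      then show ?thesis
        using s unfolding continuous_on_eq_continuous_within
        by (intro ballI has_vector_derivative_continuous [OF circ_coeff_has_vector_derivative [OF G]]) auto
    qed
    show "continuous_on {s..r} ((*) (2 * B / s ^ k))"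
      by (intro continuous_intros)
    show "((*) (2 * B / s ^ k) has_vector_derivative 2 * B / s ^ k) (at x)" for x
      by (auto intro!: derivative_eq_intros simp: has_vector_derivative_def)
  qed (use s bd in \<open>auto intro!: circ_coeff_has_vector_derivative [OF G]\<close>)
  then show ?thesis by (simp add: right_diff_distrib)
qed

text \<open>This identifies limits of averages as derivatives: up to dbar terms, the real derivative
  of the mean value is the first coefficient. Pointwise the derivative along \<open>axis j 1\<close>
  splits into dbar terms and an angular derivative, and \<open>circ_ibp\<close> turns the latter
  into the coefficient.\<close>

lemma circ_coeff_real_derivative:
  fixes j :: "'n::finite"
  assumes G: "C1_with G G'" and r: "r > 0"
  shows "circ_coeff' 0 j r G' z (axis j 1) = circ_coeff 1 j r G z
      + circ_coeff 0 j r (\<lambda>z. dbar_comp j (G' z)) z + r\<^sup>2 *\<^sub>R circ_coeff 2 j r (\<lambda>z. dbar_comp j (G' z)) z"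
proof -
  let ?u = "\<lambda>s t. z + axis j (s *\<^sub>R cis t)"
  note [continuous_intros] = C1_with_compose_continuous [OF G] continuous_on_dbar_comp [OF G]
  have i: "(\<lambda>t. cis (- (c * t)) * dbar_comp j (G' (?u r t))) integrable_on {0..2*pi}"
    "(\<lambda>t. cis (- (c * t)) * G' (?u r t) (axis j (\<i> * cis t))) integrable_on {0..2*pi}" for c
    unfolding dbar_comp_def
    by (intro integrable_continuous_real continuous_intros continuous_on_cis; simp)+
  have pt: "blinfun_apply L (axis j 1) = dbar_comp j L + cis (- (2 * t)) * dbar_comp j L - \<i> * (cis (- t) * L (axis j (\<i> * cis t)))"
    for L :: "(complex ^ 'n) \<Rightarrow>\<^sub>L complex" and t
  proof -
    have "\<i> * cis t = cos t *\<^sub>R \<i> + (- sin t) *\<^sub>R 1"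
      by (simp add: complex_eq_iff)
    then have 1: "axis j (\<i> * cis t) = cos t *\<^sub>R axis j \<i> + (- sin t) *\<^sub>R axis j 1"
      by (simp only: axis_add axis_scaleR)
    have 2: "cis (- t) = of_real (cos t) - \<i> * of_real (sin t)"
      by (simp add: complex_eq_iff)
    have 3: "cis (- (2 * t)) = cis (- t) * cis (- t)"
      by (simp add: cis_mult)
    have 4: "of_real (sin t) * of_real (sin t) = (1 - of_real (cos t) * of_real (cos t) :: complex)"
    proof -
      have "sin t * sin t = 1 - cos t * cos t"
        using sin_cos_squared_add [of t] by (simp add: power2_eq_square)
      then show ?thesis
        by (metis of_real_1 of_real_diff of_real_mult)
    qed
    \<comment> \<open>With \<open>e = cis (- t)\<close> the claim is a polynomial identity modulo
      the relations for sine, cosine and the imaginary unit.\<close>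
    have alg: "p = D + e * e * D - I * (e * (a * q - b * p))"
      if "b * b = 1 - a * a" "I * I = - 1" "e = a - I * b" "D + D = p + I * q" for p q a b e D I :: complex
      using that by algebra
    have 5: "L (axis j (\<i> * cis t)) = of_real (cos t) * L (axis j \<i>) - of_real (sin t) * L (axis j 1)"
      unfolding 1 blinfun.bilinear_simps by (simp add: scaleR_conv_of_real)
    show ?thesis
      unfolding 5 3
      using alg [OF 4 _ 2, of "dbar_comp j L" "L (axis j 1)" "L (axis j \<i>)"]
      by (simp add: dbar_comp_def mult.assoc)
  qed
  let ?I = "\<lambda>c. integral {0..2*pi} (\<lambda>t. cis (- (c * t)) * dbar_comp j (G' (?u r t)))"
  let ?E = "integral {0..2*pi} (\<lambda>t. cis (- (real 1 * t)) * G' (?u r t) (axis j (\<i> * cis t)))"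
  let ?G = "integral {0..2*pi} (\<lambda>t. cis (- (real 1 * t)) * G (?u r t))"
  have "integral {0..2*pi} (\<lambda>t. cis (- (real 0 * t)) * G' (?u r t) (axis j 1)) =
     integral {0..2*pi} (\<lambda>t. (cis (- (0 * t)) * dbar_comp j (G' (?u r t))
        + cis (- (2 * t)) * dbar_comp j (G' (?u r t)))
        - \<i> * (cis (- (1 * t)) * G' (?u r t) (axis j (\<i> * cis t))))"
    by (intro integral_cong) (subst pt, simp)
  also have "\<dots> = (?I 0 + ?I 2) - \<i> * ?E"
    using i [of 0] i [of 1] i [of 2]
    by (subst integral_diff integral_add; (intro integrable_add integrable_on_mult_right)?; simp)+
  also have "\<i> * ?E = - (?G / of_real r)"
    using circ_ibp [OF G, of r 1 z j] r by (simp add: scaleR_conv_of_real field_simps)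
  finally show ?thesis
    unfolding circ_coeff'_apply [OF G] circ_coeff_def
    using r by (simp add: scaleR_conv_of_real field_simps power2_eq_square)
qed

section \<open>Iterated averages with a common radius\<close>

fun iter_coeff :: "real \<Rightarrow> 'n list \<Rightarrow> (complex ^ 'n \<Rightarrow> complex) \<Rightarrow> complex ^ 'n \<Rightarrow> complex" where
  "iter_coeff r [] G = G"
| "iter_coeff r (j # js) G = circ_coeff 1 j r (iter_coeff r js G)"

fun iter_coeff' where
  "iter_coeff' r [] G' = G'"
| "iter_coeff' r (j # js) G' = circ_coeff' 1 j r (iter_coeff' r js G')"

lemma C1_with_iter_coeff: "C1_with G G' \<Longrightarrow> C1_with (iter_coeff r js G) (iter_coeff' r js G')"
  by (induction js) (auto intro: C1_with_circ_coeff)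

lemma infdist_add_axis: "infdist (z + axis j (r *\<^sub>R cis t)) K \<le> infdist z K + \<bar>r\<bar>"
  using infdist_triangle [of "z + axis j (r *\<^sub>R cis t)" K z]
  by (simp add: dist_norm norm_axis)

text \<open>Averages commute with dbar. Each one moves the point by at most \<open>r\<close> and
  costs a factor \<open>1/r\<close>, so the bound on the original function is required on a
  neighbourhood widened by \<open>length js * r\<close>.\<close>

lemma dbar_iter_coeff_bound:
  assumes G: "C1_with G G'" and r: "r > 0"
    and B: "\<And>z l. infdist z K \<le> D + real (length js) * r \<Longrightarrow> norm (dbar_comp l (G' z)) \<le> B"
    and z: "infdist z K \<le> D"
  shows "norm (dbar_comp l (iter_coeff' r js G' z)) \<le> B / r ^ length js"
  using B z
proof (induction js arbitrary: D z l)
  case Nil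
  then show ?case by simp
next
  case (Cons j js)
  have C: "C1_with (iter_coeff r js G) (iter_coeff' r js G')"
    by (rule C1_with_iter_coeff [OF G])
  have "norm (circ_coeff 1 j r (\<lambda>z. dbar_comp l (iter_coeff' r js G' z)) z) \<le> (B / r ^ length js) / r ^ 1"
  proof (rule circ_coeff_bound [OF continuous_on_dbar_comp [OF C] r])
    fix t
    show "norm (dbar_comp l (iter_coeff' r js G' (z + axis j (r *\<^sub>R cis t)))) \<le> B / r ^ length js"
    proof (rule Cons.IH [of "D + r"])
      show "infdist (z + axis j (r *\<^sub>R cis t)) K \<le> D + r"
        using infdist_add_axis [of z j r t K] Cons.prems(2) r by simp
    qed (use Cons.prems(1) in \<open>simp add: algebra_simps\<close>)
  qed
  then show ?case
    by (simp add: dbar_comp_circ_coeff [OF C] mult.commute)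
qed

text \<open>First the outermost circle is shrunk, then all inner ones. In units of
  \<open>B / r ^ k * r\<close> this gives the recursion \<open>a (Suc k) = 2 + 2 * a k\<close>, for
  which \<open>k * 2 ^ k\<close> is an upper bound.\<close>

lemma iter_coeff_radius_diff:
  assumes G: "C1_with G G'" and r: "r > 0"
    and B: "\<And>z l. infdist z K \<le> D + real (length js) * r \<Longrightarrow> norm (dbar_comp l (G' z)) \<le> B"
    and z: "infdist z K \<le> D"
  shows "norm (iter_coeff r js G z - iter_coeff (r/2) js G z) \<le> real (length js) * 2 ^ length js * B / r ^ length js * r"
  using B z
proof (induction js arbitrary: D z)
  case Nil
  then show ?case by simp
next
  case (Cons j js)
  let ?k = "length js"
  let ?\<Delta> = "real ?k * 2 ^ ?k * B / r ^ ?k * r"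
  have C: "C1_with (iter_coeff s js G) (iter_coeff' s js G')" for s
    by (rule C1_with_iter_coeff [OF G])
  have 1: "norm (circ_coeff 1 j r (iter_coeff r js G) z - circ_coeff 1 j (r/2) (iter_coeff r js G) z)
      \<le> 2 * (B / r ^ ?k) / (r/2) ^ 1 * (r - r/2)"
  proof (rule circ_coeff_radius_diff [OF C])
    fix \<rho> t assume \<rho>: "0 < \<rho>" "\<rho> \<le> r"
    show "norm (dbar_comp j (iter_coeff' r js G' (z + axis j (\<rho> *\<^sub>R cis t)))) \<le> B / r ^ ?k"
    proof (rule dbar_iter_coeff_bound [OF G r])
      show "infdist (z + axis j (\<rho> *\<^sub>R cis t)) K \<le> D + r"
        using infdist_add_axis [of z j \<rho> t K] Cons.prems(2) \<rho> by simp
    qed (use Cons.prems(1) in \<open>simp add: algebra_simps\<close>)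
  qed (use r in auto)
  have i: "(\<lambda>t. cis (- (real k * t)) * iter_coeff s js G (z + axis j (q *\<^sub>R cis t))) integrable_on {0..2*pi}" for s q k
    by (intro integrable_continuous_real continuous_intros continuous_on_cis C1_with_compose_continuous [OF C])
  have "circ_coeff 1 j (r/2) (iter_coeff r js G) z - circ_coeff 1 j (r/2) (iter_coeff (r/2) js G) z
      = circ_coeff 1 j (r/2) (\<lambda>z. iter_coeff r js G z - iter_coeff (r/2) js G z) z"
    unfolding circ_coeff_def
    by (simp only: right_diff_distrib [where 'a = complex] integral_diff [OF i i] scaleR_diff_right)
  also have "norm \<dots> \<le> ?\<Delta> / (r/2) ^ 1"
  proof (rule circ_coeff_bound)
    show "continuous_on UNIV (\<lambda>z. iter_coeff r js G z - iter_coeff (r / 2) js G z)"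
      by (intro continuous_intros C1_withD(3) [OF C])
    fix t
    show "norm (iter_coeff r js G (z + axis j ((r / 2) *\<^sub>R cis t)) - iter_coeff (r / 2) js G (z + axis j ((r / 2) *\<^sub>R cis t))) \<le> ?\<Delta>"
    proof (rule Cons.IH [of "D + r"])
      show "infdist (z + axis j ((r / 2) *\<^sub>R cis t)) K \<le> D + r"
        using infdist_add_axis [of z j "r/2" t K] Cons.prems(2) r by simp
    qed (use Cons.prems(1) in \<open>simp add: algebra_simps\<close>)
  qed (use r in auto)
  finally have 2: "norm (circ_coeff 1 j (r/2) (iter_coeff r js G) z - circ_coeff 1 j (r/2) (iter_coeff (r/2) js G) z)
      \<le> ?\<Delta> / (r/2) ^ 1" .
  have B0: "0 \<le> B"
    using Cons.prems(1) [of z undefined] Cons.prems(2) r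
    by (meson add_increasing2 mult_nonneg_nonneg norm_ge_zero of_nat_0_le_iff order.strict_implies_order order_trans)
  have "norm (circ_coeff 1 j r (iter_coeff r js G) z - circ_coeff 1 j (r/2) (iter_coeff (r/2) js G) z)
     \<le> 2 * (B / r ^ ?k) / (r/2) ^ 1 * (r - r/2) + ?\<Delta> / (r/2) ^ 1"
    using norm_triangle_le [OF add_mono [OF 1 2]] by simp
  also have "\<dots> = B / r ^ ?k * (2 + real ?k * 2 ^ Suc ?k)"
    using r by (simp add: field_simps)
  also have "\<dots> \<le> B / r ^ ?k * (real (Suc ?k) * 2 ^ Suc ?k)"
    using B0 r by (intro mult_left_mono) (auto simp: algebra_simps)
  also have "\<dots> = real (Suc ?k) * 2 ^ Suc ?k * B / r ^ Suc ?k * r"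
    using r by (simp add: field_simps)
  finally show ?case by simp
qed

section \<open>Elementary estimates for infima, factorials and geometric increments\<close>

lemma h_fun_le:
  assumes "\<And>k. 0 \<le> m k" "t \<ge> 0"
  shows "h_fun m t \<le> m k * t ^ k"
proof (cases "t > 0")
  case True
  then have "bdd_below (range (\<lambda>k. m k * t ^ k))"
    using assms by (intro bdd_belowI [where m = 0]) auto
  then show ?thesis
    using True cINF_lower [of "\<lambda>k. m k * t ^ k" UNIV k] by (simp add: h_fun_def)
next
  case False
  then show ?thesis
    using assms by (auto simp: h_fun_def)
qed

lemma power_self_le_exp_fact: "real k ^ k \<le> exp 1 ^ k * fact k"
proof -
  have "(\<lambda>n. real k ^ n /\<^sub>R fact n) sums exp (real k)"
    by (rule exp_converges)
  then have "real k ^ k /\<^sub>R fact k \<le> exp (real k)"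
    using sum_le_suminf [of "\<lambda>n. real k ^ n /\<^sub>R fact n" "{k}"] sums_unique [of "\<lambda>n. real k ^ n /\<^sub>R fact n"]
    by (auto simp: sums_iff)
  also have "exp (real k) = exp 1 ^ k"
    by (simp flip: exp_of_nat_mult)
  finally show ?thesis
    by (simp add: field_simps)
qed

lemma eventually_geometric_less:
  assumes "(e::real) > 0"
  shows "\<forall>\<^sub>F i in sequentially. c * (1/2) ^ i < e"
proof -
  have "(\<lambda>i. c * (1/2) ^ i) \<longlonglongrightarrow> c * 0"
    by (intro tendsto_intros LIMSEQ_power_zero) auto
  then show ?thesis
    using assms by (intro order_tendstoD(2)) auto
qed

lemma geometric_increments_limit:
  fixes X :: "nat \<Rightarrow> 'a::banach"
  assumes X: "\<And>i. norm (X i - X (Suc i)) \<le> c * (1/2) ^ i"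
  shows "X \<longlonglongrightarrow> lim X" and "norm (X i - lim X) \<le> 2 * c * (1/2) ^ i"
proof -
  have c: "0 \<le> c"
    using order_trans [OF norm_ge_zero X [of 0]] by simp
  have d: "norm (X i - X (i + n)) \<le> 2 * c * (1/2) ^ i - 2 * c * (1/2) ^ (i + n)" for i n
  proof (induction n)
    case (Suc n)
    have "norm (X i - X (i + Suc n)) \<le> norm (X i - X (i + n)) + norm (X (i + n) - X (Suc (i + n)))"
      using norm_triangle_ineq [of "X i - X (i + n)" "X (i + n) - X (Suc (i + n))"] by simp
    then show ?case
      using Suc X [of "i + n"] by (simp add: algebra_simps)
  qed simp
  have b: "norm (X i - X (i + n)) \<le> 2 * c * (1/2) ^ i" for i n
    using d [of i n] c by (smt (verit) mult_nonneg_nonneg zero_le_power zero_less_divide_iff)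
  have "Cauchy X"
  proof (rule CauchyI')
    fix e :: real assume "e > 0"
    then obtain N where N: "2 * c * (1/2) ^ i < e" if "i \<ge> N" for i
      using eventually_geometric_less [of e "2 * c"] unfolding eventually_sequentially by blast
    show "\<exists>M. \<forall>m\<ge>M. \<forall>n>m. dist (X m) (X n) < e"
    proof (intro exI allI impI)
      fix m n assume "N \<le> m" "m < n"
      then show "dist (X m) (X n) < e"
        using b [of m "n - m"] N [of m] by (simp add: dist_norm)
    qed
  qed
  then show L: "X \<longlonglongrightarrow> lim X"
    using Cauchy_convergent convergent_LIMSEQ_iff by blast
  have "(\<lambda>n. norm (X i - X (i + n))) \<longlonglongrightarrow> norm (X i - lim X)"
    using LIMSEQ_ignore_initial_segment [OF L, of i]
    by (intro tendsto_intros) (simp add: add.commute)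
  then show "norm (X i - lim X) \<le> 2 * c * (1/2) ^ i"
    by (rule lim_mono [OF _ _ tendsto_const, rotated]) (use b in auto)
qed

section \<open>The real subspace of complex space\<close>

lemma embed_real_add_axis: "embed_real (x + t *\<^sub>R axis j 1) = embed_real x + t *\<^sub>R axis j 1"
  by (auto simp: embed_real_def vec_eq_iff axis_def complex_eq_iff)

lemma bounded_linear_embed_real: "bounded_linear (embed_real :: real ^ 'n::finite \<Rightarrow> complex ^ 'n)"
proof (rule bounded_linear_intro [where K = 1])
  show "norm (embed_real x :: complex ^ 'n) \<le> norm x * 1" for x
    by (simp add: embed_real_def norm_vec_def)
qed (auto simp: embed_real_def vec_eq_iff complex_eq_iff)

lemma norm_embed_real: "norm (embed_real x) = norm (x :: real ^ 'n::finite)"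
  by (simp add: embed_real_def norm_vec_def)

lemmas continuous_on_embed_real [continuous_intros] =
  bounded_linear.continuous_on [OF bounded_linear_embed_real]

text \<open>Flatness of every order on \<open>K\<close>, with explicit constants: the order used
  below grows with the number of averages, and \<open>b\<close> ends up as the bound on the
  derivatives of that order.\<close>

locale flat_dbar =
  fixes F :: "complex ^ 'n \<Rightarrow> complex" and F' and K :: "(complex ^ 'n) set" and b :: "nat \<Rightarrow> real"
  assumes F: "C1_with F F'"
    and flat: "\<And>z l k D. infdist z K \<le> D \<Longrightarrow> norm (dbar_comp l (F' z)) \<le> b k * D ^ k"
begin

definition jet :: "'n list \<Rightarrow> complex ^ 'n \<Rightarrow> complex" where
  "jet js z = lim (\<lambda>i. iter_coeff ((1/2) ^ i) js F z)"

text \<open>The constant in \<open>iter_coeff_radius_diff\<close> when flatness of order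
  \<open>length js\<close> is inserted at distance \<open>length js * r\<close>: all powers of
  \<open>r\<close> cancel except the last factor \<open>r\<close>.\<close>

definition rate :: "'n list \<Rightarrow> real" where
  "rate js = real (length js) * 2 ^ length js * (b (length js) * real (length js) ^ length js)"

lemma
  assumes "z \<in> K"
  shows jet_limit: "(\<lambda>i. iter_coeff ((1/2) ^ i) js F z) \<longlonglongrightarrow> jet js z"
    and jet_rate: "norm (iter_coeff ((1/2) ^ i) js F z - jet js z) \<le> 2 * rate js * (1/2) ^ i"
proof -
  have "norm (iter_coeff ((1/2) ^ i) js F z - iter_coeff ((1/2) ^ Suc i) js F z) \<le> rate js * (1/2) ^ i" for i
  proof -
    let ?r = "(1/2::real) ^ i" and ?k = "length js"
    have "norm (iter_coeff ?r js F z - iter_coeff (?r/2) js F z) \<le>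
        real ?k * 2 ^ ?k * (b ?k * (real ?k * ?r) ^ ?k) / ?r ^ ?k * ?r"
      by (rule iter_coeff_radius_diff [OF F, where D = 0 and K = K])
        (use assms flat in \<open>auto\<close>)
    also have "\<dots> = rate js * ?r"
      by (simp add: rate_def power_mult_distrib)
    finally show ?thesis by simp
  qed
  from geometric_increments_limit [OF this]
  show "(\<lambda>i. iter_coeff ((1/2) ^ i) js F z) \<longlonglongrightarrow> jet js z"
    and "norm (iter_coeff ((1/2) ^ i) js F z - jet js z) \<le> 2 * rate js * (1/2) ^ i"
    by (simp_all add: jet_def)
qed

lemma jet_Nil: "jet [] z = F z"
  by (simp add: jet_def)

text \<open>At radius 1 averaging does not increase the supremum, so \<open>S\<close> bounds the
  first member of the sequence; the distance to its limit is \<open>jet_rate\<close> at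
  \<open>i = 0\<close>.\<close>

lemma norm_jet_le:
  assumes "z \<in> K" "\<And>w. norm (F w) \<le> S"
  shows "norm (jet js z) \<le> S + 2 * rate js"
proof -
  have "norm (iter_coeff 1 js F w) \<le> S" for w
  proof (induction js arbitrary: w)
    case (Cons j js)
    have "norm (circ_coeff 1 j 1 (iter_coeff 1 js F) w) \<le> S / 1 ^ 1"
      by (rule circ_coeff_bound) (use Cons in \<open>auto intro: C1_withD(3) [OF C1_with_iter_coeff [OF F]]\<close>)
    then show ?case by simp
  qed (use assms in auto)
  then show ?thesis
    using jet_rate [OF assms(1), of 0 js] norm_triangle_sub [of "jet js z" "iter_coeff 1 js F z"]
    by (simp add: norm_minus_commute) (meson add_mono order_trans)
qed

lemma continuous_on_jet: "continuous_on K (jet js)"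
proof (rule uniform_limit_theorem)
  show "uniform_limit K (\<lambda>i. iter_coeff ((1/2) ^ i) js F) (jet js) sequentially"
    unfolding uniform_limit_iff
  proof (intro allI impI)
    fix e :: real assume "e > 0"
    from eventually_geometric_less [OF this, of "2 * rate js"] show "\<forall>\<^sub>F n in sequentially. \<forall>x\<in>K. dist (iter_coeff ((1/2) ^ n) js F x) (jet js x) < e"
      by eventually_elim (auto simp: dist_norm intro: le_less_trans [OF jet_rate])
  qed
qed (auto intro!: always_eventually C1_withD(3) [OF C1_with_iter_coeff [OF F]])

text \<open>The iterated averages are replaced by their mean values over one more circle, since for
  those \<open>circ_coeff_real_derivative\<close> computes the derivative. Values tend to
  \<open>jet js\<close> pointwise and derivatives to \<open>jet (j # js)\<close> uniformly, so limit
  and derivative can be exchanged.\<close>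

lemma jet_has_derivative:
  assumes S: "\<And>t. \<bar>t\<bar> < \<epsilon> \<Longrightarrow> z + t *\<^sub>R axis j 1 \<in> K" and \<epsilon>: "\<epsilon> > 0"
  shows "((\<lambda>t. jet js (z + t *\<^sub>R axis j 1)) has_vector_derivative jet (j # js) z) (at 0)"
proof -
  let ?k = "length js" and ?S = "{-\<epsilon><..<\<epsilon>}" and ?r = "\<lambda>i. (1/2::real) ^ i"
  let ?p = "\<lambda>t. z + t *\<^sub>R axis j 1"
  \<comment> \<open>One order of flatness more than there are averages, so that a factor
    \<open>r\<close> remains after division by \<open>r ^ length js\<close>.\<close>
  define c where "c = b (Suc ?k) * real (Suc ?k) ^ Suc ?k"
  have S': "?p t \<in> K" if "t \<in> ?S" for t
    using S that by auto
  have C: "C1_with (iter_coeff r js F) (iter_coeff' r js F')" for r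
    by (rule C1_with_iter_coeff [OF F])
  have db: "norm (dbar_comp j (iter_coeff' r js F' w)) \<le> c * r"
    if r: "r > 0" and w: "infdist w K \<le> r" for r w
  proof -
    have "norm (dbar_comp j (iter_coeff' r js F' w)) \<le> (b (Suc ?k) * (real (Suc ?k) * r) ^ Suc ?k) / r ^ ?k"
    proof (rule dbar_iter_coeff_bound [OF F r _ w])
      fix z l assume "infdist z K \<le> r + real ?k * r"
      moreover have "real (Suc ?k) * r = r + real ?k * r"
        by (simp add: algebra_simps)
      ultimately show "norm (dbar_comp l (F' z)) \<le> b (Suc ?k) * (real (Suc ?k) * r) ^ Suc ?k"
        by (simp only: flat)
    qed
    also have "\<dots> = c * r"
      using r unfolding c_def power_mult_distrib by simp
    finally show ?thesis .
  qed
  have db': "norm (dbar_comp j (iter_coeff' r js F' (w + axis j (\<rho> *\<^sub>R cis t)))) \<le> c * r"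
    if "r > 0" "w \<in> K" "0 < \<rho>" "\<rho> \<le> r" for r w \<rho> t
  proof (rule db [OF that(1)])
    show "infdist (w + axis j (\<rho> *\<^sub>R cis t)) K \<le> r"
      using that infdist_add_axis [of w j \<rho> t K] by simp
  qed
  define f where "f i t = circ_coeff 0 j (?r i) (iter_coeff (?r i) js F) (?p t)" for i t
  define f' where "f' i t = circ_coeff' 0 j (?r i) (iter_coeff' (?r i) js F') (?p t) (axis j 1)" for i t
  have lim_f: "(\<lambda>i. f i t) \<longlonglongrightarrow> jet js (?p t)" if t: "t \<in> ?S" for t
  proof -
    have "norm (f i t - iter_coeff (?r i) js F (?p t)) \<le> 2 * c * (?r i * ?r i)" for i
    proof -
      have "norm (circ_coeff 0 j (?r i) (iter_coeff (?r i) js F) (?p t) - circ_coeff 0 j 0 (iter_coeff (?r i) js F) (?p t))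
          \<le> 2 * (c * ?r i) / 0 ^ 0 * (?r i - 0)"
        by (rule circ_coeff_radius_diff [OF C _ _ _ db' [OF _ S' [OF t]]]) auto
      then show ?thesis
        by (simp add: f_def circ_coeff_0)
    qed
    then have "(\<lambda>i. f i t - iter_coeff (?r i) js F (?p t)) \<longlonglongrightarrow> 0"
    proof (rule Lim_null_comparison [OF always_eventually [OF allI]])
      have "(\<lambda>i. 2 * c * (?r i * ?r i)) \<longlonglongrightarrow> 2 * c * (0 * 0)"
        by (intro tendsto_intros LIMSEQ_power_zero) auto
      then show "(\<lambda>i. 2 * c * (?r i * ?r i)) \<longlonglongrightarrow> 0"
        by simp
    qed
    from tendsto_add [OF this jet_limit [OF S' [OF t], of js]] show ?thesis
      by simp
  qed
  have "\<exists>g. \<forall>t\<in>?S. (\<lambda>i. f i t) \<longlonglongrightarrow> g t \<and> (g has_derivative (\<lambda>h. h *\<^sub>R jet (j # js) (?p t))) (at t within ?S)"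
  proof (rule has_derivative_sequence)
    show "(f i has_derivative (\<lambda>h. h *\<^sub>R f' i t)) (at t within ?S)" for i t
    proof -
      have 1: "(?p has_vector_derivative axis j 1) (at t within ?S)"
        by (auto intro!: derivative_eq_intros simp: has_vector_derivative_def)
      show ?thesis
        using vector_derivative_diff_chain_within [OF 1 C1_withD(1) [OF C1_with_circ_coeff [OF C]]]
        by (simp add: f_def [abs_def] f'_def has_vector_derivative_def o_def)
    qed
    show "(\<lambda>i. f i 0) \<longlonglongrightarrow> jet js (?p 0)"
      using \<epsilon> by (intro lim_f) auto
  next
    fix e :: real assume e: "e > 0"
    from eventually_geometric_less [OF e, of "2 * c + 2 * rate (j # js)"] show "\<forall>\<^sub>F i in sequentially. \<forall>t\<in>?S. \<forall>h. norm (h *\<^sub>R f' i t - h *\<^sub>R jet (j # js) (?p t)) \<le> e * norm h"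
    proof eventually_elim
      case (elim i)
      show ?case
      proof (intro ballI allI)
        fix t h assume t: "t \<in> ?S"
        let ?d = "\<lambda>z. dbar_comp j (iter_coeff' (?r i) js F' z)"
        have eq: "f' i t = iter_coeff (?r i) (j # js) F (?p t)
            + circ_coeff 0 j (?r i) ?d (?p t) + (?r i)\<^sup>2 *\<^sub>R circ_coeff 2 j (?r i) ?d (?p t)"
          unfolding f'_def by (subst circ_coeff_real_derivative [OF C]) auto
        have n: "norm (circ_coeff k j (?r i) ?d (?p t)) \<le> c * ?r i / ?r i ^ k" for k
          by (intro circ_coeff_bound continuous_on_dbar_comp [OF C] db' [OF _ S' [OF t]]) auto
        have n0: "norm (circ_coeff 0 j (?r i) ?d (?p t)) \<le> c * ?r i"
          using n [of 0] by simp
        have n2: "norm ((?r i)\<^sup>2 *\<^sub>R circ_coeff 2 j (?r i) ?d (?p t)) \<le> c * ?r i"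
          using mult_left_mono [OF n [of 2], of "(?r i)\<^sup>2"] by simp
        have n3: "norm (iter_coeff (?r i) (j # js) F (?p t) - jet (j # js) (?p t)) \<le> 2 * rate (j # js) * ?r i"
          by (rule jet_rate [OF S' [OF t]])
        have "norm (f' i t - jet (j # js) (?p t)) \<le> e"
          using norm_triangle_le [OF add_mono [OF norm_triangle_le [OF add_mono [OF n3 n0]] n2]] elim
          unfolding eq by (simp add: algebra_simps)
        then show "norm (h *\<^sub>R f' i t - h *\<^sub>R jet (j # js) (?p t)) \<le> e * norm h"
          by (simp flip: scaleR_diff_right) (simp add: mult.commute [of e] mult_left_mono)
      qed
    qed
  qed (use \<epsilon> in auto)
  then obtain g where g': "\<forall>t\<in>?S. (\<lambda>i. f i t) \<longlonglongrightarrow> g t \<and> (g has_derivative (\<lambda>h. h *\<^sub>R jet (j # js) (?p t))) (at t within ?S)"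
    by (elim exE)
  note g = g' [rule_format, THEN conjunct1] g' [rule_format, THEN conjunct2]
  have 0: "(0::real) \<in> ?S" using \<epsilon> by auto
  have "(g has_derivative (\<lambda>h. h *\<^sub>R jet (j # js) z)) (at 0)"
  proof -
    have "at 0 within ?S = at 0"
      by (rule at_within_open [OF 0]) simp
    with g(2) [OF 0] show ?thesis
      by simp
  qed
  then have "((\<lambda>t. jet js (?p t)) has_derivative (\<lambda>h. h *\<^sub>R jet (j # js) z)) (at 0)"
  proof (rule has_derivative_transform_within_open [OF _ _ 0])
    show "g t = jet js (?p t)" if "t \<in> ?S" for t
      using that by (intro LIMSEQ_unique [OF g(1) lim_f])
  qed auto
  then show ?thesis
    by (simp add: has_vector_derivative_def)
qed

end

section \<open>From an almost analytic extension to derivative bounds\<close>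

text \<open>Eventually the \<open>k\<close>-th root exceeds \<open>1 / \<rho>\<close>, which makes
  the product at least 1; finitely many positive values remain. The constant \<open>c\<close> serves
  to absorb additive constants into a weighted bound.\<close>

lemma power_times_weight_bounded_below:
  fixes M :: "nat \<Rightarrow> real"
  assumes pos: "\<And>k. 0 < M k" and lim: "filterlim (\<lambda>k. root k (M k)) at_top sequentially" and \<rho>: "\<rho> > 0"
  shows "\<exists>c>0. \<forall>k. c \<le> \<rho> ^ k * M k"
proof -
  have "\<forall>\<^sub>F k in sequentially. 1 / \<rho> \<le> root k (M k) \<and> k > 0"
    using lim eventually_gt_at_top [of 0] by (auto simp: filterlim_at_top intro: eventually_conj)
  then obtain k0 where k0: "1 / \<rho> \<le> root k (M k)" "k > 0" if "k \<ge> k0" for k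
    unfolding eventually_sequentially by blast
  have large: "1 \<le> \<rho> ^ k * M k" if "k \<ge> k0" for k
  proof -
    have "(1 / \<rho>) ^ k \<le> root k (M k) ^ k"
      using k0 [OF that] \<rho> by (intro power_mono) auto
    also have "\<dots> = M k"
      using k0 [OF that] pos [of k] by (simp add: real_root_pow_pos)
    finally show ?thesis
      using \<rho> by (simp add: field_simps)
  qed
  define c where "c = Min (insert 1 ((\<lambda>k. \<rho> ^ k * M k) ` {..<k0}))"
  show ?thesis
  proof (intro exI conjI allI)
    show "c > 0"
      unfolding c_def using pos \<rho> by (subst Min_gr_iff) auto
    fix k
    show "c \<le> \<rho> ^ k * M k"
    proof (cases "k < k0")
      case True
      then show ?thesis unfolding c_def by (intro Min_le) auto
    next
      case False
      have "c \<le> 1" unfolding c_def by (intro Min_le) auto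
      then show ?thesis using large [of k] False by simp
    qed
  qed
qed

section \<open>Multi-indices and lists of coordinates\<close>

lemma length_of_count:
  fixes \<alpha> :: "'n::finite \<Rightarrow> nat"
  assumes "\<forall>j. count (mset js) j = \<alpha> j"
  shows "length js = mi_order \<alpha>"
proof -
  have "length js = (\<Sum>j\<in>set_mset (mset js). count (mset js) j)"
    by (simp flip: size_mset add: size_multiset_overloaded_eq)
  also have "\<dots> = (\<Sum>j\<in>UNIV. count (mset js) j)"
    by (rule sum.mono_neutral_left) (auto simp: count_eq_zero_iff)
  finally show ?thesis
    using assms by (simp add: mi_order_def)
qed

lemma ex_list_of_count:
  fixes \<alpha> :: "'n::finite \<Rightarrow> nat"
  shows "\<exists>js. \<forall>j. count (mset js) j = \<alpha> j"
proof -
  obtain js where "mset js = Abs_multiset \<alpha>"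
    using ex_mset by blast
  then show ?thesis
    by (metis count_Abs_multiset finite)
qed

lemma length_pderiv_mi_list:
  "length (SOME js. \<forall>j. count (mset js) j = \<alpha> j) = mi_order (\<alpha> :: 'n::finite \<Rightarrow> nat)"
  by (rule length_of_count [OF someI_ex [OF ex_list_of_count]])

context flat_dbar
begin

text \<open>Induction over the list: once \<open>partials js f\<close> agrees with the jet on
  \<open>U\<close>, both have the same derivative along each axis.\<close>

lemma
  assumes U: "open U" and UK: "embed_real ` U \<subseteq> K"
    and Ff: "\<And>x. x \<in> U \<Longrightarrow> F (embed_real x) = complex_of_real (f x)"
    and x: "x \<in> U"
  shows partials_eq_jet: "complex_of_real (partials js f x) = jet js (embed_real x)"
    and partials_has_derivative:
      "((\<lambda>t. partials js f (x + t *\<^sub>R axis j 1)) has_real_derivative partials (j # js) f x) (at 0)"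
proof -
  have step: "complex_of_real (partials (j # js) f x) = jet (j # js) (embed_real x)
      \<and> ((\<lambda>t. partials js f (x + t *\<^sub>R axis j 1)) has_real_derivative partials (j # js) f x) (at 0)"
    if IH: "\<And>x. x \<in> U \<Longrightarrow> complex_of_real (partials js f x) = jet js (embed_real x)" and x: "x \<in> U" for js j x
  proof -
    obtain \<epsilon> where \<epsilon>: "\<epsilon> > 0" "ball x \<epsilon> \<subseteq> U"
      using U x openE by blast
    have near: "x + t *\<^sub>R axis j 1 \<in> U" if "\<bar>t\<bar> < \<epsilon>" for t
      using \<epsilon>(2) that by (auto simp: subset_iff dist_norm norm_axis)
    have "((\<lambda>t. jet js (embed_real x + t *\<^sub>R axis j 1)) has_vector_derivative jet (j # js) (embed_real x)) (at 0)"
      using near UK by (intro jet_has_derivative [OF _ \<epsilon>(1)]) (auto simp flip: embed_real_add_axis)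
    then have d: "((\<lambda>t. complex_of_real (partials js f (x + t *\<^sub>R axis j 1))) has_vector_derivative jet (j # js) (embed_real x)) (at 0)"
    proof (rule has_vector_derivative_transform_within_open [where S = "{-\<epsilon><..<\<epsilon>}"])
      fix t assume "t \<in> {-\<epsilon><..<\<epsilon>}"
      then have "x + t *\<^sub>R axis j 1 \<in> U"
        by (intro near) auto
      then show "jet js (embed_real x + t *\<^sub>R axis j 1) = complex_of_real (partials js f (x + t *\<^sub>R axis j 1))"
        using IH by (simp add: embed_real_add_axis)
    qed (use \<epsilon> in auto)
    have re: "((\<lambda>t. partials js f (x + t *\<^sub>R axis j 1)) has_real_derivative Re (jet (j # js) (embed_real x))) (at 0)"
      using bounded_linear.has_vector_derivative [OF bounded_linear_Re d]
      by (simp add: has_real_derivative_iff_has_vector_derivative)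
    \<comment> \<open>The jet of \<open>js\<close> is real along the whole segment by hypothesis,
      hence so is its derivative.\<close>
    have "((\<lambda>t. 0::real) has_vector_derivative Im (jet (j # js) (embed_real x))) (at 0)"
      using bounded_linear.has_vector_derivative [OF bounded_linear_Im d] by simp
    then have im: "Im (jet (j # js) (embed_real x)) = 0"
      using has_vector_derivative_const vector_derivative_unique_at by blast
    have "partials (j # js) f x = Re (jet (j # js) (embed_real x))"
      using re by (simp add: partial_def DERIV_imp_deriv)
    then show ?thesis
      using re im by (simp add: complex_eq_iff)
  qed
  have eq: "\<forall>x\<in>U. complex_of_real (partials js f x) = jet js (embed_real x)" for js
  proof (induction js)
    case Nil
    then show ?case using Ff by (simp add: jet_Nil)
  next
    case (Cons j js)
    then show ?case using step by blast
  qed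
  show "complex_of_real (partials js f x) = jet js (embed_real x)"
    using eq x by blast
  show "((\<lambda>t. partials js f (x + t *\<^sub>R axis j 1)) has_real_derivative partials (j # js) f x) (at 0)"
    using step eq x by blast
qed

lemma smooth_on_restriction:
  assumes U: "open U" and UK: "embed_real ` U \<subseteq> K"
    and Ff: "\<And>x. x \<in> U \<Longrightarrow> F (embed_real x) = complex_of_real (f x)"
  shows "smooth_on U f"
  unfolding smooth_on_def
proof (intro allI conjI ballI)
  fix js
  have "continuous_on U (\<lambda>x. Re (jet js (embed_real x)))"
    by (intro continuous_intros continuous_on_compose2 [OF continuous_on_jet]) (rule UK)
  moreover have "Re (jet js (embed_real x)) = partials js f x" if "x \<in> U" for x
    using partials_eq_jet [OF U UK Ff that, of js] by (metis Re_complex_of_real)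
  ultimately show "continuous_on U (partials js f)"
    by (simp cong: continuous_on_cong)
qed (rule partials_has_derivative [OF U UK Ff])

end

lemma extendable_imp_B_class:
  fixes U :: "(real ^ 'n) set"
  assumes W: "weight_matrix W" and U: "open U" "U \<noteq> {}"
    and ext: "M_almost_analytic_extendable W U f"
  shows "f \<in> B_class W U"
proof -
  have main: "smooth_on U f \<and> (\<exists>C. \<forall>x\<in>U. \<forall>js. \<bar>partials js f x\<bar> \<le> C * (\<rho> ^ length js * M (length js)))"
    if M: "M \<in> W" and \<rho>: "\<rho> > 0" for M \<rho>
  proof -
    have wM: "weight_sequence M" using W M by (auto simp: weight_matrix_def)
    then have pos: "M k > 0" for k by (simp add: weight_sequence_def)
    \<comment> \<open>In \<open>rate\<close> the factors \<open>k * 2 ^ k\<close> and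
      \<open>k ^ k\<close> cost \<open>4 ^ k\<close> and \<open>exp 1 ^ k * fact k\<close>; the
      factorial turns \<open>small_seq M k\<close> back into \<open>M k\<close>, and
      \<open>\<sigma>\<close> undoes the rest.\<close>
    define \<sigma> where "\<sigma> = \<rho> / (4 * exp 1)"
    have \<sigma>: "\<sigma> > 0" using \<rho> by (simp add: \<sigma>_def)
    let ?K = "embed_real ` closure U"
    let ?m = "small_seq M"
    obtain F C where F: "C1c F" and C: "C \<ge> 1" and Ff: "\<And>x. x \<in> U \<Longrightarrow> F (embed_real x) = complex_of_real (f x)"
      and h: "\<And>z. norm (dbar F z) \<le> C * h_fun ?m (\<sigma> * infdist z ?K)"
      using ext M \<sigma> unfolding M_almost_analytic_extendable_def almost_analytic_ext_def by blast
    obtain F' where F': "C1_with F F'" and cpt: "compact (closure {z. F z \<noteq> 0})"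
      using F unfolding C1c_def C1_with_def by blast
    have m0: "?m k \<ge> 0" for k
      using pos [of k] by (simp add: small_seq_def)
    interpret flat_dbar F F' ?K "\<lambda>k. C * ?m k * \<sigma> ^ k"
    proof
      fix z l k D assume D: "infdist z ?K \<le> D"
      have "norm (dbar_comp l (F' z)) \<le> norm (dbar F z)"
        by (rule norm_dbar_comp_le [OF F'])
      also have "\<dots> \<le> C * h_fun ?m (\<sigma> * infdist z ?K)"
        by (rule h)
      also have "\<dots> \<le> C * (?m k * (\<sigma> * infdist z ?K) ^ k)"
        using C \<sigma> by (intro mult_left_mono h_fun_le m0) (auto simp: infdist_nonneg)
      also have "\<dots> \<le> C * (?m k * (\<sigma> * D) ^ k)"
        using C \<sigma> D by (intro mult_left_mono power_mono m0) (auto simp: infdist_nonneg)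
      finally show "norm (dbar_comp l (F' z)) \<le> C * ?m k * \<sigma> ^ k * D ^ k"
        by (simp add: power_mult_distrib)
    qed (use F' U in auto)
    have UK: "embed_real ` U \<subseteq> ?K"
      using closure_subset by blast
    obtain S where S: "\<And>w. norm (F w) \<le> S"
    proof -
      have "bounded (F ` closure {z. F z \<noteq> 0})"
        by (intro compact_imp_bounded compact_continuous_image C1_withD(3) [OF F'] cpt)
      then obtain S where S: "\<And>w. w \<in> closure {z. F z \<noteq> 0} \<Longrightarrow> norm (F w) \<le> S"
        unfolding bounded_iff by blast
      have "norm (F w) \<le> max S 0" for w
      proof (cases "F w = 0")
        case False
        then have "w \<in> closure {z. F z \<noteq> 0}"
          by (intro closure_subset [THEN subsetD]) simp
        then show ?thesis using S [of w] by simp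
      qed auto
      then show ?thesis using that by blast
    qed
    have S0: "0 \<le> S" by (rule order_trans [OF norm_ge_zero S])
    \<comment> \<open>Needed to express the bound \<open>S\<close> of \<open>F\<close>, which does
      not depend on the order, as a multiple of the weighted term.\<close>
    obtain c where c: "c > 0" "\<And>k. c \<le> \<rho> ^ k * M k"
    proof -
      have "filterlim (\<lambda>k. root k (M k)) at_top sequentially"
        using wM by (simp add: weight_sequence_def)
      from power_times_weight_bounded_below [OF pos this \<rho>] show ?thesis
        using that by blast
    qed
    have rate: "rate js \<le> C * (\<rho> ^ length js * M (length js))" for js
    proof -
      let ?k = "length js"
      have "real ?k * 2 ^ ?k \<le> 2 ^ ?k * 2 ^ ?k"
        by (intro mult_right_mono) (auto intro: order.strict_implies_order)
      also have "\<dots> = (4::real) ^ ?k"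
        by (simp flip: power_mult_distrib)
      finally have 1: "real ?k * 2 ^ ?k \<le> 4 ^ ?k" .
      have "rate js = (real ?k * 2 ^ ?k) * (real ?k ^ ?k) * (C * ?m ?k * \<sigma> ^ ?k)"
        by (simp add: rate_def)
      also have "\<dots> \<le> 4 ^ ?k * (exp 1 ^ ?k * fact ?k) * (C * ?m ?k * \<sigma> ^ ?k)"
        using C m0 [of ?k] \<sigma> by (intro mult_right_mono mult_mono 1 power_self_le_exp_fact) auto
      also have "\<dots> = C * ((4 * exp 1 * \<sigma>) ^ ?k * M ?k)"
        by (simp add: small_seq_def power_mult_distrib)
      also have "4 * exp 1 * \<sigma> = \<rho>"
        by (simp add: \<sigma>_def)
      finally show ?thesis .
    qed
    have "\<bar>partials js f x\<bar> \<le> (S / c + 2 * C) * (\<rho> ^ length js * M (length js))" if x: "x \<in> U" for x js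
    proof -
      have "\<bar>partials js f x\<bar> = norm (jet js (embed_real x))"
        by (simp flip: partials_eq_jet [OF U(1) UK Ff x])
      also have "\<dots> \<le> S + 2 * rate js"
        using UK x by (intro norm_jet_le S) auto
      also have "\<dots> \<le> S / c * (\<rho> ^ length js * M (length js)) + 2 * (C * (\<rho> ^ length js * M (length js)))"
      proof (intro add_mono mult_left_mono rate)
        have "S / c * c \<le> S / c * (\<rho> ^ length js * M (length js))"
          using c S0 by (intro mult_left_mono) auto
        then show "S \<le> S / c * (\<rho> ^ length js * M (length js))"
          using c by simp
      qed auto
      finally show ?thesis by (simp add: algebra_simps)
    qed
    then show ?thesis
      using smooth_on_restriction [OF U(1) UK Ff] by blast
  qed
  obtain M where M: "M \<in> W" using W by (auto simp: weight_matrix_def)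
  have "smooth_on U f"
    using main [OF M, of 1] by simp
  moreover have "\<exists>C. \<forall>x\<in>U. \<forall>\<alpha>. \<bar>pderiv_mi \<alpha> f x\<bar> \<le> C * (\<rho> ^ mi_order \<alpha> * M (mi_order \<alpha>))"
    if M\<rho>: "M \<in> W" "\<rho> > 0" for M \<rho>
  proof -
    obtain C where C: "\<And>x js. x \<in> U \<Longrightarrow> \<bar>partials js f x\<bar> \<le> C * (\<rho> ^ length js * M (length js))"
      using main [OF M\<rho>] by blast
    have "\<bar>pderiv_mi \<alpha> f x\<bar> \<le> C * (\<rho> ^ mi_order \<alpha> * M (mi_order \<alpha>))" if "x \<in> U" for x \<alpha>
      using C [OF that, of "SOME js. \<forall>j. count (mset js) j = \<alpha> j"]
      by (simp only: pderiv_mi_def length_pderiv_mi_list)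
    then show ?thesis by blast
  qed
  ultimately show ?thesis
    by (simp add: B_class_def)
qed

section \<open>Regular weight matrices and log-convex sequences\<close>

text \<open>By \<open>power_times_weight_bounded_below\<close> with \<open>s/2\<close> the terms
  grow at least like \<open>c * 2 ^ k\<close>, so the infimum is a minimum over finitely many
  indices.\<close>

lemma h_fun_attained:
  assumes pos: "\<And>k. 0 < m k" and lim: "filterlim (\<lambda>k. root k (m k)) at_top sequentially" and s: "s > 0"
  shows "\<exists>k. h_fun m s = m k * s ^ k"
proof -
  obtain c where c: "c > 0" "\<And>k. c \<le> (s/2) ^ k * m k"
    using power_times_weight_bounded_below [OF pos lim, of "s/2"] s by auto
  obtain k1 :: nat where k1: "m 0 / c < 2 ^ k1"
    using real_arch_pow [of 2 "m 0 / c"] by auto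
  have large: "m 0 \<le> m k * s ^ k" if "k \<ge> k1" for k
  proof -
    have "m 0 < c * 2 ^ k1"
      using k1 c by (simp add: field_simps)
    also have "\<dots> \<le> c * 2 ^ k"
      using that c by (intro mult_left_mono power_increasing) auto
    also have "\<dots> \<le> ((s/2) ^ k * m k) * 2 ^ k"
      using c by (intro mult_right_mono) auto
    finally show ?thesis
      by (simp add: power_divide mult.commute)
  qed
  define X where "X = (\<lambda>k. m k * s ^ k) ` {..k1}"
  have fX: "finite X" "X \<noteq> {}" by (auto simp: X_def)
  obtain k where k: "Min X = m k * s ^ k"
  proof -
    have "Min X \<in> (\<lambda>k. m k * s ^ k) ` {..k1}"
      using Min_in [OF fX] unfolding X_def .
    then show ?thesis
      using that by blast
  qed
  have le: "m k * s ^ k \<le> m i * s ^ i" if "i \<le> k1" for i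
    unfolding k [symmetric] using that by (intro Min_le [OF fX(1)]) (auto simp: X_def)
  have "m k * s ^ k \<le> m i * s ^ i" for i
  proof (cases "i \<le> k1")
    case True
    then show ?thesis
      by (rule le)
  next
    case False
    have "m k * s ^ k \<le> m 0 * s ^ 0"
      by (rule le) simp
    then show ?thesis using large [of i] False by simp
  qed
  then have "(INF k. m k * s ^ k) = m k * s ^ k"
    by (intro cInf_eq_minimum) auto
  then show ?thesis
    using s by (auto simp: h_fun_def)
qed

lemma small_seq_pos: "weight_sequence M \<Longrightarrow> 0 < small_seq M k"
  by (simp add: small_seq_def weight_sequence_def)

lemma B_regularD:
  assumes "B_regular W" "M \<in> W"
  shows "weight_sequence M" "filterlim (\<lambda>k. root k (small_seq M k)) at_top sequentially"
    "\<exists>N\<in>W. \<exists>C\<ge>1. \<forall>j. N (j + 1) \<le> C ^ j * M j"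
    "\<exists>N\<in>W. \<exists>C\<ge>1. \<forall>t>0. Gamma_over (small_seq M) (C * t) \<le> Gamma_under (small_seq N) t"
  using assms by (auto simp: B_regular_def weight_matrix_def)

text \<open>Condition (3) applied \<open>K\<close> times. Using it at index \<open>j + K\<close>
  leaves \<open>C ^ K\<close>, whence the separate constant \<open>E\<close>.\<close>

lemma iterated_derivation_closed:
  assumes W: "B_regular W" and M: "M \<in> W"
  shows "\<exists>N\<in>W. \<exists>D\<ge>1. \<exists>E\<ge>1. \<forall>j. N (j + K) \<le> E * D ^ j * M j"
proof (induction K)
  case 0
  show ?case
    using M by (intro bexI [of _ M] exI [of _ 1]) auto
next
  case (Suc K)
  then obtain N D E where N: "N \<in> W" "D \<ge> 1" "E \<ge> 1" "\<And>j. N (j + K) \<le> E * D ^ j * M j"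
    by blast
  obtain N' C where N': "N' \<in> W" "C \<ge> 1" "\<And>j. N' (j + 1) \<le> C ^ j * N j"
    using B_regularD(3) [OF W N(1)] by blast
  have "N' (j + Suc K) \<le> (C ^ K * E) * (C * D) ^ j * M j" for j
  proof -
    have "N' (j + Suc K) \<le> C ^ (j + K) * N (j + K)"
      using N'(3) [of "j + K"] by simp
    also have "\<dots> \<le> C ^ (j + K) * (E * D ^ j * M j)"
      using N'(2) N(4) by (intro mult_left_mono) auto
    finally show ?thesis
      by (simp add: power_add power_mult_distrib mult_ac)
  qed
  moreover have "C * D \<ge> 1" "C ^ K * E \<ge> 1"
    using N N' by (auto intro: order_trans [OF _ mult_mono [of 1 _ 1]])
  ultimately show ?case
    using N'(1) by blast
qed

text \<open>Condition (4) says that the increasing hull of the ratios of \<open>n\<close>, rescaled, still generates a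
  sequence below \<open>m\<close>.\<close>

lemma log_convex_between:
  assumes W: "B_regular W" and M: "M \<in> W"
  shows "\<exists>N\<in>W. \<exists>C\<ge>1. \<exists>l. l 0 = 1 \<and> (\<forall>k. 0 < l k) \<and> mono (\<lambda>k. l (Suc k) / l k) \<and>
     (\<forall>k. small_seq N k \<le> C ^ k * l k) \<and> (\<forall>k. l k \<le> small_seq M k)"
proof -
  obtain N C where N: "N \<in> W" "C \<ge> 1"
    and \<Gamma>: "\<And>t. t > 0 \<Longrightarrow> Gamma_over (small_seq M) (C * t) \<le> Gamma_under (small_seq N) t"
    using B_regularD(4) [OF W M] by blast
  let ?m = "small_seq M" and ?n = "small_seq N"
  have m: "?m k > 0" and n: "?n k > 0" for k
    using B_regularD(1) [OF W M] B_regularD(1) [OF W N(1)] by (auto intro: small_seq_pos)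
  define r where "r k = Max ((\<lambda>i. ?n (Suc i) / ?n i) ` {..k})" for k
  have r_mono: "r i \<le> r k" if "i \<le> k" for i k
    unfolding r_def using that by (intro Max_mono) auto
  have r_ge: "?n (Suc k) / ?n k \<le> r k" for k
    unfolding r_def by (intro Max_ge) auto
  have r_pos: "r k > 0" for k
    using r_ge [of k] n by (smt (verit) divide_pos_pos)
  define l where "l k = (\<Prod>i<k. r i / C)" for k
  have l_pos: "l k > 0" for k
    unfolding l_def using r_pos N(2) by (intro prod_pos) auto
  have l_Suc: "l (Suc k) / l k = r k / C" for k
  proof -
    have "l (Suc k) = l k * (r k / C)"
      by (simp add: l_def)
    then show ?thesis
      using l_pos [of k] by simp
  qed
  have "?n k \<le> C ^ k * l k" for k
  proof (induction k)
    case 0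
    then show ?case
      using B_regularD(1) [OF W N(1)] by (simp add: l_def small_seq_def weight_sequence_def)
  next
    case (Suc k)
    have "?n (Suc k) = ?n (Suc k) / ?n k * ?n k"
      using n [of k] by simp
    also have "\<dots> \<le> r k * (C ^ k * l k)"
      using r_ge r_pos [of k] n [of k] Suc by (intro mult_mono) (auto intro: less_imp_le)
    also have "\<dots> = C ^ Suc k * l (Suc k)"
      using N(2) by (simp add: l_def)
    finally show ?case .
  qed
  moreover have "l k \<le> ?m k" for k
  proof (induction k rule: less_induct)
    case (less k)
    show ?case
    proof (cases k)
      case 0
      then show ?thesis
        using B_regularD(1) [OF W M] by (simp add: l_def small_seq_def weight_sequence_def)
    next
      case (Suc k')
      \<comment> \<open>The hull \<open>r k'\<close> is an actual ratio of \<open>?n\<close> at some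
        index \<open>i \<le> k'\<close>; this is what bounds \<open>Gamma_under\<close> from
        above.\<close>
      have "r k' \<in> (\<lambda>i. ?n (Suc i) / ?n i) ` {..k'}"
        unfolding r_def by (intro Max_in) auto
      then obtain i where i: "i \<le> k'" "r k' = ?n (Suc i) / ?n i"
        by auto
      \<comment> \<open>Condition (4) is used at \<open>t = 1 / r k'\<close>, with
        \<open>s = C * t\<close>: the minimiser \<open>j\<close> for \<open>?m\<close> at
        \<open>s\<close> lies at or before \<open>i\<close>, hence strictly before \<open>k\<close>,
        where the induction hypothesis is available.\<close>
      define s where "s = C / r k'"
      have s: "s > 0" using r_pos N(2) by (simp add: s_def)
      define j where "j = Gamma_over ?m s"
      have "j \<le> Gamma_under ?n (1 / r k')"
        using \<Gamma> [of "1 / r k'"] r_pos [of k'] by (simp add: j_def s_def)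
      also have "\<dots> \<le> i"
        unfolding Gamma_under_def using i by (intro Least_le) auto
      finally have jk: "j < k"
        using i Suc by simp
      have "h_fun ?m s = ?m j * s ^ j"
        unfolding j_def Gamma_over_def
        by (rule LeastI_ex [OF h_fun_attained [OF m B_regularD(2) [OF W M] s]])
      then have "?m j * s ^ j \<le> ?m k * s ^ k"
        using h_fun_le [of ?m s k] m s by (simp add: less_imp_le)
      also have "s ^ k = s ^ j * s ^ (k - j)"
        using jk by (simp flip: power_add)
      finally have "?m j \<le> ?m k * s ^ (k - j)"
        using s by (simp add: mult_ac)
      then have 1: "?m j * (r k' / C) ^ (k - j) \<le> ?m k"
        using s r_pos [of k'] N(2) by (simp add: s_def field_simps)
      \<comment> \<open>From \<open>j\<close> to \<open>k\<close> all ratios of \<open>l\<close> are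
        at most \<open>r k' / C = 1 / s\<close>, while minimality of \<open>j\<close> says that
        \<open>?m\<close> grows at least by \<open>1 / s\<close> per step on average.\<close>
      have "l k = l j * (\<Prod>i\<in>{j..<k}. r i / C)"
        unfolding l_def using jk by (subst prod.union_disjoint [symmetric]) (auto intro!: prod.cong)
      also have "\<dots> \<le> ?m j * (\<Prod>i\<in>{j..<k}. r k' / C)"
        using less.IH [OF jk] l_pos m [of j] N(2) r_pos Suc
        by (intro mult_mono prod_mono prod_nonneg) (auto intro!: divide_right_mono r_mono simp: less_imp_le)
      also have "\<dots> \<le> ?m k"
        using 1 by simp
      finally show ?thesis .
    qed
  qed
  moreover have "mono (\<lambda>k. l (Suc k) / l k)"
    unfolding l_Suc using r_mono N(2) by (intro monoI divide_right_mono) auto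
  ultimately show ?thesis
    using N l_pos by (intro bexI [of _ N] exI [of _ C] conjI exI [of _ l]) (auto simp: l_def)
qed

text \<open>Condition (3) is applied first and the log-convex sequence is inserted below the shifted
  weight, so that \<open>l\<close> itself inherits the shift by \<open>K\<close>. Bounded ratios
  would make \<open>l\<close>, and with it \<open>small_seq N\<close>, at most geometric, against
  condition (0).\<close>

lemma regular_log_convex_minorant:
  assumes W: "B_regular W" and M: "M \<in> W"
  shows "\<exists>l. \<exists>N\<in>W. \<exists>C>0. \<exists>D>0. \<exists>E>0. l 0 = 1 \<and> (\<forall>k. 0 < l k) \<and> mono (\<lambda>k. l (Suc k) / l k) \<and>
     (\<forall>R. \<exists>k. R \<le> l (Suc k) / l k) \<and>
     (\<forall>k. N k \<le> C ^ k * fact k * l k) \<and> (\<forall>j. l (j + K) \<le> E * D ^ j * small_seq M j)"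
proof -
  obtain M' D E where M': "M' \<in> W" "D \<ge> 1" "E \<ge> 1" "\<And>j. M' (j + K) \<le> E * D ^ j * M j"
    using iterated_derivation_closed [OF W M] by blast
  obtain N C l where N: "N \<in> W" "C \<ge> 1" and l: "l 0 = 1" "\<forall>k. 0 < l k" "mono (\<lambda>k. l (Suc k) / l k)"
     "\<forall>k. small_seq N k \<le> C ^ k * l k" "\<forall>k. l k \<le> small_seq M' k"
    using log_convex_between [OF W M'(1)] by (elim bexE exE conjE)
  note l = l(1) l(2) [rule_format] l(3) l(4) [rule_format] l(5) [rule_format]
  have "l (j + K) \<le> E * D ^ j * small_seq M j" for j
  proof -
    have "M' (j + K) \<ge> 0"
      using B_regularD(1) [OF W M'(1)] by (simp add: weight_sequence_def less_imp_le)
    have "l (j + K) \<le> M' (j + K) / fact (j + K)"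
      using l(5) by (simp add: small_seq_def)
    also have "\<dots> \<le> M' (j + K) / fact j"
      using \<open>M' (j + K) \<ge> 0\<close> by (intro divide_left_mono fact_mono) auto
    also have "\<dots> \<le> E * D ^ j * M j / fact j"
      by (intro divide_right_mono M') auto
    finally show ?thesis by (simp add: small_seq_def)
  qed
  moreover have "\<exists>k. R \<le> l (Suc k) / l k" for R
  proof (rule ccontr)
    assume "\<nexists>k. R \<le> l (Suc k) / l k"
    then have R: "l (Suc k) \<le> R * l k" for k
    proof -
      have "l (Suc k) / l k < R"
        using \<open>\<nexists>k. R \<le> l (Suc k) / l k\<close> not_le by blast
      then show ?thesis
        using l(2) [of k] by (simp add: pos_divide_less_eq)
    qed
    have R0: "R > 0"
      using R [of 0] l(1) l(2) [of 1] by auto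
    have lR: "l k \<le> R ^ k" for k
    proof (induction k)
      case (Suc k)
      then show ?case
        using order_trans [OF R mult_left_mono [OF Suc, of R]] R0 by simp
    qed (simp add: l)
    \<comment> \<open>\<open>small_seq N k \<le> (C * R) ^ k\<close>; the extra 2 turns this into
      decay like \<open>(1/2) ^ k\<close>.\<close>
    obtain c where c: "c > 0" "\<And>k. c \<le> (1 / (2 * C * R)) ^ k * small_seq N k"
      using power_times_weight_bounded_below [OF small_seq_pos [OF B_regularD(1) [OF W N(1)]] B_regularD(2) [OF W N(1)], of "1 / (2 * C * R)"]
        R0 N(2) by auto
    have "c \<le> (1/2) ^ k" for k
    proof -
      have "c \<le> (1 / (2 * C * R)) ^ k * (C ^ k * R ^ k)"
        using c(2) [of k] order_trans [OF l(4) mult_left_mono [OF lR, of "C ^ k"]] N(2) R0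
        by (smt (verit) mult_left_mono zero_le_divide_1_iff zero_le_mult_iff zero_le_power)
      also have "\<dots> = (1/2) ^ k"
        using N(2) R0 by (simp flip: power_mult_distrib)
      finally show ?thesis .
    qed
    moreover obtain k where "(1/2) ^ k < c"
      using real_arch_pow_inv [OF c(1), of "1/2"] by auto
    ultimately show False
      by (metis not_le)
  qed
  moreover have "N k \<le> C ^ k * fact k * l k" for k
    using l(4) [of k] by (simp add: small_seq_def field_simps)
  ultimately show ?thesis
    using N M' l(1-3)
    by (intro exI [of _ l] bexI [of _ N] exI [of _ C] conjI exI [of _ D] exI [of _ E]) auto
qed

section \<open>Minimal terms of a log-convex sequence\<close>

locale log_convex_seq =
  fixes l :: "nat \<Rightarrow> real"
  assumes l_0: "l 0 = 1" and l_pos: "\<And>k. 0 < l k" and ratio_mono: "mono (\<lambda>k. l (Suc k) / l k)"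
    and ratio_unbounded: "\<And>R. \<exists>k. R \<le> l (Suc k) / l k"
begin

text \<open>This is \<open>Gamma_under l\<close>. Because the ratios increase,
  \<open>l k * t ^ k\<close> decreases up to this index and increases afterwards, so it is also a
  minimiser and plays the role of \<open>Gamma_over\<close>.\<close>

definition opt :: "real \<Rightarrow> nat" where
  "opt t = (LEAST k. 1 / t \<le> l (Suc k) / l k)"

lemma ratio_opt: "opt t \<le> k \<Longrightarrow> 1 / t \<le> l (Suc k) / l k"
  using LeastI_ex [OF ratio_unbounded [of "1 / t"]] monoD [OF ratio_mono, of "opt t" k]
  unfolding opt_def by linarith

lemma ratio_below_opt: "k < opt t \<Longrightarrow> l (Suc k) / l k < 1 / t"
  unfolding opt_def using not_less_Least by fastforce

lemma opt_antimono: "0 < s \<Longrightarrow> s \<le> t \<Longrightarrow> opt t \<le> opt s"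
  unfolding opt_def [of t]
  by (intro Least_le order_trans [OF _ ratio_opt [of s]]) (auto simp: frac_le)

lemma opt_ge: "0 < t \<Longrightarrow> l (Suc k) / l k < 1 / t \<Longrightarrow> Suc k \<le> opt t"
  using ratio_opt [of t k] by (meson not_less not_less_eq_eq)

lemma decreasing_below_opt:
  assumes t: "t > 0" and "i \<le> k" "k \<le> opt t"
  shows "l k * t ^ k \<le> l i * t ^ i"
  using assms(2,3)
proof (induction k rule: dec_induct)
  case (step k)
  have "l (Suc k) * t \<le> l k"
    using ratio_below_opt [of k t] step t l_pos [of k] by (simp add: field_simps)
  then have "l (Suc k) * t * t ^ k \<le> l k * t ^ k"
    using t by (intro mult_right_mono) auto
  then show ?case
    using step by (simp add: mult_ac)
qed simp

lemma increasing_above_opt: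
  assumes t: "t > 0" and "i \<le> k" "opt t \<le> i"
  shows "l i * t ^ i \<le> l k * t ^ k"
  using assms(2)
proof (induction k rule: dec_induct)
  case (step k)
  have "l k \<le> l (Suc k) * t"
    using ratio_opt [of t k] step assms(3) t l_pos [of k] by (simp add: field_simps)
  then have "l k * t ^ k \<le> l (Suc k) * t * t ^ k"
    using t by (intro mult_right_mono) auto
  then show ?case
    using step by (simp add: mult_ac)
qed simp

definition opt_val :: "real \<Rightarrow> real" where
  "opt_val t = l (opt t) * t ^ opt t"

lemma opt_val_le: "t > 0 \<Longrightarrow> opt_val t \<le> l k * t ^ k"
  unfolding opt_val_def
  using decreasing_below_opt [of t k "opt t"] increasing_above_opt [of t "opt t" k] by linarith

lemma opt_val_nonneg: "t > 0 \<Longrightarrow> opt_val t \<ge> 0"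
  using l_pos by (simp add: opt_val_def less_imp_le)

text \<open>These are the indices of the Taylor terms that are added when the scale drops from
  \<open>t\<close> to \<open>s\<close>. At scale \<open>s\<close> the terms still decrease there, so
  the first one, of index \<open>opt t\<close>, dominates.\<close>

lemma between_opts_le:
  assumes "0 < s" "s \<le> t" "opt t \<le> k" "k \<le> opt s"
  shows "l k * s ^ k \<le> opt_val t"
proof -
  have "l k * s ^ k \<le> l (opt t) * s ^ opt t"
    using assms by (intro decreasing_below_opt) auto
  also have "\<dots> \<le> opt_val t"
    unfolding opt_val_def using assms l_pos by (intro mult_left_mono power_mono) (auto simp: less_imp_le)
  finally show ?thesis .
qed

end

section \<open>Complexified Taylor polynomials\<close>

lemma axis_derivative_shift:
  fixes y v :: "'a::real_normed_vector"
  assumes g: "\<And>y. y \<in> U \<Longrightarrow> ((\<lambda>t. g (y + t *\<^sub>R v)) has_vector_derivative g' y) (at 0)"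
    and "y + s *\<^sub>R v \<in> U"
  shows "((\<lambda>t. g (y + t *\<^sub>R v)) has_vector_derivative g' (y + s *\<^sub>R v)) (at s within S)"
proof -
  have 1: "((\<lambda>t. t - s) has_vector_derivative 1) (at s within S)"
    by (auto intro!: derivative_eq_intros simp: has_vector_derivative_def)
  have "((\<lambda>t. g (y + s *\<^sub>R v + t *\<^sub>R v)) has_vector_derivative g' (y + s *\<^sub>R v)) (at (s - s) within (\<lambda>t. t - s) ` S)"
    using g [OF assms(2)] by (simp add: has_vector_derivative_at_within)
  note vector_derivative_diff_chain_within [OF 1 this[unfolded has_vector_derivative_def]]
  moreover have "y + s *\<^sub>R v + (t - s) *\<^sub>R v = y + t *\<^sub>R v" for t
    by (simp add: scaleR_left_diff_distrib)
  ultimately show ?thesis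
    by (simp add: o_def has_vector_derivative_def)
qed

lemma axis_derivative_shift_real:
  fixes g :: "'a::real_normed_vector \<Rightarrow> real"
  assumes g: "\<And>y. y \<in> U \<Longrightarrow> ((\<lambda>t. g (y + t *\<^sub>R v)) has_real_derivative g' y) (at 0)"
    and "y + s *\<^sub>R v \<in> U"
  shows "((\<lambda>t. g (y + t *\<^sub>R v)) has_real_derivative g' (y + s *\<^sub>R v)) (at s)"
  using axis_derivative_shift [of U g v g' y s UNIV] assms
  by (simp add: has_real_derivative_iff_has_vector_derivative)

lemma second_difference:
  fixes g :: "'a::real_normed_vector \<Rightarrow> real"
  assumes g: "\<And>y. y \<in> U \<Longrightarrow> ((\<lambda>t. g (y + t *\<^sub>R u)) has_real_derivative g' y) (at 0)"
    and g': "\<And>y. y \<in> U \<Longrightarrow> ((\<lambda>t. g' (y + t *\<^sub>R v)) has_real_derivative g'' y) (at 0)"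
    and h: "h > 0" and box: "\<And>s t. 0 \<le> s \<Longrightarrow> s \<le> h \<Longrightarrow> 0 \<le> t \<Longrightarrow> t \<le> h \<Longrightarrow> x + s *\<^sub>R u + t *\<^sub>R v \<in> U"
  shows "\<exists>s t. 0 < s \<and> s < h \<and> 0 < t \<and> t < h \<and>
    g (x + h *\<^sub>R u + h *\<^sub>R v) - g (x + h *\<^sub>R u) - g (x + h *\<^sub>R v) + g x = h\<^sup>2 * g'' (x + s *\<^sub>R u + t *\<^sub>R v)"
proof -
  have c: "x + t *\<^sub>R v + s *\<^sub>R u = x + s *\<^sub>R u + t *\<^sub>R v" for s t
    by simp
  have "\<exists>s>0. s < h \<and> (g (x + h *\<^sub>R v + h *\<^sub>R u) - g (x + h *\<^sub>R u)) - (g (x + h *\<^sub>R v + 0 *\<^sub>R u) - g (x + 0 *\<^sub>R u))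
      = (h - 0) * (g' (x + h *\<^sub>R v + s *\<^sub>R u) - g' (x + s *\<^sub>R u))"
  proof (rule MVT2 [OF h])
    fix s assume s: "0 \<le> s" "s \<le> h"
    show "((\<lambda>s. g (x + h *\<^sub>R v + s *\<^sub>R u) - g (x + s *\<^sub>R u)) has_real_derivative
       g' (x + h *\<^sub>R v + s *\<^sub>R u) - g' (x + s *\<^sub>R u)) (at s)"
      using box [of s h] box [of s 0] s h
      by (intro DERIV_diff axis_derivative_shift_real [OF g]) (auto simp: c)
  qed
  then obtain s where s: "0 < s" "s < h" and 1: "(g (x + h *\<^sub>R v + h *\<^sub>R u) - g (x + h *\<^sub>R u)) - (g (x + h *\<^sub>R v + 0 *\<^sub>R u) - g (x + 0 *\<^sub>R u))
      = (h - 0) * (g' (x + h *\<^sub>R v + s *\<^sub>R u) - g' (x + s *\<^sub>R u))"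
    by blast
  have "\<exists>t>0. t < h \<and> g' (x + s *\<^sub>R u + h *\<^sub>R v) - g' (x + s *\<^sub>R u + 0 *\<^sub>R v) = (h - 0) * g'' (x + s *\<^sub>R u + t *\<^sub>R v)"
  proof (rule MVT2 [OF h])
    fix t assume t: "0 \<le> t" "t \<le> h"
    show "((\<lambda>t. g' (x + s *\<^sub>R u + t *\<^sub>R v)) has_real_derivative g'' (x + s *\<^sub>R u + t *\<^sub>R v)) (at t)"
      using box [of s t] s t by (intro axis_derivative_shift_real [OF g']) auto
  qed
  then obtain t where t: "0 < t" "t < h" and 2: "g' (x + s *\<^sub>R u + h *\<^sub>R v) - g' (x + s *\<^sub>R u + 0 *\<^sub>R v) = (h - 0) * g'' (x + s *\<^sub>R u + t *\<^sub>R v)"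
    by blast
  show ?thesis
    using 1 2 s t
    by (intro exI [of _ s] exI [of _ t]) (simp add: c power2_eq_square algebra_simps)
qed

text \<open>Schwarz's theorem: the same second difference over a small square equals
  \<open>h\<^sup>2\<close> times either mixed derivative at some point of the square, and continuity
  lets the square shrink.\<close>

lemma mixed_derivatives_eq:
  fixes g :: "'a::real_normed_vector \<Rightarrow> real"
  assumes U: "open U" "x \<in> U"
    and g1: "\<And>y. y \<in> U \<Longrightarrow> ((\<lambda>t. g (y + t *\<^sub>R u)) has_real_derivative gu y) (at 0)"
    and g2: "\<And>y. y \<in> U \<Longrightarrow> ((\<lambda>t. gu (y + t *\<^sub>R v)) has_real_derivative gvu y) (at 0)"
    and g3: "\<And>y. y \<in> U \<Longrightarrow> ((\<lambda>t. g (y + t *\<^sub>R v)) has_real_derivative gv y) (at 0)"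
    and g4: "\<And>y. y \<in> U \<Longrightarrow> ((\<lambda>t. gv (y + t *\<^sub>R u)) has_real_derivative guv y) (at 0)"
    and c: "continuous_on U gvu" "continuous_on U guv"
  shows "guv x = gvu x"
proof (rule ccontr)
  assume ne: "guv x \<noteq> gvu x"
  define e where "e = \<bar>guv x - gvu x\<bar> / 2"
  have e: "e > 0" using ne by (simp add: e_def)
  obtain d0 where d0: "d0 > 0" "ball x d0 \<subseteq> U"
    using U openE by blast
  obtain d1 where d1: "d1 > 0" "\<And>y. y \<in> U \<Longrightarrow> dist y x < d1 \<Longrightarrow> dist (gvu y) (gvu x) < e"
    using c(1) U(2) e unfolding continuous_on_iff by blast
  obtain d2 where d2: "d2 > 0" "\<And>y. y \<in> U \<Longrightarrow> dist y x < d2 \<Longrightarrow> dist (guv y) (guv x) < e"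
    using c(2) U(2) e unfolding continuous_on_iff by blast
  define d where "d = min d0 (min d1 d2)"
  define N where "N = norm u + norm v + 1"
  define h where "h = d / N / 2"
  have d: "d > 0" using d0 d1 d2 by (simp add: d_def)
  have n: "N > 0"
    by (simp add: N_def add_nonneg_pos)
  have h: "h > 0" using d n by (simp add: h_def)
  have near: "dist (x + s *\<^sub>R u + t *\<^sub>R v) x < d" if "0 \<le> s" "s \<le> h" "0 \<le> t" "t \<le> h" for s t
  proof -
    have "dist (x + s *\<^sub>R u + t *\<^sub>R v) x = norm (s *\<^sub>R u + t *\<^sub>R v)"
      by (simp add: dist_norm algebra_simps)
    also have "\<dots> \<le> s * norm u + t * norm v"
      using norm_triangle_ineq [of "s *\<^sub>R u" "t *\<^sub>R v"] that by simp
    also have "\<dots> \<le> h * norm u + h * norm v"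
      using that by (intro add_mono mult_right_mono) auto
    also have "\<dots> \<le> h * N"
      using h by (simp add: N_def algebra_simps)
    also have "\<dots> < d"
      using d n by (simp add: h_def)
    finally show ?thesis .
  qed
  have inU: "y \<in> U" if "dist y x < d" for y
    using d0(2) that by (auto simp: d_def dist_commute)
  obtain s t where st: "0 < s" "s < h" "0 < t" "t < h" and
     1: "g (x + h *\<^sub>R u + h *\<^sub>R v) - g (x + h *\<^sub>R u) - g (x + h *\<^sub>R v) + g x = h\<^sup>2 * gvu (x + s *\<^sub>R u + t *\<^sub>R v)"
    using second_difference [OF g1 g2 h, where U = U and x = x] inU near by blast
  have near': "dist (x + t *\<^sub>R v + s *\<^sub>R u) x < d" if "0 \<le> s" "s \<le> h" "0 \<le> t" "t \<le> h" for s t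
    using near [OF that] by (simp add: add.commute add.left_commute)
  obtain s' t' where st': "0 < s'" "s' < h" "0 < t'" "t' < h" and
     2: "g (x + h *\<^sub>R v + h *\<^sub>R u) - g (x + h *\<^sub>R v) - g (x + h *\<^sub>R u) + g x = h\<^sup>2 * guv (x + t' *\<^sub>R v + s' *\<^sub>R u)"
    using second_difference [OF g3 g4 h, where U = U and x = x] inU near' by blast
  have "h\<^sup>2 * gvu (x + s *\<^sub>R u + t *\<^sub>R v) = h\<^sup>2 * guv (x + t' *\<^sub>R v + s' *\<^sub>R u)"
  proof -
    have "x + h *\<^sub>R v + h *\<^sub>R u = x + h *\<^sub>R u + h *\<^sub>R v"
      by simp
    then have "g (x + h *\<^sub>R v + h *\<^sub>R u) = g (x + h *\<^sub>R u + h *\<^sub>R v)"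
      by (rule arg_cong)
    then show ?thesis
      using 1 2 by linarith
  qed
  then have "gvu (x + s *\<^sub>R u + t *\<^sub>R v) = guv (x + t' *\<^sub>R v + s' *\<^sub>R u)"
    using h by simp
  moreover have "dist (gvu (x + s *\<^sub>R u + t *\<^sub>R v)) (gvu x) < e"
    using near [of s t] st by (intro d1 inU) (auto simp: d_def)
  moreover have "dist (guv (x + t' *\<^sub>R v + s' *\<^sub>R u)) (guv x) < e"
    using near' [of s' t'] st' by (intro d2 inU) (auto simp: d_def)
  ultimately show False
    by (simp add: e_def dist_real_def abs_if split: if_splits)
qed

lemma smooth_onD:
  assumes "smooth_on U f"
  shows "continuous_on U (partials js f)"
    and "x \<in> U \<Longrightarrow> ((\<lambda>t. partials js f (x + t *\<^sub>R axis j 1)) has_real_derivative partials (j # js) f x) (at 0)"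
  using assms unfolding smooth_on_def by blast+

lemma eventually_axis_in_open:
  fixes x v :: "'a::real_normed_vector"
  assumes "open U" "x \<in> U"
  shows "\<forall>\<^sub>F t in nhds 0. x + t *\<^sub>R v \<in> U"
proof -
  have "((\<lambda>t. x + t *\<^sub>R v) \<longlongrightarrow> x + 0 *\<^sub>R v) (nhds (0::real))"
    by (intro tendsto_add tendsto_const tendsto_scaleR filterlim_ident)
  then show ?thesis
    using assms by (auto dest: topological_tendstoD)
qed

lemma partials_cong_on:
  assumes f: "smooth_on U f" and U: "open U"
    and eq: "\<And>x. x \<in> U \<Longrightarrow> partials js f x = partials js' f x" and x: "x \<in> U"
  shows "partials (j # js) f x = partials (j # js') f x"
proof (rule DERIV_unique)
  show "((\<lambda>t. partials js f (x + t *\<^sub>R axis j 1)) has_real_derivative partials (j # js) f x) (at 0)"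
    by (rule smooth_onD(2) [OF f x])
  have "\<forall>\<^sub>F t in nhds 0. partials js f (x + t *\<^sub>R axis j 1) = partials js' f (x + t *\<^sub>R axis j 1)"
    using eventually_axis_in_open [OF U x] by eventually_elim (rule eq)
  then show "((\<lambda>t. partials js f (x + t *\<^sub>R axis j 1)) has_real_derivative partials (j # js') f x) (at 0)"
    using smooth_onD(2) [OF f x] by (subst DERIV_cong_ev [OF refl _ refl])
qed

lemma partials_move_front:
  assumes f: "smooth_on U f" and U: "open U" and x: "x \<in> U"
  shows "partials (bs @ a # cs) f x = partials (a # bs @ cs) f x"
  using x
proof (induction bs arbitrary: x)
  case (Cons b bs)
  have "partials (b # (bs @ a # cs)) f x = partials (b # (a # bs @ cs)) f x"
    using Cons by (intro partials_cong_on [OF f U]) auto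
  also have "\<dots> = partials (a # b # (bs @ cs)) f x"
    by (rule mixed_derivatives_eq [OF U Cons.prems smooth_onD(2) [OF f] smooth_onD(2) [OF f]
          smooth_onD(2) [OF f] smooth_onD(2) [OF f] smooth_onD(1) [OF f] smooth_onD(1) [OF f]])
  finally show ?case by simp
qed simp

text \<open>Lets derivatives indexed by lists be compared with \<open>pderiv_mi\<close>, whose list
  is an arbitrary choice, and makes \<open>jet_form\<close> symmetric.\<close>

lemma partials_permute:
  assumes f: "smooth_on U f" and U: "open U" and x: "x \<in> U" and m: "mset js = mset js'"
  shows "partials js f x = partials js' f x"
  using x m
proof (induction js arbitrary: x js')
  case (Cons a as)
  have "a \<in> set js'"
    using Cons.prems(2) by (metis list.set_intros(1) set_mset_mset)
  then obtain bs cs where js': "js' = bs @ a # cs"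
    by (meson split_list)
  have "partials (a # as) f x = partials (a # (bs @ cs)) f x"
    using Cons by (intro partials_cong_on [OF f U]) (auto simp: js')
  then show ?case
    using partials_move_front [OF f U Cons.prems(1), of bs a cs] by (simp add: js')
qed simp

text \<open>The \<open>k\<close>-th derivative of \<open>partials js f\<close> as a homogeneous
  form, evaluated at a complex vector. It sums over ordered lists of coordinates instead of
  multi-indices, so Taylor coefficients carry \<open>1 / fact k\<close> only.\<close>

fun jet_form :: "nat \<Rightarrow> 'n::finite list \<Rightarrow> (real ^ 'n \<Rightarrow> real) \<Rightarrow> real ^ 'n \<Rightarrow> complex ^ 'n \<Rightarrow> complex" where
  "jet_form 0 js f x w = complex_of_real (partials js f x)"
| "jet_form (Suc k) js f x w = (\<Sum>j\<in>UNIV. w $ j * jet_form k (j # js) f x w)"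

definition taylor :: "nat \<Rightarrow> 'n::finite list \<Rightarrow> (real ^ 'n \<Rightarrow> real) \<Rightarrow> real ^ 'n \<Rightarrow> complex ^ 'n \<Rightarrow> complex" where
  "taylor p js f x z = (\<Sum>k\<le>p. jet_form k js f x (z - embed_real x) / fact k)"

lemma jet_form_bound:
  fixes w :: "complex ^ 'n::finite"
  assumes "\<And>js'. length js' = k + length js \<Longrightarrow> \<bar>partials js' f x\<bar> \<le> B"
  shows "norm (jet_form k js f x w) \<le> (real CARD('n) * norm w) ^ k * B"
  using assms
proof (induction k arbitrary: js)
  case (Suc k)
  have "norm (jet_form (Suc k) js f x w) \<le> (\<Sum>j\<in>(UNIV::'n set). norm w * ((real CARD('n) * norm w) ^ k * B))"
    unfolding jet_form.simps
  proof (rule sum_norm_le)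
    fix j :: 'n
    show "norm (w $ j * jet_form k (j # js) f x w) \<le> norm w * ((real CARD('n) * norm w) ^ k * B)"
      unfolding norm_mult
      by (intro mult_mono Finite_Cartesian_Product.norm_nth_le Suc.IH Suc.prems) auto
  qed
  then show ?case by (simp add: mult_ac)
qed simp

context
  fixes f :: "real ^ 'n::finite \<Rightarrow> real" and U :: "(real ^ 'n) set"
  assumes f: "smooth_on U f" and U: "open U"
begin

lemma jet_form_permute:
  assumes x: "x \<in> U" and m: "mset js = mset js'"
  shows "jet_form k js f x w = jet_form k js' f x w"
  using m
proof (induction k arbitrary: js js')
  case 0
  show ?case
    using partials_permute [OF f U x 0] by simp
next
  case (Suc k)
  have "jet_form k (j # js) f x w = jet_form k (j # js') f x w" for j
    by (rule Suc.IH) (simp add: Suc.prems)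
  then show ?case by simp
qed

text \<open>By symmetry the slot \<open>j\<close> can be contracted with \<open>w\<close> as if it
  were innermost, which raises the degree by one. At \<open>k = 0\<close> the truncated
  \<open>k - 1\<close> is harmless because of the factor \<open>of_nat k\<close>.\<close>

lemma sum_jet_form_swap:
  assumes x: "x \<in> U"
  shows "(\<Sum>j\<in>UNIV. w $ j * (of_nat k * jet_form (k - 1) (i # j # js) f x w)) = of_nat k * jet_form k (i # js) f x w"
proof (cases k)
  case (Suc k')
  have "jet_form k' (i # j # js) f x w = jet_form k' (j # i # js) f x w" for j
    by (rule jet_form_permute [OF x]) simp
  then show ?thesis
    unfolding Suc by (simp add: sum_distrib_left mult_ac)
qed simp

text \<open>Base point and argument move oppositely, as they do in \<open>z - embed_real x\<close>
  for fixed \<open>z\<close>. The first term comes from the coefficients, the second from the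
  argument.\<close>

lemma jet_form_base_derivative:
  assumes x: "x \<in> U"
  shows "((\<lambda>t. jet_form k js f (x + t *\<^sub>R axis i 1) (w - t *\<^sub>R axis i 1)) has_vector_derivative
     (jet_form k (i # js) f x w - of_nat k * jet_form (k - 1) (i # js) f x w)) (at 0)"
proof (induction k arbitrary: js)
  case 0
  have "((\<lambda>t. partials js f (x + t *\<^sub>R axis i 1)) has_vector_derivative partials (i # js) f x) (at 0)"
    using smooth_onD(2) [OF f x] by (simp add: has_real_derivative_iff_has_vector_derivative)
  from bounded_linear.has_vector_derivative [OF bounded_linear_of_real this]
  show ?case by simp
next
  case (Suc k)
  let ?J = "\<lambda>k js. jet_form k js f x w"
  have c: "((\<lambda>t. (w - t *\<^sub>R axis i 1) $ j) has_vector_derivative - (axis i 1 $ j :: complex)) (at 0)" for j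
    unfolding has_vector_derivative_def
    by (auto intro!: derivative_eq_intros)
  have "((\<lambda>t. \<Sum>j\<in>UNIV. (w - t *\<^sub>R axis i 1) $ j * jet_form k (j # js) f (x + t *\<^sub>R axis i 1) (w - t *\<^sub>R axis i 1))
     has_vector_derivative
     (\<Sum>j\<in>UNIV. w $ j * (?J k (i # j # js) - of_nat k * ?J (k - 1) (i # j # js))
        + - (axis i 1 $ j) * ?J k (j # js))) (at 0)"
    using has_vector_derivative_mult [OF c Suc.IH]
    by (intro has_vector_derivative_sum) simp
  moreover have "(\<Sum>j\<in>UNIV. w $ j * (?J k (i # j # js) - of_nat k * ?J (k - 1) (i # j # js))
        + - (axis i 1 $ j) * ?J k (j # js)) =
      ?J (Suc k) (i # js) - of_nat (Suc k) * ?J k (i # js)"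
  proof -
    have 1: "?J k (i # j # js) = ?J k (j # i # js)" for j
      by (rule jet_form_permute [OF x]) simp
    have 2: "(\<Sum>j\<in>UNIV. axis i 1 $ j * ?J k (j # js)) = ?J k (i # js)"
      by (simp add: axis_def if_distrib [where f = "\<lambda>x. x * _"] cong: if_cong)
    have "(\<Sum>j\<in>UNIV. w $ j * (?J k (i # j # js) - of_nat k * ?J (k - 1) (i # j # js))
        + - (axis i 1 $ j) * ?J k (j # js)) =
       (\<Sum>j\<in>UNIV. w $ j * ?J k (i # j # js))
       - (\<Sum>j\<in>UNIV. w $ j * (of_nat k * ?J (k - 1) (i # j # js)))
       - (\<Sum>j\<in>UNIV. axis i 1 $ j * ?J k (j # js))"
      by (simp add: sum.distrib sum_subtractf right_diff_distrib sum_negf)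
    also have "\<dots> = ?J (Suc k) (i # js) - of_nat k * ?J k (i # js) - ?J k (i # js)"
      unfolding sum_jet_form_swap [OF x] 2 by (simp add: 1)
    finally show ?thesis
      by (simp add: algebra_simps)
  qed
  ultimately show ?case by simp
qed

text \<open>The derivative is complex-linear in \<open>v\<close>: this is the holomorphy of the
  complexified polynomials.\<close>

lemma jet_form_has_derivative:
  assumes x: "x \<in> U"
  shows "(jet_form k js f x has_derivative (\<lambda>v. \<Sum>i\<in>UNIV. v $ i * (of_nat k * jet_form (k - 1) (i # js) f x w))) (at w)"
proof (induction k arbitrary: js)
  case 0
  then show ?case by (simp add: has_derivative_const [of _ "at w", simplified] ext)
next
  case (Suc k)
  have "((\<lambda>w. \<Sum>j\<in>UNIV. w $ j * jet_form k (j # js) f x w) has_derivative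
     (\<lambda>v. \<Sum>j\<in>UNIV. w $ j * (\<Sum>i\<in>UNIV. v $ i * (of_nat k * jet_form (k - 1) (i # j # js) f x w)) + v $ j * jet_form k (j # js) f x w)) (at w)"
    by (intro has_derivative_sum has_derivative_mult Suc.IH bounded_linear_imp_has_derivative bounded_linear_vec_nth)
  moreover have "(\<Sum>j\<in>UNIV. w $ j * (\<Sum>i\<in>UNIV. v $ i * (of_nat k * jet_form (k - 1) (i # j # js) f x w)) + v $ j * jet_form k (j # js) f x w)
     = (\<Sum>i\<in>UNIV. v $ i * (of_nat (Suc k) * jet_form k (i # js) f x w))" for v
  proof -
    have "(\<Sum>j\<in>UNIV. w $ j * (\<Sum>i\<in>UNIV. v $ i * (of_nat k * jet_form (k - 1) (i # j # js) f x w)))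
      = (\<Sum>j\<in>UNIV. \<Sum>i\<in>UNIV. v $ i * (w $ j * (of_nat k * jet_form (k - 1) (i # j # js) f x w)))"
      by (simp add: sum_distrib_left mult_ac)
    also have "\<dots> = (\<Sum>i\<in>UNIV. v $ i * (\<Sum>j\<in>UNIV. w $ j * (of_nat k * jet_form (k - 1) (i # j # js) f x w)))"
      by (subst sum.swap) (simp add: sum_distrib_left)
    also have "\<dots> = (\<Sum>i\<in>UNIV. v $ i * (of_nat k * jet_form k (i # js) f x w))"
      unfolding sum_jet_form_swap [OF x] ..
    finally show ?thesis
      by (simp add: sum.distrib algebra_simps)
  qed
  moreover have "jet_form (Suc k) js f x = (\<lambda>w. \<Sum>j\<in>UNIV. w $ j * jet_form k (j # js) f x w)"
    by (simp add: fun_eq_iff)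
  ultimately show ?case by simp
qed

text \<open>The sum over \<open>k\<close> telescopes, leaving only derivatives of the top order.
  Hence moving the base point costs no more than a Taylor remainder.\<close>

lemma taylor_base_derivative:
  assumes x: "x \<in> U"
  shows "((\<lambda>t. taylor p js f (x + t *\<^sub>R axis i 1) z) has_vector_derivative
     jet_form p (i # js) f x (z - embed_real x) / fact p) (at 0)"
proof -
  let ?w = "z - embed_real x"
  have "((\<lambda>t. \<Sum>k\<le>p. jet_form k js f (x + t *\<^sub>R axis i 1) (?w - t *\<^sub>R axis i 1) / fact k) has_vector_derivative
     (\<Sum>k\<le>p. (jet_form k (i # js) f x ?w - of_nat k * jet_form (k - 1) (i # js) f x ?w) / fact k)) (at 0)"
    by (intro has_vector_derivative_sum has_vector_derivative_divide jet_form_base_derivative x)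
  moreover have "(\<Sum>k\<le>p. (jet_form k (i # js) f x ?w - of_nat k * jet_form (k - 1) (i # js) f x ?w) / fact k) = jet_form p (i # js) f x ?w / fact p"
  proof -
    have "(\<Sum>k\<le>p. (A k - of_nat k * A (k - 1)) / fact k) = A p / fact p" for A :: "nat \<Rightarrow> complex"
    proof (induction p)
      case (Suc p)
      then show ?case
        by (simp add: diff_divide_distrib del: of_nat_Suc)
    qed simp
    then show ?thesis .
  qed
  ultimately show ?thesis
    by (simp add: taylor_def embed_real_add_axis diff_diff_eq)
qed

text \<open>Differentiation in \<open>z\<close> passes to the partial derivatives and lowers the
  degree by one.\<close>

lemma taylor_has_derivative:
  assumes x: "x \<in> U"
  shows "(taylor (Suc p) js f x has_derivative (\<lambda>v. \<Sum>i\<in>UNIV. v $ i * taylor p (i # js) f x z)) (at z)"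
proof -
  let ?w = "z - embed_real x"
  have "((\<lambda>z. \<Sum>k\<le>Suc p. jet_form k js f x (z - embed_real x) / fact k) has_derivative
     (\<lambda>v. \<Sum>k\<le>Suc p. (\<Sum>i\<in>UNIV. v $ i * (of_nat k * jet_form (k - 1) (i # js) f x ?w)) / fact k)) (at z)"
  proof (intro has_derivative_sum bounded_linear.has_derivative [OF bounded_linear_divide])
    fix k
    have "((\<lambda>z. z - embed_real x) has_derivative (\<lambda>v. v)) (at z)"
      by (auto intro!: derivative_eq_intros)
    from has_derivative_compose [OF this jet_form_has_derivative [OF x]]
    show "((\<lambda>z. jet_form k js f x (z - embed_real x)) has_derivative
       (\<lambda>v. \<Sum>i\<in>UNIV. v $ i * (of_nat k * jet_form (k - 1) (i # js) f x ?w))) (at z)" .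
  qed
  moreover have "(\<Sum>k\<le>Suc p. (\<Sum>i\<in>UNIV. v $ i * (of_nat k * jet_form (k - 1) (i # js) f x ?w)) / fact k)
     = (\<Sum>i\<in>UNIV. v $ i * taylor p (i # js) f x z)" for v
  proof -
    have "(\<Sum>k\<le>Suc p. (\<Sum>i\<in>UNIV. v $ i * (of_nat k * jet_form (k - 1) (i # js) f x ?w)) / fact k)
       = (\<Sum>k\<le>p. (\<Sum>i\<in>UNIV. v $ i * (of_nat (Suc k) * jet_form k (i # js) f x ?w)) / fact (Suc k))"
      by (subst sum.atMost_Suc_shift) simp
    also have "\<dots> = (\<Sum>k\<le>p. \<Sum>i\<in>UNIV. v $ i * (jet_form k (i # js) f x ?w / fact k))"
      unfolding sum_divide_distrib by (intro sum.cong refl) (simp del: of_nat_Suc)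
    also have "\<dots> = (\<Sum>i\<in>UNIV. v $ i * taylor p (i # js) f x z)"
      unfolding taylor_def by (subst sum.swap) (simp add: sum_distrib_left)
    finally show ?thesis .
  qed
  moreover have "taylor (Suc p) js f x = (\<lambda>z. \<Sum>k\<le>Suc p. jet_form k js f x (z - embed_real x) / fact k)"
    by (simp add: taylor_def fun_eq_iff)
  ultimately show ?thesis by simp
qed

end

section \<open>Mean value estimates along rectifiable paths\<close>

text \<open>Only derivatives along the axes are available, so the segment is replaced by a walk that
  changes one coordinate at a time. It never leaves the ball, as its points are componentwise no
  farther from \<open>u\<close> than \<open>y\<close> is.\<close>

lemma ball_mean_value:
  fixes g :: "real ^ 'n::finite \<Rightarrow> 'b::real_normed_vector"
  assumes V: "ball u e \<subseteq> V" and y: "y \<in> ball u e"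
    and d: "\<And>y i. y \<in> V \<Longrightarrow> ((\<lambda>t. g (y + t *\<^sub>R axis i 1)) has_vector_derivative g' i y) (at 0)"
    and B: "\<And>y i. y \<in> V \<Longrightarrow> norm (g' i y) \<le> B"
  shows "norm (g y - g u) \<le> real CARD('n) * B * dist u y"
proof -
  \<comment> \<open>The corner of the walk at which exactly the coordinates in \<open>S\<close> have
    been moved from \<open>u\<close> to \<open>y\<close>.\<close>
  define P where "P S = (\<chi> j. if j \<in> S then y $ j else u $ j)" for S
  have uV: "u \<in> V"
    using y by (intro V [THEN subsetD]) (auto intro: le_less_trans [OF zero_le_dist])
  have B0: "0 \<le> B"
    by (rule order_trans [OF norm_ge_zero B [OF uV, of undefined]])
  have "norm (g (P S) - g u) \<le> real (card S) * (B * dist u y)" if "finite S" for S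
    using that
  proof (induction S rule: finite_induct)
    case empty
    have "P {} = u" by (simp add: P_def vec_eq_iff)
    then show ?case by simp
  next
    case (insert i S)
    define c where "c = y $ i - u $ i"
    have Pi: "P (insert i S) = P S + c *\<^sub>R axis i 1"
      using insert.hyps by (auto simp: P_def c_def vec_eq_iff axis_def)
    have c: "\<bar>c\<bar> \<le> dist u y"
      using component_le_norm_cart [of "y - u" i] by (simp add: c_def dist_norm norm_minus_commute)
    have seg: "P S + t *\<^sub>R axis i 1 \<in> V" if "t \<in> closed_segment 0 c" for t
    proof -
      have t: "\<bar>t\<bar> \<le> \<bar>c\<bar>"
        using that by (auto simp: closed_segment_eq_real_ivl split: if_splits)
      have "norm (P S + t *\<^sub>R axis i 1 - u) \<le> norm (y - u)"
        using t insert.hyps by (intro norm_le_componentwise_cart) (auto simp: P_def c_def axis_def)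
      then show ?thesis
        using y by (intro V [THEN subsetD]) (simp add: dist_norm norm_minus_commute)
    qed
    have "norm (g (P S + c *\<^sub>R axis i 1) - g (P S + 0 *\<^sub>R axis i 1)) \<le> B * norm (c - 0)"
    proof (rule differentiable_bound [where S = "closed_segment 0 c" and f = "\<lambda>t. g (P S + t *\<^sub>R axis i 1)"])
      fix t assume t: "t \<in> closed_segment 0 c"
      show "((\<lambda>t. g (P S + t *\<^sub>R axis i 1)) has_derivative (\<lambda>h. h *\<^sub>R g' i (P S + t *\<^sub>R axis i 1))) (at t within closed_segment 0 c)"
        using axis_derivative_shift [of V g "axis i 1" "g' i", OF d seg [OF t]] by (simp add: has_vector_derivative_def)
      show "onorm (\<lambda>h. h *\<^sub>R g' i (P S + t *\<^sub>R axis i 1)) \<le> B"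
        using B [OF seg [OF t], of i] by (intro onorm_bound B0) (simp add: mult.commute [of B] mult_left_mono)
    qed auto
    also have "\<dots> \<le> B * dist u y"
      using c B0 by (intro mult_left_mono) auto
    finally have "norm (g (P (insert i S)) - g (P S)) \<le> B * dist u y"
      by (simp add: Pi)
    then have "norm (g (P (insert i S)) - g u) \<le> B * dist u y + real (card S) * (B * dist u y)"
      using norm_triangle_ineq [of "g (P (insert i S)) - g (P S)" "g (P S) - g u"] insert.IH by simp
    then show ?case
      using insert.hyps by (simp add: algebra_simps)
  qed
  from this [of UNIV] show ?thesis
    by (simp add: P_def mult.assoc)
qed

lemma polygonal_sum_le:
  assumes "rectifiable_path g" "sorted ts" "set ts \<subseteq> {0..1}"
  shows "(\<Sum>i<length ts - 1. dist (g (ts ! i)) (g (ts ! (i + 1)))) \<le> path_length g"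
  using assms unfolding path_length_def rectifiable_path_def
  by (intro cSup_upper) (auto simp: polygonal_sums_def)

lemma rectifiable_path_subset_cball:
  assumes "rectifiable_path g"
  shows "path_image g \<subseteq> cball (pathstart g) (path_length g)"
proof
  fix v assume "v \<in> path_image g"
  then obtain t where t: "0 \<le> t" "t \<le> 1" "v = g t"
    by (auto simp: path_image_def)
  then show "v \<in> cball (pathstart g) (path_length g)"
    using polygonal_sum_le [OF assms, of "[0, t]"] by (simp add: pathstart_def)
qed

text \<open>The path is merely continuous, so it is sampled finely enough for consecutive points to
  lie in a common ball inside \<open>V\<close>; the distances of the samples add up to at most its
  length.\<close>

lemma rectifiable_mean_value:
  fixes g :: "real ^ 'n::finite \<Rightarrow> 'b::real_normed_vector"
  assumes \<gamma>: "rectifiable_path \<gamma>" "path_image \<gamma> \<subseteq> V" and V: "open V"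
    and d: "\<And>y i. y \<in> V \<Longrightarrow> ((\<lambda>t. g (y + t *\<^sub>R axis i 1)) has_vector_derivative g' i y) (at 0)"
    and B: "\<And>y i. y \<in> V \<Longrightarrow> norm (g' i y) \<le> B"
  shows "norm (g (pathfinish \<gamma>) - g (pathstart \<gamma>)) \<le> real CARD('n) * B * path_length \<gamma>"
proof -
  have \<gamma>c: "continuous_on {0..1} \<gamma>"
    using \<gamma>(1) by (simp add: rectifiable_path_def path_def)
  obtain e where e: "e > 0" "(\<Union>v\<in>path_image \<gamma>. ball v e) \<subseteq> V"
    using compact_subset_open_imp_ball_epsilon_subset [OF _ V \<gamma>(2)] \<gamma>(1) compact_path_image
    unfolding rectifiable_path_def by blast
  have "uniformly_continuous_on {0..1} \<gamma>"
    by (rule compact_uniformly_continuous [OF \<gamma>c]) simp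
  then obtain \<delta> where \<delta>: "\<delta> > 0" "\<And>s t. s \<in> {0..1} \<Longrightarrow> t \<in> {0..1} \<Longrightarrow> dist t s < \<delta> \<Longrightarrow> dist (\<gamma> t) (\<gamma> s) < e"
    using e(1) unfolding uniformly_continuous_on_def by blast
  obtain N :: nat where N: "N > 0" "1 / real N < \<delta>"
    using \<delta>(1) real_arch_inverse [of \<delta>] by (auto simp: inverse_eq_divide)
  define p where "p i = \<gamma> (real i / real N)" for i
  have t01: "real i / real N \<in> {0..1}" if "i \<le> N" for i
    using that N by auto
  have step: "norm (g (p (Suc i)) - g (p i)) \<le> real CARD('n) * B * dist (p i) (p (Suc i))" if "i < N" for i
  proof (rule ball_mean_value [OF _ _ d B])
    have "p i \<in> path_image \<gamma>"
      using t01 [of i] that by (simp add: p_def path_image_def)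
    then show "ball (p i) e \<subseteq> V"
      using e(2) by blast
    have "dist (real i / real N) (real (Suc i) / real N) < \<delta>"
      using N by (simp add: dist_real_def diff_divide_distrib [symmetric])
    then show "p (Suc i) \<in> ball (p i) e"
      using \<delta>(2) [of "real (Suc i) / real N" "real i / real N"] t01 [of i] t01 [of "Suc i"] that by (simp add: p_def)
  qed auto
  have "p 0 \<in> V"
    using t01 [of 0] \<gamma>(2) by (auto simp: p_def path_image_def)
  then have B0: "0 \<le> B"
    by (rule order_trans [OF norm_ge_zero B [of _ undefined]])
  let ?ts = "map (\<lambda>i. real i / real N) [0..<Suc N]"
  have "(\<Sum>i<N. dist (p i) (p (Suc i))) = (\<Sum>i<length ?ts - 1. dist (\<gamma> (?ts ! i)) (\<gamma> (?ts ! (i + 1))))"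
    by (rule sum.cong) (auto simp: p_def nth_append simp del: upt_Suc)
  also have "\<dots> \<le> path_length \<gamma>"
  proof (rule polygonal_sum_le [OF \<gamma>(1)])
    show "sorted ?ts"
      by (auto simp: sorted_iff_nth_mono divide_right_mono simp del: upt_Suc)
    show "set ?ts \<subseteq> {0..1}"
      using t01 by (auto simp: le_less_Suc_eq simp del: upt_Suc)
  qed
  finally have len: "(\<Sum>i<N. dist (p i) (p (Suc i))) \<le> path_length \<gamma>" .
  have "g (pathfinish \<gamma>) - g (pathstart \<gamma>) = (\<Sum>i<N. g (p (Suc i)) - g (p i))"
  proof -
    have "p N = pathfinish \<gamma>" "p 0 = pathstart \<gamma>"
      using N by (simp_all add: p_def pathfinish_def pathstart_def)
    then show ?thesis
      by (simp only: sum_lessThan_telescope [of "\<lambda>i. g (p i)" N])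
  qed
  also have "norm \<dots> \<le> (\<Sum>i<N. real CARD('n) * B * dist (p i) (p (Suc i)))"
    by (rule sum_norm_le) (use step in auto)
  also have "\<dots> = real CARD('n) * B * (\<Sum>i<N. dist (p i) (p (Suc i)))"
    by (simp add: sum_distrib_left)
  also have "\<dots> \<le> real CARD('n) * B * path_length \<gamma>"
    using len B0 by (intro mult_left_mono) auto
  finally show ?thesis .
qed

lemma taylor_degree_diff:
  fixes z :: "complex ^ 'n::finite"
  assumes B: "\<And>js. \<bar>partials js f x\<bar> \<le> b (length js)" and r: "norm (z - embed_real x) \<le> r" and "q \<le> p"
  shows "norm (taylor p js f x z - taylor q js f x z) \<le> (\<Sum>k\<in>{q<..p}. (real CARD('n) * r) ^ k * b (k + length js) / fact k)"
proof -
  \<comment> \<open>The sign of the bound at a given order is read off from any list of that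
    length.\<close>
  have b: "0 \<le> b (k + length js)" for k
    using order_trans [OF abs_ge_zero B [of "replicate k undefined @ js"]] by simp
  have "taylor p js f x z - taylor q js f x z = (\<Sum>k\<in>{..p} - {..q}. jet_form k js f x (z - embed_real x) / fact k)"
    unfolding taylor_def using assms(3) by (subst sum_diff) auto
  also have "{..p} - {..q} = {q<..p}"
    by auto
  also have "norm (\<Sum>k\<in>{q<..p}. jet_form k js f x (z - embed_real x) / fact k) \<le>
      (\<Sum>k\<in>{q<..p}. (real CARD('n) * r) ^ k * b (k + length js) / fact k)"
  proof (rule sum_norm_le)
    fix k
    have "norm (jet_form k js f x (z - embed_real x)) \<le> (real CARD('n) * norm (z - embed_real x)) ^ k * b (k + length js)"
      by (rule jet_form_bound) (metis B)
    also have "\<dots> \<le> (real CARD('n) * r) ^ k * b (k + length js)"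
      using r b by (intro mult_right_mono power_mono mult_left_mono) auto
    finally show "norm (jet_form k js f x (z - embed_real x) / fact k) \<le> (real CARD('n) * r) ^ k * b (k + length js) / fact k"
      by (simp add: norm_divide divide_right_mono)
  qed
  finally show ?thesis .
qed

text \<open>The mean value estimate along a path in \<open>U\<close>, with the derivative from
  \<open>taylor_base_derivative\<close>.\<close>

lemma taylor_base_diff:
  fixes z :: "complex ^ 'n::finite"
  assumes f: "smooth_on U f" and U: "open U"
    and B: "\<And>x js. x \<in> U \<Longrightarrow> \<bar>partials js f x\<bar> \<le> b (length js)"
    and \<gamma>: "rectifiable_path \<gamma>" "path_image \<gamma> \<subseteq> U" "pathstart \<gamma> = x" "pathfinish \<gamma> = y" "path_length \<gamma> < L"
    and r: "norm (z - embed_real x) \<le> r"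
  shows "norm (taylor p js f y z - taylor p js f x z) \<le>
    real CARD('n) * ((real CARD('n) * (r + L)) ^ p * b (Suc (p + length js)) / fact p) * L"
proof -
  let ?B = "(real CARD('n) * (r + L)) ^ p * b (Suc (p + length js)) / fact p"
  \<comment> \<open>The path stays within its own length of \<open>x\<close>; on this smaller open
    set \<open>z\<close> is within \<open>r + L\<close> of every base point.\<close>
  let ?V = "U \<inter> ball x L"
  have xU: "x \<in> U"
    using \<gamma> pathstart_in_path_image by blast
  have b: "0 \<le> b (Suc (p + length js))"
    using order_trans [OF abs_ge_zero B [OF xU, of "replicate (Suc p) undefined @ js"]] by simp
  have len0: "0 \<le> path_length \<gamma>"
    using polygonal_sum_le [OF \<gamma>(1), of "[]"] by simp
  have r0: "0 \<le> r"
    using r norm_ge_zero order_trans by blast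
  have "norm (taylor p js f (pathfinish \<gamma>) z - taylor p js f (pathstart \<gamma>) z) \<le> real CARD('n) * ?B * path_length \<gamma>"
  proof (rule rectifiable_mean_value [OF \<gamma>(1)])
    show "path_image \<gamma> \<subseteq> ?V"
      using \<gamma> rectifiable_path_subset_cball [OF \<gamma>(1)] by fastforce
    show "open ?V" using U by auto
    fix v i assume v: "v \<in> ?V"
    show "((\<lambda>t. taylor p js f (v + t *\<^sub>R axis i 1) z) has_vector_derivative
        jet_form p (i # js) f v (z - embed_real v) / fact p) (at 0)"
      using v by (intro taylor_base_derivative [OF f U]) auto
    have "norm (z - embed_real v) \<le> norm (z - embed_real x) + norm (embed_real (x - v))"
      using norm_triangle_ineq [of "z - embed_real x" "embed_real (x - v)"]
      by (simp add: bounded_linear.linear [OF bounded_linear_embed_real, THEN linear_diff])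
    also have "\<dots> \<le> r + L"
      using r v by (intro add_mono) (auto simp: norm_embed_real dist_norm)
    finally have rv: "norm (z - embed_real v) \<le> r + L" .
    have "norm (jet_form p (i # js) f v (z - embed_real v)) \<le> (real CARD('n) * norm (z - embed_real v)) ^ p * b (Suc (p + length js))"
      using v by (intro jet_form_bound) (metis B IntD1 add_Suc_right length_Cons)
    also have "\<dots> \<le> (real CARD('n) * (r + L)) ^ p * b (Suc (p + length js))"
      using b rv by (intro mult_right_mono power_mono mult_left_mono) auto
    finally show "norm (jet_form p (i # js) f v (z - embed_real v) / fact p) \<le> ?B"
      by (simp add: norm_divide divide_right_mono)
  qed
  also have "\<dots> \<le> real CARD('n) * ?B * L"
    using \<gamma>(5) b r0 len0 by (intro mult_left_mono mult_nonneg_nonneg divide_nonneg_nonneg zero_le_power) auto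
  finally show ?thesis
    by (simp add: \<gamma>)
qed

section \<open>Comparison of Taylor polynomials of optimal degree\<close>

text \<open>In units of the scale, \<open>8 * Q + 5\<close> bounds the distance from
  \<open>z\<close> to points on a path between two base points. The factor 64 is needed in
  \<open>approx_degree_diff\<close>: 8 for distance and factorials, and another 8 for passing to a
  quarter of the scale and gaining a geometric factor.\<close>

locale jet_estimates = log_convex_seq l for l +
  fixes f :: "real ^ 'n::finite \<Rightarrow> real" and U :: "(real ^ 'n) set" and n Q A \<sigma> \<tau> :: real
  assumes f: "smooth_on U f" and U: "open U" and n: "n = real CARD('n)" and Q: "Q \<ge> 1"
    and quasiconvex: "\<And>x y. x \<in> U \<Longrightarrow> y \<in> U \<Longrightarrow> \<exists>\<gamma>. rectifiable_path \<gamma> \<and> path_image \<gamma> \<subseteq> U \<and>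
        pathstart \<gamma> = x \<and> pathfinish \<gamma> = y \<and> path_length \<gamma> \<le> Q * dist x y"
    and A: "A \<ge> 0" and \<sigma>: "\<sigma> > 0" and \<tau>: "\<tau> > 0"
    and partials_bound: "\<And>x js. x \<in> U \<Longrightarrow>
        \<bar>partials js f x\<bar> \<le> A * \<sigma> ^ length js * fact (length js) * l (length js)"
    and \<sigma>\<tau>: "64 * n * (8 * Q + 5) * \<sigma> \<le> \<tau>"
begin

lemma n_ge_1: "n \<ge> 1"
  unfolding n using zero_less_card_finite [where 'a = 'n] by (simp add: Suc_leI)

text \<open>The degree is chosen such that the derivatives of order \<open>opt (\<tau> * \<delta>)\<close> bound the Taylor remainder.\<close>

definition approx :: "real \<Rightarrow> 'n list \<Rightarrow> real ^ 'n \<Rightarrow> complex ^ 'n \<Rightarrow> complex" where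
  "approx \<delta> js x z = taylor (opt (\<tau> * \<delta>) - 1 - length js) js f x z"

text \<open>Dividing by \<open>\<delta>\<close> covers first derivatives, whose Taylor degree is one
  lower. The factor \<open>2 * n\<close> absorbs the geometric sum of
  \<open>approx_degree_diff\<close> and the dimension factor of
  \<open>approx_base_diff\<close>.\<close>

definition err :: "real \<Rightarrow> real" where
  "err \<delta> = 2 * n * A / \<delta> * opt_val (\<tau> * \<delta>)"

text \<open>From \<open>opt\<close> at least 2 the truncated subtractions in the two degrees are
  exact and differ by one, as \<open>taylor_has_derivative\<close> requires.\<close>

lemma approx_has_derivative:
  assumes "x \<in> U" "2 \<le> opt (\<tau> * \<delta>)"
  shows "(approx \<delta> [] x has_derivative (\<lambda>v. \<Sum>i\<in>UNIV. v $ i * approx \<delta> [i] x z)) (at z)"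
proof -
  obtain p where p: "opt (\<tau> * \<delta>) = Suc (Suc p)"
    using assms(2) by (metis add_2_eq_Suc le_Suc_ex)
  then show ?thesis
    using taylor_has_derivative [OF f U assms(1), of p "[]" z] by (simp add: approx_def [abs_def])
qed

lemma fact_quotient_le: "fact (p + j) / fact p \<le> real (p + j) ^ j"
proof (induction j)
  case (Suc j)
  have "fact (p + Suc j) / fact p = real (p + Suc j) * (fact (p + j) / fact p)"
    by simp
  also have "\<dots> \<le> real (p + Suc j) * real (p + j) ^ j"
    using Suc by (intro mult_left_mono) auto
  also have "\<dots> \<le> real (p + Suc j) * real (p + Suc j) ^ j"
    by (intro mult_left_mono power_mono) auto
  finally show ?case by simp
qed simp

text \<open>\<open>taylor_base_diff\<close> bounds the difference by derivatives of order exactly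
  \<open>g = opt (\<tau> * \<delta>)\<close>, so the minimal term
  \<open>opt_val (\<tau> * \<delta>)\<close> appears.\<close>

lemma approx_base_diff:
  assumes x: "x \<in> U" and y: "y \<in> U" and \<delta>: "0 < \<delta>" "\<delta> \<le> 1" and deg: "2 \<le> opt (\<tau> * \<delta>)" and js: "length js \<le> 1"
    and zx: "norm (z - embed_real x) \<le> 4 * \<delta>" and zy: "norm (z - embed_real y) \<le> 4 * \<delta>"
  shows "norm (approx \<delta> js y z - approx \<delta> js x z) \<le> err \<delta>"
proof -
  define c where "c = 8 * Q + 5"
  define g where "g = opt (\<tau> * \<delta>)"
  define m where "m = length js"
  define p where "p = g - 1 - m"
  \<comment> \<open>The base points are at distance at most \<open>8 * \<delta>\<close>; the
    additional \<open>\<delta>\<close> makes the bound on the path length strict.\<close>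
  define L where "L = (8 * Q + 1) * \<delta>"
  have gp: "g = Suc (p + m)"
    using deg js by (simp add: p_def g_def m_def)
  have c: "c \<ge> 1" using Q by (simp add: c_def)
  have nc: "n * c \<ge> 1" using mult_mono [OF n_ge_1 c] n_ge_1 by simp
  have "dist x y = norm (embed_real (x - y))"
    by (simp add: norm_embed_real dist_norm)
  also have "\<dots> \<le> norm (z - embed_real x) + norm (z - embed_real y)"
    using norm_triangle_ineq4 [of "z - embed_real y" "z - embed_real x"]
    by (simp add: bounded_linear.linear [OF bounded_linear_embed_real, THEN linear_diff] add.commute)
  finally have xy: "dist x y \<le> 8 * \<delta>"
    using zx zy by simp
  obtain \<gamma> where \<gamma>: "rectifiable_path \<gamma>" "path_image \<gamma> \<subseteq> U" "pathstart \<gamma> = x" "pathfinish \<gamma> = y" "path_length \<gamma> \<le> Q * dist x y"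
    using quasiconvex [OF x y] by blast
  have "Q * dist x y \<le> Q * (8 * \<delta>)"
    using xy Q by (intro mult_left_mono) auto
  then have plen: "path_length \<gamma> < L"
    using \<gamma>(5) \<delta> by (simp add: L_def algebra_simps)
  \<comment> \<open>Derivatives of order \<open>g\<close> bring \<open>fact g\<close>, the Taylor
    coefficient only \<open>1 / fact p\<close> with \<open>p\<close> smaller by at most 2; the
    quotient is geometric in \<open>g\<close>.\<close>
  have F1: "fact g / fact p \<le> (4::real) ^ g"
  proof -
    have "fact g / fact p \<le> real g ^ (Suc m)"
      using fact_quotient_le [of p "Suc m"] by (simp add: gp)
    also have "\<dots> \<le> real g ^ 2"
      using deg js by (intro power_increasing) (auto simp: g_def m_def)
    also have "\<dots> \<le> (2 ^ g) ^ 2"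
      by (intro power_mono) (auto intro: order.strict_implies_order)
    also have "\<dots> = 4 ^ g"
      by (simp add: power_mult [symmetric] mult.commute [of g] power_mult)
    finally show ?thesis .
  qed
  \<comment> \<open>One power of \<open>\<delta>\<close> comes from the path length, so at most one
    is missing from \<open>\<delta> ^ g\<close>.\<close>
  have F2: "(n * c) ^ p * L * \<delta> ^ p \<le> (n * c) ^ g * (\<delta> ^ g / \<delta>)"
  proof -
    have "L \<le> n * c * \<delta>"
    proof -
      have "L \<le> 1 * c * \<delta>"
        using \<delta> by (simp add: L_def c_def)
      also have "\<dots> \<le> n * c * \<delta>"
        using n_ge_1 c \<delta> by (intro mult_right_mono) auto
      finally show ?thesis .
    qed
    then have "(n * c) ^ p * L * \<delta> ^ p \<le> (n * c) ^ p * (n * c * \<delta>) * \<delta> ^ p"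
      using nc \<delta> by (intro mult_left_mono mult_right_mono) auto
    also have "\<dots> = (n * c) ^ Suc p * \<delta> ^ Suc p"
      by simp
    also have "\<dots> \<le> (n * c) ^ g * (\<delta> ^ g / \<delta>)"
    proof (intro mult_mono power_increasing nc)
      have "\<delta> ^ Suc p = \<delta> ^ (Suc p) * \<delta> / \<delta>" using \<delta> by simp
      also have "\<dots> \<le> \<delta> ^ (Suc p) * \<delta> ^ m / \<delta>"
        using power_decreasing [of m 1 \<delta>] js \<delta> by (intro divide_right_mono mult_left_mono) (auto simp: m_def)
      also have "\<dots> = \<delta> ^ g / \<delta>"
        by (simp add: gp power_add)
      finally show "\<delta> ^ Suc p \<le> \<delta> ^ g / \<delta>" .
    qed (use gp \<delta> nc in auto)
    finally show ?thesis .
  qed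
  from taylor_base_diff [OF f U partials_bound \<gamma>(1-4) plen zx, of p js, folded n]
  have "norm (approx \<delta> js y z - approx \<delta> js x z)
     \<le> n * ((n * (4 * \<delta> + L)) ^ p * (A * \<sigma> ^ g * fact g * l g) / fact p) * L"
    unfolding approx_def g_def [symmetric] m_def [symmetric] p_def [symmetric] gp [symmetric]
    by (simp add: gp)
  also have "4 * \<delta> + L = c * \<delta>"
    by (simp add: L_def c_def algebra_simps)
  also have "n * ((n * (c * \<delta>)) ^ p * (A * \<sigma> ^ g * fact g * l g) / fact p) * L
     = n * A * l g * \<sigma> ^ g * (fact g / fact p) * ((n * c) ^ p * L * \<delta> ^ p)"
    by (simp add: power_mult_distrib mult_ac)
  also have "\<dots> \<le> n * A * l g * \<sigma> ^ g * (4 ^ g) * ((n * c) ^ g * (\<delta> ^ g / \<delta>))"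
    using n_ge_1 A \<sigma> \<delta> Q c l_pos [of g]
    by (intro mult_mono [OF mult_left_mono [OF F1] F2]) (auto simp: L_def intro!: mult_nonneg_nonneg)
  also have "\<dots> = n * A / \<delta> * (l g * ((4 * n * c * \<sigma>) * \<delta>) ^ g)"
    by (simp add: power_mult_distrib mult_ac)
  also have "\<dots> \<le> n * A / \<delta> * (l g * (\<tau> * \<delta>) ^ g)"
  proof (intro mult_left_mono power_mono mult_right_mono)
    have "4 * (n * c * \<sigma>) \<le> 64 * (n * c * \<sigma>)"
      using c \<sigma> n_ge_1 by (intro mult_right_mono) auto
    then show "4 * n * c * \<sigma> \<le> \<tau>"
      using \<sigma>\<tau> by (simp add: c_def mult_ac)
  qed (use A \<sigma> \<delta> c n_ge_1 l_pos [of g] in \<open>auto simp: less_imp_le\<close>)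
  also have "\<dots> = n * A / \<delta> * opt_val (\<tau> * \<delta>)"
    by (simp add: opt_val_def g_def)
  also have "\<dots> \<le> err \<delta>"
    unfolding err_def using n_ge_1 A \<delta> \<tau> opt_val_nonneg [of "\<tau> * \<delta>"]
    by (intro mult_right_mono divide_right_mono) auto
  finally show ?thesis .
qed

text \<open>Only Taylor terms of total order between \<open>opt (\<tau> * \<delta>)\<close> and
  \<open>opt (\<tau> * (\<delta>/4))\<close> are added, which is the range of
  \<open>between_opts_le\<close>.\<close>

lemma approx_degree_diff:
  assumes x: "x \<in> U" and \<delta>: "0 < \<delta>" "\<delta> \<le> 1" and deg: "2 \<le> opt (\<tau> * \<delta>)" and js: "length js \<le> 1"
    and zx: "norm (z - embed_real x) \<le> 4 * \<delta>"
  shows "norm (approx (\<delta>/4) js x z - approx \<delta> js x z) \<le> err \<delta>"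
proof -
  define g where "g = opt (\<tau> * \<delta>)"
  define g' where "g' = opt (\<tau> * (\<delta>/4))"
  define m where "m = length js"
  have gg': "g \<le> g'"
    unfolding g_def g'_def using \<tau> \<delta> by (intro opt_antimono) auto
  from taylor_degree_diff [OF partials_bound [OF x] zx, of "g - 1 - m" "g' - 1 - m" js, folded n]
  have "norm (approx (\<delta>/4) js x z - approx \<delta> js x z) \<le>
     (\<Sum>k\<in>{g - 1 - m<..g' - 1 - m}. (n * (4 * \<delta>)) ^ k * (A * \<sigma> ^ (k + m) * fact (k + m) * l (k + m)) / fact k)"
    using gg' by (simp add: approx_def g_def g'_def m_def diff_le_mono)
  also have "\<dots> \<le> (\<Sum>k\<in>{g - 1 - m<..g' - 1 - m}. (A / \<delta> * opt_val (\<tau> * \<delta>)) * (1/2) ^ k)"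
  proof (rule sum_mono)
    fix k assume k: "k \<in> {g - 1 - m<..g' - 1 - m}"
    define k' where "k' = k + m"
    have k': "g \<le> k'" "k' \<le> g'"
      using k deg js by (auto simp: k'_def g_def m_def)
    have 1: "fact k' / fact k \<le> (2::real) ^ k'"
    proof -
      have "fact k' / fact k \<le> real k' ^ m"
        using fact_quotient_le [of k m] by (simp add: k'_def)
      also have "\<dots> \<le> real k' ^ 1"
        using deg js k' by (intro power_increasing) (auto simp: g_def m_def)
      also have "\<dots> \<le> 2 ^ k'"
        by (simp add: order.strict_implies_order)
      finally show ?thesis .
    qed
    have 2: "(n * (4 * \<delta>)) ^ k \<le> (n * 4) ^ k' * (\<delta> ^ k' / \<delta>)"
    proof -
      have "\<delta> ^ k = \<delta> ^ k * \<delta> / \<delta>" using \<delta> by simp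
      also have "\<dots> \<le> \<delta> ^ k * \<delta> ^ m / \<delta>"
        using power_decreasing [of m 1 \<delta>] js \<delta> by (intro divide_right_mono mult_left_mono) (auto simp: m_def)
      finally have "\<delta> ^ k \<le> \<delta> ^ k' / \<delta>"
        by (simp add: k'_def power_add)
      moreover have "(n * 4) ^ k \<le> (n * 4) ^ k'"
        using n_ge_1 by (intro power_increasing) (auto simp: k'_def)
      ultimately have "(n * 4) ^ k * \<delta> ^ k \<le> (n * 4) ^ k' * (\<delta> ^ k' / \<delta>)"
        using \<delta> n_ge_1 by (intro mult_mono) auto
      then show ?thesis by (simp add: power_mult_distrib mult_ac)
    qed
    have "(n * (4 * \<delta>)) ^ k * (A * \<sigma> ^ k' * fact k' * l k') / fact k
       = A * \<sigma> ^ k' * l k' * ((fact k' / fact k) * (n * (4 * \<delta>)) ^ k)"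
      by simp
    also have "\<dots> \<le> A * \<sigma> ^ k' * l k' * (2 ^ k' * ((n * 4) ^ k' * (\<delta> ^ k' / \<delta>)))"
      using A \<sigma> \<delta> l_pos [of k'] n_ge_1 by (intro mult_left_mono mult_mono 1 2) auto
    also have "\<dots> = A / \<delta> * (l k' * ((8 * n * \<sigma>) * \<delta>) ^ k')"
    proof -
      have "(8::real) ^ k' = 2 ^ k' * 4 ^ k'"
        by (simp flip: power_mult_distrib)
      then show ?thesis
        by (simp add: power_mult_distrib mult_ac)
    qed
    \<comment> \<open>Since \<open>\<tau> / 8\<close> is half of \<open>\<tau> / 4\<close>, the term
      at scale \<open>\<delta>/4\<close> comes with a factor \<open>(1/2) ^ k'\<close> that makes
      the sum converge.\<close>
    also have "\<dots> \<le> A / \<delta> * (l k' * ((\<tau> / 8) * \<delta>) ^ k')"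
    proof (intro mult_left_mono power_mono mult_right_mono)
      have "64 * n * 1 * \<sigma> \<le> 64 * n * (8 * Q + 5) * \<sigma>"
        using Q \<sigma> n_ge_1 by (intro mult_right_mono mult_left_mono) auto
      then show "8 * n * \<sigma> \<le> \<tau> / 8"
        using \<sigma>\<tau> by simp
    qed (use A \<sigma> \<delta> n_ge_1 l_pos [of k'] in \<open>auto simp: less_imp_le\<close>)
    also have "\<dots> = A / \<delta> * ((l k' * (\<tau> * (\<delta>/4)) ^ k') * (1/2) ^ k')"
      by (simp flip: power_mult_distrib)
    also have "\<dots> \<le> A / \<delta> * (opt_val (\<tau> * \<delta>) * (1/2) ^ k)"
    proof (intro mult_left_mono mult_mono)
      show "l k' * (\<tau> * (\<delta>/4)) ^ k' \<le> opt_val (\<tau> * \<delta>)"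
        using k' \<tau> \<delta> by (intro between_opts_le) (auto simp: g_def g'_def)
      show "(1/2::real) ^ k' \<le> (1/2) ^ k"
        by (intro power_decreasing) (auto simp: k'_def)
    qed (use A \<delta> \<tau> opt_val_nonneg in auto)
    finally show "(n * (4 * \<delta>)) ^ k * (A * \<sigma> ^ (k + m) * fact (k + m) * l (k + m)) / fact k
        \<le> (A / \<delta> * opt_val (\<tau> * \<delta>)) * (1/2) ^ k"
      by (simp add: k'_def mult.assoc)
  qed
  also have "\<dots> = (A / \<delta> * opt_val (\<tau> * \<delta>)) * (\<Sum>k\<in>{g - 1 - m<..g' - 1 - m}. (1/2) ^ k)"
    by (simp add: sum_distrib_left)
  also have "\<dots> \<le> (A / \<delta> * opt_val (\<tau> * \<delta>)) * (2 * n)"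
  proof (intro mult_left_mono)
    have "(\<Sum>k\<in>{g - 1 - m<..g' - 1 - m}. (1/2::real) ^ k) \<le> (\<Sum>k. (1/2) ^ k)"
      by (intro sum_le_suminf) (auto simp: summable_geometric)
    also have "\<dots> = 2"
      by (simp add: suminf_geometric)
    finally show "(\<Sum>k\<in>{g - 1 - m<..g' - 1 - m}. (1/2::real) ^ k) \<le> 2 * n"
      using n_ge_1 by simp
  qed (use A \<delta> \<tau> opt_val_nonneg in auto)
  also have "\<dots> = err \<delta>"
    by (simp add: err_def)
  finally show ?thesis .
qed

end

section \<open>Cut-off functions and successive overwriting\<close>

definition sq_pos :: "real \<Rightarrow> real" where "sq_pos x = (max 0 x)\<^sup>2"

lemma sq_pos_has_derivative: "(sq_pos has_real_derivative 2 * max 0 x) (at x)"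
proof -
  consider "x < 0" | "x = 0" | "x > 0" by linarith
  then show ?thesis
  proof cases
    case 1
    have "((\<lambda>_. 0) has_real_derivative 2 * max 0 x) (at x)"
      using 1 by simp
    then show ?thesis
      by (rule has_field_derivative_transform_within_open [where S = "{..<0}"]) (use 1 in \<open>auto simp: sq_pos_def\<close>)
  next
    case 3
    have "((\<lambda>x. x\<^sup>2) has_real_derivative 2 * max 0 x) (at x)"
      using 3 by (auto intro!: derivative_eq_intros)
    then show ?thesis
      by (rule has_field_derivative_transform_within_open [where S = "{0<..}"]) (use 3 in \<open>auto simp: sq_pos_def\<close>)
  next
    case 2
    have "((\<lambda>h. (sq_pos (0 + h) - sq_pos 0) / h) \<longlongrightarrow> 0) (at 0)"
    proof (rule Lim_null_comparison)
      show "\<forall>\<^sub>F h in at 0. norm ((sq_pos (0 + h) - sq_pos 0) / h) \<le> \<bar>h\<bar>"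
        by (rule always_eventually) (auto simp: sq_pos_def max_def power2_eq_square)
      show "((\<lambda>h. \<bar>h\<bar>) \<longlongrightarrow> (0::real)) (at 0)"
        using tendsto_rabs_zero [OF tendsto_ident_at] by simp
    qed
    then show ?thesis
      using 2 by (simp add: DERIV_def)
  qed
qed

text \<open>A transition from 0 on the negative axis to 1 beyond 1. Built from squared positive
  parts it is \<open>C^1\<close>, which is all that \<open>C1c\<close> asks for.\<close>

definition smooth_step :: "real \<Rightarrow> real" where
  "smooth_step u = 1 - sq_pos (1 - sq_pos u)"

definition smooth_step' :: "real \<Rightarrow> real" where
  "smooth_step' u = 4 * max 0 (1 - sq_pos u) * max 0 u"

lemma smooth_step_has_derivative: "(smooth_step has_real_derivative smooth_step' u) (at u)"
proof -
  have "((\<lambda>u. 1 - sq_pos u) has_real_derivative - (2 * max 0 u)) (at u)"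
    by (auto intro!: derivative_eq_intros sq_pos_has_derivative)
  from DERIV_chain2 [OF sq_pos_has_derivative this]
  show ?thesis
    unfolding smooth_step_def [abs_def] smooth_step'_def
    by (auto intro!: derivative_eq_intros)
qed

lemma smooth_step_bounds: "0 \<le> smooth_step u" "smooth_step u \<le> 1"
  by (auto simp: smooth_step_def sq_pos_def max_def power_le_one)

lemma smooth_step_eq_0: "u \<le> 0 \<Longrightarrow> smooth_step u = 0" "u \<le> 0 \<Longrightarrow> smooth_step' u = 0"
  by (auto simp: smooth_step_def smooth_step'_def sq_pos_def)

lemma smooth_step_eq_1: "u \<ge> 1 \<Longrightarrow> smooth_step u = 1" "u \<ge> 1 \<Longrightarrow> smooth_step' u = 0"
proof -
  have "1 \<le> sq_pos u" if "u \<ge> 1"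
    using one_le_power [OF that, of 2] that by (simp add: sq_pos_def)
  then show "u \<ge> 1 \<Longrightarrow> smooth_step u = 1" "u \<ge> 1 \<Longrightarrow> smooth_step' u = 0"
    by (auto simp: smooth_step_def smooth_step'_def sq_pos_def [of "1 - _"])
qed

lemma smooth_step'_bounds: "0 \<le> smooth_step' u" "smooth_step' u \<le> 4"
proof -
  show "0 \<le> smooth_step' u" by (simp add: smooth_step'_def)
  show "smooth_step' u \<le> 4"
  proof (cases "u \<ge> 1")
    case False
    then have "max 0 (1 - sq_pos u) * max 0 u \<le> 1 * 1"
      by (intro mult_mono) (auto simp: sq_pos_def)
    then show ?thesis by (simp add: smooth_step'_def)
  qed (simp add: smooth_step_eq_1)
qed

lemma continuous_on_smooth_step': "continuous_on S smooth_step'"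
  unfolding smooth_step'_def [abs_def] sq_pos_def by (intro continuous_intros)

text \<open>The argument of \<open>smooth_step\<close> reaches 1 at distance
  \<open>2 * \<delta>\<close> and 0 at distance \<open>3 * \<delta>\<close>, with
  \<open>5 = 9 - 4\<close>. Squared distances keep it differentiable at the centre.\<close>

definition bump :: "real \<Rightarrow> 'a::real_inner \<Rightarrow> 'a \<Rightarrow> real" where
  "bump \<delta> a z = smooth_step ((9 - inner (z - a) (z - a) / \<delta>\<^sup>2) / 5)"

definition bump' :: "real \<Rightarrow> 'a::real_inner \<Rightarrow> 'a \<Rightarrow> 'a \<Rightarrow>\<^sub>L real" where
  "bump' \<delta> a z = (- (2 / (5 * \<delta>\<^sup>2) * smooth_step' ((9 - inner (z - a) (z - a) / \<delta>\<^sup>2) / 5))) *\<^sub>R blinfun_inner_left (z - a)"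

lemma bump'_apply:
  "bump' \<delta> a z v = - (2 / (5 * \<delta>\<^sup>2) * smooth_step' ((9 - inner (z - a) (z - a) / \<delta>\<^sup>2) / 5)) * inner (z - a) v"
  unfolding bump'_def blinfun.scaleR_left by (simp add: inner_commute)

lemma bump_has_derivative: "(bump \<delta> a has_derivative blinfun_apply (bump' \<delta> a z)) (at z)"
proof -
  have "((\<lambda>z. (9 - inner (z - a) (z - a) * c) * d) has_derivative (\<lambda>v. - (2 * c * d) * inner (z - a) v)) (at z)" for c d
    by (auto intro!: derivative_eq_intros simp: inner_commute algebra_simps)
  from this [of "1 / \<delta>\<^sup>2" "1 / 5"]
  have 1: "((\<lambda>z. (9 - inner (z - a) (z - a) / \<delta>\<^sup>2) / 5) has_derivative (\<lambda>v. - (2 / (5 * \<delta>\<^sup>2)) * inner (z - a) v)) (at z)"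
    by (simp add: mult.commute)
  have 2: "(smooth_step has_derivative (\<lambda>h. smooth_step' u * h)) (at u)" for u
    using smooth_step_has_derivative by (simp add: has_field_derivative_def)
  show ?thesis
    unfolding bump_def [abs_def]
    by (rule has_derivative_eq_rhs [OF has_derivative_compose [OF 1 2]]) (simp add: fun_eq_iff bump'_apply)
qed

lemma continuous_on_bump': "continuous_on S (bump' \<delta> a)"
  unfolding bump'_def [abs_def] divide_inverse
  by (intro continuous_intros continuous_on_compose2 [OF continuous_on_smooth_step' [of UNIV]]) auto

lemma bump_bounds: "0 \<le> bump \<delta> a z" "bump \<delta> a z \<le> 1"
  by (simp_all add: bump_def smooth_step_bounds)

lemma
  assumes "\<delta> > 0" "3 * \<delta> \<le> dist z a"
  shows bump_eq_0: "bump \<delta> a z = 0" and bump'_eq_0: "bump' \<delta> a z = 0"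
proof -
  have "(3 * \<delta>)\<^sup>2 \<le> (dist z a)\<^sup>2"
    using assms by (intro power_mono) auto
  then have "(9 - inner (z - a) (z - a) / \<delta>\<^sup>2) / 5 \<le> 0"
    using assms by (simp add: dist_norm field_simps flip: power2_norm_eq_inner)
  then show "bump \<delta> a z = 0" "bump' \<delta> a z = 0"
    by (simp_all add: bump_def bump'_def smooth_step_eq_0)
qed

lemma
  assumes "\<delta> > 0" "dist z a \<le> 2 * \<delta>"
  shows bump_eq_1: "bump \<delta> a z = 1" and bump'_eq_0_inner: "bump' \<delta> a z = 0"
proof -
  have "(dist z a)\<^sup>2 \<le> (2 * \<delta>)\<^sup>2"
    using assms by (intro power_mono) auto
  then have "(9 - inner (z - a) (z - a) / \<delta>\<^sup>2) / 5 \<ge> 1"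
    using assms by (simp add: dist_norm field_simps flip: power2_norm_eq_inner)
  then show "bump \<delta> a z = 1" "bump' \<delta> a z = 0"
    by (simp_all add: bump_def bump'_def smooth_step_eq_1)
qed

text \<open>Inside the support the bound is \<open>2 / (5 * \<delta>\<^sup>2) * 4 * (3 * \<delta>) =
  24 / (5 * \<delta>)\<close>.\<close>

lemma norm_bump':
  assumes \<delta>: "\<delta> > 0"
  shows "norm (bump' \<delta> a z) \<le> 5 / \<delta>"
proof (cases "3 * \<delta> \<le> dist z a")
  case True
  then show ?thesis using bump'_eq_0 [OF \<delta> True] \<delta> by simp
next
  case False
  let ?c = "2 / (5 * \<delta>\<^sup>2) * smooth_step' ((9 - inner (z - a) (z - a) / \<delta>\<^sup>2) / 5)"
  have c: "0 \<le> ?c" "?c \<le> 2 / (5 * \<delta>\<^sup>2) * 4"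
    by (intro mult_nonneg_nonneg smooth_step'_bounds, simp) (intro mult_left_mono smooth_step'_bounds, simp)
  show ?thesis
  proof (rule norm_blinfun_bound)
    fix v
    have "norm (bump' \<delta> a z v) = ?c * \<bar>inner v (z - a)\<bar>"
      by (simp add: bump'_apply abs_mult inner_commute abs_of_nonneg [OF smooth_step'_bounds(1)])
    also have "\<dots> \<le> (2 / (5 * \<delta>\<^sup>2) * 4) * (norm v * (3 * \<delta>))"
      using c False by (intro mult_mono order_trans [OF Cauchy_Schwarz_ineq2] mult_left_mono smooth_step'_bounds) (auto simp: dist_norm smooth_step'_bounds)
    also have "\<dots> \<le> 5 / \<delta> * norm v"
      using \<delta> by (simp add: field_simps power2_eq_square)
    finally show "norm (bump' \<delta> a z v) \<le> 5 / \<delta> * norm v" .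
  qed (use \<delta> in auto)
qed

section \<open>Successive overwriting along a list\<close>

context
  fixes b :: "'p \<Rightarrow> complex ^ 'n::finite \<Rightarrow> real" and b' :: "'p \<Rightarrow> complex ^ 'n \<Rightarrow> (complex ^ 'n) \<Rightarrow>\<^sub>L real"
    and T :: "'p \<Rightarrow> complex ^ 'n \<Rightarrow> complex" and T' :: "'p \<Rightarrow> complex ^ 'n \<Rightarrow> (complex ^ 'n) \<Rightarrow>\<^sub>L complex"
    and S :: "complex ^ 'n \<Rightarrow> complex" and S' :: "complex ^ 'n \<Rightarrow> (complex ^ 'n) \<Rightarrow>\<^sub>L complex"
begin

text \<open>The head of the list acts last. The cut-offs are not normalised: each step is an
  interpolation between the current function and one \<open>T x\<close>.\<close>

fun overwrite :: "'p list \<Rightarrow> complex ^ 'n \<Rightarrow> complex" where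
  "overwrite [] z = S z"
| "overwrite (x # xs) z = (1 - b x z) *\<^sub>R overwrite xs z + b x z *\<^sub>R T x z"

fun overwrite' :: "'p list \<Rightarrow> complex ^ 'n \<Rightarrow> (complex ^ 'n) \<Rightarrow>\<^sub>L complex" where
  "overwrite' [] z = S' z"
| "overwrite' (x # xs) z = (1 - b x z) *\<^sub>R overwrite' xs z + b x z *\<^sub>R T' x z
     + (blinfun_scaleR_left (T x z - overwrite xs z) o\<^sub>L b' x z)"

end

lemma C1_with_overwrite:
  assumes b: "\<And>x z. x \<in> set xs \<Longrightarrow> (b x has_derivative blinfun_apply (b' x z)) (at z)"
      "\<And>x. x \<in> set xs \<Longrightarrow> continuous_on UNIV (b' x)"
    and T: "\<And>x. x \<in> set xs \<Longrightarrow> C1_with (T x) (T' x)" and S: "C1_with S S'"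
  shows "C1_with (overwrite b T S xs) (overwrite' b b' T T' S S' xs)"
  using b T
proof (induction xs)
  case Nil
  have "overwrite b T S [] = S" "overwrite' b b' T T' S S' [] = S'"
    by (auto simp: fun_eq_iff)
  then show ?case using S by simp
next
  case (Cons x xs)
  have IH: "C1_with (overwrite b T S xs) (overwrite' b b' T T' S S' xs)"
    using Cons by auto
  have Tx: "C1_with (T x) (T' x)" and bx: "(b x has_derivative blinfun_apply (b' x z)) (at z)"
    and cb': "continuous_on UNIV (b' x)" for z
    using Cons.prems by auto
  have cb: "continuous_on UNIV (b x)"
    by (rule has_derivative_continuous_on [OF bx])
  let ?G = "overwrite b T S xs" and ?G' = "overwrite' b b' T T' S S' xs"
  have "((\<lambda>z. (1 - b x z) *\<^sub>R ?G z + b x z *\<^sub>R T x z) has_derivative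
      (\<lambda>v. ((1 - b x z) *\<^sub>R ?G' z v + (0 - b' x z v) *\<^sub>R ?G z) + (b x z *\<^sub>R T' x z v + b' x z v *\<^sub>R T x z))) (at z)" for z
    by (intro has_derivative_add has_derivative_scaleR has_derivative_diff has_derivative_const bx
        C1_withD(1) [OF IH] C1_withD(1) [OF Tx])
  then have "((\<lambda>z. (1 - b x z) *\<^sub>R ?G z + b x z *\<^sub>R T x z) has_derivative overwrite' b b' T T' S S' (x # xs) z) (at z)" for z
    by (rule has_derivative_eq_rhs) (auto simp: fun_eq_iff blinfun.bilinear_simps algebra_simps)
  moreover have "continuous_on UNIV (\<lambda>z. (1 - b x z) *\<^sub>R ?G' z + b x z *\<^sub>R T' x z
     + (blinfun_scaleR_left (T x z - ?G z) o\<^sub>L b' x z))"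
    by (intro continuous_intros cb cb' C1_withD(2,3) [OF IH] C1_withD(2,3) [OF Tx])
  moreover have "overwrite b T S (x # xs) = (\<lambda>z. (1 - b x z) *\<^sub>R ?G z + b x z *\<^sub>R T x z)"
    "overwrite' b b' T T' S S' (x # xs) = (\<lambda>z. (1 - b x z) *\<^sub>R ?G' z + b x z *\<^sub>R T' x z
      + (blinfun_scaleR_left (T x z - ?G z) o\<^sub>L b' x z))"
    by (simp_all add: fun_eq_iff)
  ultimately show ?case
    unfolding C1_with_def by simp
qed

text \<open>\<open>R\<close> and \<open>R'\<close> stand for value and derivative of a reference
  function at \<open>z\<close>. Values are convex combinations, so their error does not accumulate.
  Each derivative of a cut-off multiplies a difference of two values near \<open>R\<close>, so the
  derivative error grows by \<open>\<kappa> * (2 * e)\<close> per entry.\<close>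

lemma overwrite_bound:
  assumes b: "\<And>x. x \<in> set xs \<Longrightarrow> 0 \<le> b x z \<and> b x z \<le> 1"
    and b': "\<And>x. x \<in> set xs \<Longrightarrow> norm (b' x z) \<le> \<kappa>"
    and S: "norm (S z - R) \<le> e" "norm (S' z - R') \<le> e'"
    and T: "\<And>x. x \<in> set xs \<Longrightarrow> b x z \<noteq> 0 \<or> b' x z \<noteq> 0 \<Longrightarrow> norm (T x z - R) \<le> e"
      "\<And>x. x \<in> set xs \<Longrightarrow> b x z \<noteq> 0 \<or> b' x z \<noteq> 0 \<Longrightarrow> norm (T' x z - R') \<le> e'"
  shows "norm (overwrite b T S xs z - R) \<le> e
     \<and> norm (overwrite' b b' T T' S S' xs z - R') \<le> e' + real (length xs) * (\<kappa> * (2 * e))"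
  using b b' T
proof (induction xs)
  case (Cons x xs)
  let ?G = "overwrite b T S xs z" and ?G' = "overwrite' b b' T T' S S' xs z" and ?E = "real (length xs) * (\<kappa> * (2 * e))"
  have IH: "norm (?G - R) \<le> e" "norm (?G' - R') \<le> e' + ?E"
    using Cons by auto
  have e: "0 \<le> e" by (rule order_trans [OF norm_ge_zero S(1)])
  have \<kappa>: "0 \<le> \<kappa>" by (rule order_trans [OF norm_ge_zero Cons.prems(2) [of x]]) simp
  have E: "0 \<le> ?E" "0 \<le> \<kappa> * (2 * e)" using e \<kappa> by auto
  have b01: "0 \<le> b x z" "b x z \<le> 1" using Cons.prems(1) by auto
  show ?case
  proof (cases "b x z = 0 \<and> b' x z = 0")
    case True
    then show ?thesis
      using IH E by (auto simp: algebra_simps)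
  next
    case False
    then have Tx: "norm (T x z - R) \<le> e" "norm (T' x z - R') \<le> e'"
      using Cons.prems(3,4) [of x] by auto
    have "overwrite b T S (x # xs) z - R = (1 - b x z) *\<^sub>R (?G - R) + b x z *\<^sub>R (T x z - R)"
      by (simp add: algebra_simps)
    also have "norm \<dots> \<le> (1 - b x z) * norm (?G - R) + b x z * norm (T x z - R)"
      using b01 norm_triangle_ineq [of "(1 - b x z) *\<^sub>R (?G - R)" "b x z *\<^sub>R (T x z - R)"] by simp
    also have "\<dots> \<le> (1 - b x z) * e + b x z * e"
      using b01 by (intro add_mono mult_left_mono IH Tx) auto
    finally have 1: "norm (overwrite b T S (x # xs) z - R) \<le> e"
      by (simp add: algebra_simps)
    let ?B = "blinfun_scaleR_left (T x z - ?G) o\<^sub>L b' x z"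
    have B: "norm ?B \<le> \<kappa> * (2 * e)"
    proof (rule norm_blinfun_bound [OF E(2)])
      fix v
      have "norm (T x z - ?G) \<le> 2 * e"
        using norm_triangle_ineq4 [of "T x z - R" "?G - R"] IH Tx by simp
      moreover have "norm (b' x z v) \<le> \<kappa> * norm v"
        using Cons.prems(2) [of x] by (intro order_trans [OF norm_blinfun] mult_right_mono) auto
      ultimately have "norm (b' x z v) * norm (T x z - ?G) \<le> (\<kappa> * norm v) * (2 * e)"
        using \<kappa> by (intro mult_mono) auto
      then show "norm (?B v) \<le> \<kappa> * (2 * e) * norm v"
        by (simp add: mult_ac)
    qed
    have "overwrite' b b' T T' S S' (x # xs) z - R' = ((1 - b x z) *\<^sub>R (?G' - R') + b x z *\<^sub>R (T' x z - R')) + ?B"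
      by (simp add: algebra_simps)
    also have "norm \<dots> \<le> ((1 - b x z) * norm (?G' - R') + b x z * norm (T' x z - R')) + norm ?B"
      using b01 norm_triangle_ineq [of "(1 - b x z) *\<^sub>R (?G' - R')" "b x z *\<^sub>R (T' x z - R')"]
      by (intro norm_triangle_le add_mono) auto
    also have "\<dots> \<le> ((1 - b x z) * (e' + ?E) + b x z * (e' + ?E)) + \<kappa> * (2 * e)"
      using b01 E(1) by (intro add_mono mult_left_mono IH B order_trans [OF Tx(2)]) auto
    finally have "norm (overwrite' b b' T T' S S' (x # xs) z - R') \<le> e' + real (length (x # xs)) * (\<kappa> * (2 * e))"
      by (simp add: algebra_simps)
    with 1 show ?thesis by blast
  qed
qed (use S in auto)

lemma overwrite_unchanged:
  assumes "\<And>x. x \<in> set xs \<Longrightarrow> b x z = 0 \<and> b' x z = 0"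
  shows "overwrite b T S xs z = S z \<and> overwrite' b b' T T' S S' xs z = S' z"
  using assms by (induction xs) auto

text \<open>Where some cut-off is 1 with vanishing derivative, its step erases whatever came
  before.\<close>

lemma overwrite_independent_of_start:
  assumes "x \<in> set xs" "b x z = 1" "b' x z = 0"
  shows "overwrite b T S xs z = overwrite b T R xs z
    \<and> overwrite' b b' T T' S S' xs z = overwrite' b b' T T' R R' xs z"
  using assms(1)
proof (induction xs)
  case (Cons y ys)
  show ?case
  proof (cases "x \<in> set ys")
    case True
    then show ?thesis using Cons.IH by simp
  next
    case False
    then have "y = x" using Cons.prems by auto
    then show ?thesis using assms by simp
  qed
qed simp

text \<open>One representative from each grid cell that meets \<open>U\<close>; the cells are
  counted in a cube containing \<open>U\<close>.\<close>

lemma finite_net_card: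
  fixes U :: "(real ^ 'n::finite) set"
  assumes "bounded U"
  shows "\<exists>C>0. \<forall>\<delta>. 0 < \<delta> \<longrightarrow> \<delta> \<le> 1 \<longrightarrow>
    (\<exists>xs. set xs \<subseteq> U \<and> (\<forall>u\<in>U. \<exists>x\<in>set xs. dist u x < \<delta>) \<and> real (length xs) \<le> C / \<delta> ^ CARD('n))"
proof -
  let ?n = "CARD('n)"
  obtain R where R: "R > 0" "\<And>x. x \<in> U \<Longrightarrow> norm x \<le> R"
    using assms bounded_pos by metis
  \<comment> \<open>With side \<open>\<delta> / N\<close> the sum of the coordinate differences
    within a cell is at most \<open>CARD('n) * \<delta> / N\<close>, strictly below
    \<open>\<delta>\<close>.\<close>
  define N where "N = real ?n + 1"
  define C where "C = (2 * R * N + 3) ^ ?n"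
  have N: "N > 0" by (simp add: N_def)
  show ?thesis
  proof (intro exI [of _ C] conjI allI impI)
    show "C > 0" unfolding C_def using R N by (intro zero_less_power) (simp add: add_pos_pos)
    fix \<delta> :: real assume \<delta>: "0 < \<delta>" "\<delta> \<le> 1"
    define s where "s = \<delta> / N"
    have s: "s > 0" using \<delta> N by (simp add: s_def)
    define cell where "cell x = (\<lambda>j. \<lfloor>x $ j / s\<rfloor>)" for x :: "real ^ 'n"
    define m where "m = \<lceil>R / s\<rceil>"
    have "0 < R / s" using R s by simp
    then have m: "m \<ge> 0" unfolding m_def by linarith
    let ?P = "(UNIV :: 'n set) \<rightarrow>\<^sub>E {- m..m}"
    have cellP: "cell ` U \<subseteq> ?P"
    proof
      fix c assume "c \<in> cell ` U"
      then obtain x where x: "x \<in> U" "c = cell x" by blast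
      have "\<lfloor>x $ j / s\<rfloor> \<in> {- m..m}" for j
      proof -
        have "\<bar>x $ j\<bar> \<le> R"
          using component_le_norm_cart [of x j] R(2) [OF x(1)] by linarith
        then have "\<bar>x $ j / s\<bar> \<le> R / s"
          using s by (simp add: abs_divide divide_right_mono)
        then have "x $ j / s \<le> R / s" "- (R / s) \<le> x $ j / s"
          by linarith+
        moreover have "R / s \<le> of_int m" by (simp add: m_def)
        ultimately have "x $ j / s \<le> of_int m" "of_int (- m) \<le> x $ j / s" by auto
        then have "- m \<le> \<lfloor>x $ j / s\<rfloor>" "\<lfloor>x $ j / s\<rfloor> \<le> m"
          by linarith+
        then show ?thesis by simp
      qed
      then show "c \<in> ?P"
        using x by (auto simp: cell_def)
    qed
    have fin: "finite ?P" by (intro finite_PiE) auto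
    have fin': "finite (cell ` U)" by (rule finite_subset [OF cellP fin])
    define rep where "rep c = (SOME x. x \<in> U \<and> cell x = c)" for c
    have rep: "rep c \<in> U \<and> cell (rep c) = c" if "c \<in> cell ` U" for c
      unfolding rep_def by (rule someI_ex) (use that in blast)
    obtain xs where xs: "set xs = rep ` (cell ` U)" "distinct xs"
      using finite_distinct_list [OF finite_imageI [OF fin', of rep]] by (elim exE conjE) simp
    show "\<exists>xs. set xs \<subseteq> U \<and> (\<forall>u\<in>U. \<exists>x\<in>set xs. dist u x < \<delta>) \<and> real (length xs) \<le> C / \<delta> ^ ?n"
    proof (intro exI [of _ xs] conjI ballI)
      show "set xs \<subseteq> U"
        unfolding xs(1) using rep by (intro image_subsetI) simp
      fix u assume u: "u \<in> U"
      let ?x = "rep (cell u)"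
      have eq: "cell ?x = cell u" using rep [of "cell u"] u by blast
      have "\<bar>(u - ?x) $ j\<bar> \<le> s" for j
      proof -
        have "\<lfloor>?x $ j / s\<rfloor> = \<lfloor>u $ j / s\<rfloor>"
          using eq by (simp add: cell_def fun_eq_iff)
        then have "\<bar>u $ j / s - ?x $ j / s\<bar> \<le> 1" by linarith
        then have "\<bar>(u $ j - ?x $ j) / s\<bar> \<le> 1" by (simp add: diff_divide_distrib)
        then show ?thesis using s by (simp add: abs_divide)
      qed
      then have "norm (u - ?x) \<le> (\<Sum>j\<in>(UNIV::'n set). s)"
        by (intro order_trans [OF norm_le_l1_cart] sum_mono) auto
      also have "\<dots> < N * s"
        using s by (simp add: N_def algebra_simps)
      also have "\<dots> = \<delta>" using N by (simp add: s_def)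
      finally have "dist u ?x < \<delta>" by (simp add: dist_norm)
      then show "\<exists>x\<in>set xs. dist u x < \<delta>"
        using u xs(1) by blast
    next
      have "length xs = card (rep ` (cell ` U))"
        using xs distinct_card by metis
      also have "\<dots> \<le> card ?P"
        using card_image_le [OF fin', of rep] card_mono [OF fin cellP] by linarith
      also have "\<dots> = nat (2 * m + 1) ^ ?n"
        by (subst card_PiE) auto
      finally have "real (length xs) \<le> real (nat (2 * m + 1)) ^ ?n"
        by (metis of_nat_le_iff of_nat_power)
      also have "real (nat (2 * m + 1)) = 2 * of_int m + 1"
        using m by simp
      also have "(2 * of_int m + 1) ^ ?n \<le> ((2 * R * N + 3) / \<delta>) ^ ?n"
      proof (intro power_mono)
        have "of_int m \<le> R / s + 1" unfolding m_def by linarith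
        then have "2 * of_int m + 1 \<le> 2 * (R * N / \<delta>) + 3" by (simp add: s_def)
        also have "\<dots> \<le> 2 * (R * N / \<delta>) + 3 / \<delta>" using \<delta> by (simp add: field_simps)
        finally show "2 * of_int m + 1 \<le> (2 * R * N + 3) / \<delta>" by (simp add: add_divide_distrib)
      qed (use m in auto)
      finally show "real (length xs) \<le> C / \<delta> ^ ?n" by (simp add: C_def power_divide)
    qed
  qed
qed

section \<open>Construction of the extension\<close>

lemma infdist_lt_embed_closure:
  fixes U :: "(real ^ 'n::finite) set"
  assumes "U \<noteq> {}" "infdist z (embed_real ` closure U) < d"
  shows "\<exists>u\<in>U. norm (z - embed_real u) < d"
proof -
  let ?K = "embed_real ` closure U"
  have ne: "?K \<noteq> {}" using assms(1) by auto
  obtain c where c: "c \<in> closure U" "dist z (embed_real c) < d"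
    using assms(2) ne by (auto simp: infdist_notempty cINF_less_iff)
  obtain u where u: "u \<in> U" "dist u c < d - dist z (embed_real c)"
    using c by (metis closure_approachable diff_gt_0_iff_gt)
  have "dist (embed_real c) (embed_real u) = dist u c"
    by (simp add: dist_norm norm_embed_real norm_minus_commute
        flip: linear_diff [OF bounded_linear.linear [OF bounded_linear_embed_real]])
  then have "dist z (embed_real u) < d"
    using dist_triangle [of z "embed_real u" "embed_real c"] u by simp
  then show ?thesis
    using u by (auto simp: dist_norm)
qed

definition coord_form :: "('n::finite \<Rightarrow> complex) \<Rightarrow> (complex ^ 'n) \<Rightarrow>\<^sub>L complex" where
  "coord_form a = (\<Sum>j\<in>UNIV. blinfun_mult_left (a j) o\<^sub>L Blinfun (\<lambda>v. v $ j))"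

lemma coord_form_apply: "coord_form a v = (\<Sum>j\<in>UNIV. v $ j * a j)"
  by (simp add: coord_form_def blinfun.sum_left bounded_linear_Blinfun_apply bounded_linear_vec_nth)

lemma coord_form_diff_bound:
  fixes a b :: "'n::finite \<Rightarrow> complex"
  assumes "\<And>j. norm (a j - b j) \<le> e" "0 \<le> e"
  shows "norm (coord_form a - coord_form b) \<le> real CARD('n) * e"
proof (rule norm_blinfun_bound)
  fix v
  have "norm (\<Sum>j\<in>UNIV. v $ j * (a j - b j)) \<le> (\<Sum>j\<in>(UNIV::'n set). norm v * e)"
    by (intro sum_norm_le) (auto simp: norm_mult intro!: mult_mono assms Finite_Cartesian_Product.norm_nth_le)
  then show "norm ((coord_form a - coord_form b) v) \<le> real CARD('n) * e * norm v"
    by (simp add: blinfun.diff_left coord_form_apply sum_subtractf right_diff_distrib mult_ac)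
qed (use assms in auto)

lemma dbar_comp_coord_form: "dbar_comp l (coord_form a) = 0"
  by (simp add: dbar_comp_def coord_form_apply axis_def if_distrib [where f = "\<lambda>x. x * _"] cong: if_cong)

lemma norm_dbar_comp_le_norm: "norm (dbar_comp l L) \<le> norm L"
proof -
  have "norm (L (axis l 1)) \<le> norm L" "norm (L (axis l \<i>)) \<le> norm L"
    using norm_blinfun [of L "axis l 1"] norm_blinfun [of L "axis l \<i>"] by (simp_all add: norm_axis)
  then have "norm (L (axis l 1) + \<i> * L (axis l \<i>)) \<le> norm L + norm L"
    by (intro norm_triangle_le add_mono) (simp_all add: norm_mult)
  then show ?thesis
    by (simp add: dbar_comp_def norm_divide)
qed

lemma dbar_comp_diff: "dbar_comp l (L - L') = dbar_comp l L - dbar_comp l L'"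
  by (simp add: dbar_comp_def blinfun.diff_left algebra_simps diff_divide_distrib add_divide_distrib)

locale extension = jet_estimates l f U n Q A \<sigma> \<tau>
  for l and f :: "real ^ 'n::finite \<Rightarrow> real" and U n Q A \<sigma> \<tau> +
  fixes \<delta>0 CN E0 D :: real and X :: "nat \<Rightarrow> (real ^ 'n) list" and mm :: "nat \<Rightarrow> real"
  assumes U_ne: "U \<noteq> {}" and bounded_U: "bounded U"
    and \<delta>0: "0 < \<delta>0" "\<delta>0 \<le> 1" and opt_\<delta>0: "2 \<le> opt (\<tau> * \<delta>0)"
    and X_sub: "\<And>i. set (X i) \<subseteq> U"
    and X_net: "\<And>i u. u \<in> U \<Longrightarrow> \<exists>x\<in>set (X i). dist u x < \<delta>0 / 4 ^ i"
    and X_len: "\<And>i. real (length (X i)) \<le> CN / (\<delta>0 / 4 ^ i) ^ CARD('n)"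
    and CN: "CN > 0" and E0: "E0 > 0" and D: "D > 0" and mm: "\<And>j. mm j \<ge> 0"
    and l_mm: "\<And>j. l (j + (CARD('n) + 3)) \<le> E0 * D ^ j * mm j"
begin

definition sc :: "nat \<Rightarrow> real" where "sc i = \<delta>0 / 4 ^ i"

lemma sc_pos: "sc i > 0" and sc_Suc: "sc (Suc i) = sc i / 4"
  using \<delta>0 by (auto simp: sc_def)

lemma sc_add_le: "sc (I + i) \<le> sc I * (1/2) ^ i"
proof -
  have "(1/4::real) ^ i \<le> (1/2) ^ i"
    by (intro power_mono) auto
  then have "sc I * (1/4) ^ i \<le> sc I * (1/2) ^ i"
    using sc_pos [of I] by (intro mult_left_mono) auto
  then show ?thesis
    by (simp add: sc_def power_add power_divide)
qed

lemma sc_le: "sc i \<le> \<delta>0"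
proof -
  have "sc i \<le> \<delta>0 / 1"
    unfolding sc_def using \<delta>0 by (intro divide_left_mono) auto
  then show ?thesis by simp
qed

lemma sc_le_1: "sc i \<le> 1"
  using sc_le [of i] \<delta>0(2) by linarith

lemma opt_sc: "2 \<le> opt (\<tau> * sc i)"
proof -
  have "opt (\<tau> * \<delta>0) \<le> opt (\<tau> * sc i)"
    using \<tau> sc_pos sc_le by (intro opt_antimono) auto
  then show ?thesis using opt_\<delta>0 by linarith
qed

definition ap where "ap i x z = approx (sc i) [] x z"
definition ap' where "ap' i x z = coord_form (\<lambda>j. approx (sc i) [j] x z)"

definition E where "E i = err (sc i)"

lemma E_nonneg: "E i \<ge> 0"
  unfolding E_def err_def using A n_ge_1 \<tau> sc_pos [of i] opt_val_nonneg [of "\<tau> * sc i"]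
  by (intro mult_nonneg_nonneg divide_nonneg_pos) auto

lemma C1_with_ap:
  assumes x: "x \<in> U"
  shows "C1_with (ap i x) (ap' i x)"
  unfolding C1_with_def
proof (intro conjI allI)
  show "(ap i x has_derivative ap' i x z) (at z)" for z
    using approx_has_derivative [OF x opt_sc]
    by (simp add: ap_def [abs_def] ap'_def coord_form_apply [abs_def])
  have "continuous_on UNIV (approx (sc i) js x)" for js
    unfolding approx_def [abs_def] taylor_def
    by (intro continuous_intros continuous_on_compose2 [OF has_derivative_continuous_on [OF jet_form_has_derivative [OF f U x, THEN has_derivative_at_withinI]], of UNIV])
      auto
  then show "continuous_on UNIV (ap' i x)"
    unfolding ap'_def [abs_def] coord_form_def
    by (intro continuous_intros bounded_linear.continuous_on [OF bounded_linear_blinfun_mult_left]) auto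
qed

lemma
  assumes "x \<in> U" "y \<in> U" "norm (z - embed_real x) \<le> 4 * sc i" "norm (z - embed_real y) \<le> 4 * sc i"
  shows ap_base_diff: "norm (ap i y z - ap i x z) \<le> E i"
    and ap'_base_diff: "norm (ap' i y z - ap' i x z) \<le> n * E i"
proof -
  show "norm (ap i y z - ap i x z) \<le> E i"
    unfolding ap_def E_def using assms by (intro approx_base_diff sc_pos sc_le_1 opt_sc) auto
  show "norm (ap' i y z - ap' i x z) \<le> n * E i"
  proof -
    have "norm (approx (sc i) [j] y z - approx (sc i) [j] x z) \<le> E i" for j
      unfolding E_def using assms by (intro approx_base_diff sc_pos sc_le_1 opt_sc) auto
    then show ?thesis
      unfolding ap'_def using coord_form_diff_bound [of "\<lambda>j. approx (sc i) [j] y z" "\<lambda>j. approx (sc i) [j] x z" "E i"]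
        E_nonneg [of i]
      by (simp add: n [symmetric])
  qed
qed

lemma
  assumes "x \<in> U" "norm (z - embed_real x) \<le> 4 * sc i"
  shows ap_degree_diff: "norm (ap (Suc i) x z - ap i x z) \<le> E i"
    and ap'_degree_diff: "norm (ap' (Suc i) x z - ap' i x z) \<le> n * E i"
proof -
  show "norm (ap (Suc i) x z - ap i x z) \<le> E i"
    unfolding ap_def E_def sc_Suc using assms by (intro approx_degree_diff sc_pos sc_le_1 opt_sc) auto
  show "norm (ap' (Suc i) x z - ap' i x z) \<le> n * E i"
  proof -
    have "norm (approx (sc i / 4) [j] x z - approx (sc i) [j] x z) \<le> E i" for j
      unfolding E_def using assms by (intro approx_degree_diff sc_pos sc_le_1 opt_sc) auto
    then show ?thesis
      unfolding ap'_def sc_Suc using coord_form_diff_bound [of "\<lambda>j. approx (sc i / 4) [j] x z" "\<lambda>j. approx (sc i) [j] x z" "E i"]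
        E_nonneg [of i]
      by (simp add: n [symmetric])
  qed
qed

abbreviation bm where "bm i x \<equiv> bump (sc i) (embed_real x :: complex ^ 'n)"
abbreviation bm' where "bm' i x \<equiv> bump' (sc i) (embed_real x :: complex ^ 'n)"

text \<open>Starting from the zero function keeps every stage zero outside the union of the cut-off
  supports, which yields the compact support of the limit.\<close>

primrec G :: "nat \<Rightarrow> complex ^ 'n \<Rightarrow> complex" where
  "G 0 = overwrite (bm 0) (ap 0) (\<lambda>_. 0) (X 0)"
| "G (Suc i) = overwrite (bm (Suc i)) (ap (Suc i)) (G i) (X (Suc i))"

primrec G' :: "nat \<Rightarrow> complex ^ 'n \<Rightarrow> (complex ^ 'n) \<Rightarrow>\<^sub>L complex" where
  "G' 0 = overwrite' (bm 0) (bm' 0) (ap 0) (ap' 0) (\<lambda>_. 0) (\<lambda>_. 0) (X 0)"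
| "G' (Suc i) = overwrite' (bm (Suc i)) (bm' (Suc i)) (ap (Suc i)) (ap' (Suc i)) (G i) (G' i) (X (Suc i))"

lemma X_in_U: "x \<in> set (X i) \<Longrightarrow> x \<in> U"
  using X_sub by blast

lemma C1_with_G: "C1_with (G i) (G' i)"
proof (induction i)
  case 0
  have "C1_with (\<lambda>_. 0) (\<lambda>_. 0)"
    by (simp add: C1_with_def zero_blinfun.rep_eq [abs_def])
  then show ?case
    by (auto intro!: C1_with_overwrite bump_has_derivative continuous_on_bump' C1_with_ap X_in_U)
next
  case (Suc i)
  then show ?case
    by (auto intro!: C1_with_overwrite bump_has_derivative continuous_on_bump' C1_with_ap X_in_U)
qed

lemma active_near:
  assumes "bm i x z \<noteq> 0 \<or> bm' i x z \<noteq> 0"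
  shows "norm (z - embed_real x) < 3 * sc i"
  using assms bump_eq_0 [OF sc_pos, of i z "embed_real x"] bump'_eq_0 [OF sc_pos, of i z "embed_real x"]
  by (force simp: dist_norm)

definition cn where "cn i = CN / sc i ^ CARD('n)"

lemma length_X: "real (length (X i)) \<le> cn i"
  using X_len by (simp add: cn_def sc_def)

definition H where "H i = n * E i + cn i * (5 / sc i * (2 * E i))"

text \<open>A net point within \<open>sc i\<close> of \<open>u\<close> is within
  \<open>2 * sc i\<close> of \<open>z\<close>, so its cut-off is 1 at \<open>z\<close> and the
  preceding stage is erased there. It may therefore be replaced by \<open>ap i y\<close> itself,
  after which \<open>overwrite_bound\<close> applies with reference \<open>ap i y\<close>: errors of
  earlier stages do not propagate.\<close>

lemma G_near_ap:
  assumes u: "u \<in> U" "norm (z - embed_real u) < sc i" and y: "y \<in> U" "norm (z - embed_real y) \<le> 4 * sc i"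
  shows "norm (G i z - ap i y z) \<le> E i" "norm (G' i z - ap' i y z) \<le> H i"
proof -
  obtain S S' where G: "G i = overwrite (bm i) (ap i) S (X i)" "G' i = overwrite' (bm i) (bm' i) (ap i) (ap' i) S S' (X i)"
    by (cases i) auto
  obtain x where x: "x \<in> set (X i)" "dist u x < sc i"
    using X_net [OF u(1)] unfolding sc_def by blast
  have "dist (embed_real u) (embed_real x) = dist u x"
    by (simp add: dist_norm norm_embed_real
        flip: linear_diff [OF bounded_linear.linear [OF bounded_linear_embed_real]])
  then have "dist z (embed_real x) \<le> 2 * sc i"
    using dist_triangle [of z "embed_real x" "embed_real u"] u(2) x(2) by (simp add: dist_norm)
  then have b: "bm i x z = 1" "bm' i x z = 0"
    by (simp_all add: bump_eq_1 bump'_eq_0_inner sc_pos)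
  note ind = overwrite_independent_of_start [of x "X i" "bm i" z "bm' i", OF x(1) b]
  have eq: "G i z = overwrite (bm i) (ap i) (ap i y) (X i) z"
    "G' i z = overwrite' (bm i) (bm' i) (ap i) (ap' i) (ap i y) (ap' i y) (X i) z"
    unfolding G using ind by blast+
  have "norm (overwrite (bm i) (ap i) (ap i y) (X i) z - ap i y z) \<le> E i \<and>
     norm (overwrite' (bm i) (bm' i) (ap i) (ap' i) (ap i y) (ap' i y) (X i) z - ap' i y z)
       \<le> n * E i + real (length (X i)) * (5 / sc i * (2 * E i))"
  proof (rule overwrite_bound)
    fix x assume x: "x \<in> set (X i)" and "bm i x z \<noteq> 0 \<or> bm' i x z \<noteq> 0"
    then have "norm (z - embed_real x) \<le> 4 * sc i"
      using active_near sc_pos [of i] by force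
    then show "norm (ap i x z - ap i y z) \<le> E i" "norm (ap' i x z - ap' i y z) \<le> n * E i"
      using y X_in_U [OF x] by (auto intro: ap_base_diff ap'_base_diff)
  qed (use E_nonneg n_ge_1 in \<open>auto simp: bump_bounds norm_bump' sc_pos\<close>)
  moreover have "real (length (X i)) * (5 / sc i * (2 * E i)) \<le> cn i * (5 / sc i * (2 * E i))"
    using E_nonneg [of i] sc_pos [of i] by (intro mult_right_mono length_X) auto
  ultimately show "norm (G i z - ap i y z) \<le> E i" "norm (G' i z - ap' i y z) \<le> H i"
    unfolding eq H_def by linarith+
qed

text \<open>Only the factor \<open>1 / \<delta>\<close> can grow. The decay of \<open>E\<close> that
  makes the stages converge is obtained in \<open>w_le\<close>.\<close>

lemma E_Suc: "E (Suc i) \<le> 4 * E i"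
proof -
  have "opt_val (\<tau> * sc (Suc i)) \<le> l (opt (\<tau> * sc i)) * (\<tau> * sc (Suc i)) ^ opt (\<tau> * sc i)"
    using \<tau> sc_pos by (intro opt_val_le) auto
  also have "\<dots> \<le> opt_val (\<tau> * sc i)"
    unfolding opt_val_def using \<tau> sc_pos [of i] l_pos
    by (intro mult_left_mono power_mono) (auto simp: sc_Suc less_imp_le)
  finally have "2 * n * A / sc (Suc i) * opt_val (\<tau> * sc (Suc i)) \<le> 2 * n * A / sc (Suc i) * opt_val (\<tau> * sc i)"
    using n_ge_1 A sc_pos [of "Suc i"] by (intro mult_left_mono) auto
  then show ?thesis
    by (simp add: E_def err_def sc_Suc)
qed

text \<open>\<open>12 * n\<close> covers the value increment and the terms with \<open>n\<close>,
  \<open>20 * CN\<close> two copies of \<open>H\<close>, and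
  \<open>240 * 4 ^ CARD('n) * CN = 10 * 6 * 4 ^ (CARD('n) + 1) * CN\<close> the cut-off derivatives
  at the next, four times smaller, scale.\<close>

definition Cb where "Cb = 12 * n + 20 * CN + 240 * 4 ^ CARD('n) * CN"

definition w where "w i = Cb * E i / sc i ^ (CARD('n) + 1)"

lemma div_sc_power_ge: "0 \<le> a \<Longrightarrow> a \<le> a / sc i ^ k"
  using sc_pos [of i] sc_le_1 [of i] power_le_one [of "sc i" k]
  by (simp add: pos_le_divide_eq mult_left_le)

lemma cn_eq: "cn i * (5 / sc i * c) = 5 * CN * c / sc i ^ (CARD('n) + 1)"
  by (simp add: cn_def mult_ac)

lemma H_le_w: "H i \<le> w i"
proof -
  let ?a = "E i / sc i ^ (CARD('n) + 1)"
  have a: "0 \<le> E i" "E i \<le> ?a" "0 \<le> ?a"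
    using E_nonneg [of i] div_sc_power_ge [of "E i" i "CARD('n) + 1"] by auto
  have "H i \<le> n * ?a + 10 * CN * ?a"
    unfolding H_def cn_eq using n_ge_1 a by (intro add_mono mult_left_mono) auto
  also have "\<dots> = (n + 10 * CN) * ?a" by (rule distrib_right [symmetric])
  also have "\<dots> \<le> Cb * ?a"
    unfolding Cb_def using n_ge_1 CN a(3) by (intro mult_right_mono) (auto intro: add_nonneg_nonneg)
  finally show ?thesis by (simp add: w_def)
qed

text \<open>Where a cut-off of stage \<open>Suc i\<close> is active, \<open>z\<close> is within
  \<open>3 * sc (Suc i) < sc i\<close> of its centre \<open>x0\<close>, so \<open>G_near_ap\<close>
  controls \<open>G i\<close> there. Both stages are compared with
  \<open>ap (Suc i) x0\<close>.\<close>

lemma G_increment: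
  "norm (G (Suc i) z - G i z) \<le> w i" "norm (G' (Suc i) z - G' i z) \<le> w i"
proof -
  let ?a = "E i / sc i ^ (CARD('n) + 1)"
  have a: "0 \<le> E i" "E i \<le> ?a" "0 \<le> ?a"
    using E_nonneg [of i] div_sc_power_ge [of "E i" i "CARD('n) + 1"] by auto
  have Cb: "Cb \<ge> 12 * n" "Cb \<ge> 0"
    unfolding Cb_def using n_ge_1 CN by auto
  have w0: "0 \<le> w i"
    using mult_nonneg_nonneg [OF Cb(2) a(3)] by (simp add: w_def)
  show "norm (G (Suc i) z - G i z) \<le> w i" "norm (G' (Suc i) z - G' i z) \<le> w i"
  proof (atomize(full), cases "\<exists>x\<in>set (X (Suc i)). bm (Suc i) x z \<noteq> 0 \<or> bm' (Suc i) x z \<noteq> 0")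
    case False
    then have "G (Suc i) z = G i z \<and>
       G' (Suc i) z = G' i z"
      unfolding G.simps G'.simps by (intro overwrite_unchanged) blast
    then show "norm (G (Suc i) z - G i z) \<le> w i \<and> norm (G' (Suc i) z - G' i z) \<le> w i"
      using w0 by simp
  next
    case True
    then obtain x0 where x0: "x0 \<in> set (X (Suc i))" "bm (Suc i) x0 z \<noteq> 0 \<or> bm' (Suc i) x0 z \<noteq> 0"
      by blast
    have x0U: "x0 \<in> U" by (rule X_in_U [OF x0(1)])
    have z0: "norm (z - embed_real x0) < 3 * sc (Suc i)"
      by (rule active_near [OF x0(2)])
    have z1: "norm (z - embed_real x0) < sc i" "norm (z - embed_real x0) \<le> 4 * sc i" "norm (z - embed_real x0) \<le> 4 * sc (Suc i)"
      using z0 sc_pos [of i] by (auto simp: sc_Suc)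
    define R where "R = ap (Suc i) x0 z"
    define R' where "R' = ap' (Suc i) x0 z"
    \<comment> \<open>\<open>2 * E i\<close> leads from \<open>G i\<close> via
      \<open>ap i x0\<close> to \<open>R\<close>; \<open>E (Suc i)\<close> leads from the other
      active polynomials to \<open>R\<close>. The sum serves as common bound.\<close>
    define e where "e = 2 * E i + E (Suc i)"
    define e' where "e' = H i + n * E i + n * E (Suc i)"
    have g: "norm (G i z - R) \<le> 2 * E i"
      using norm_triangle_ineq4 [of "G i z - ap i x0 z" "R - ap i x0 z"]
        G_near_ap(1) [OF x0U z1(1) x0U z1(2)] ap_degree_diff [OF x0U z1(2)]
      by (simp add: R_def)
    have g': "norm (G' i z - R') \<le> H i + n * E i"
      using norm_triangle_ineq4 [of "G' i z - ap' i x0 z" "R' - ap' i x0 z"]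
        G_near_ap(2) [OF x0U z1(1) x0U z1(2)] ap'_degree_diff [OF x0U z1(2)]
      by (simp add: R'_def)
    have H0: "0 \<le> H i"
      unfolding H_def cn_eq using n_ge_1 a CN sc_pos [of i] by auto
    have B: "norm (G (Suc i) z - R) \<le> e \<and>
       norm (G' (Suc i) z - R')
         \<le> e' + real (length (X (Suc i))) * (5 / sc (Suc i) * (2 * e))"
    proof (unfold G.simps G'.simps, rule overwrite_bound)
      fix x assume x: "x \<in> set (X (Suc i))" and "bm (Suc i) x z \<noteq> 0 \<or> bm' (Suc i) x z \<noteq> 0"
      then have "norm (z - embed_real x) \<le> 4 * sc (Suc i)"
        using active_near sc_pos [of "Suc i"] by force
      then have "norm (ap (Suc i) x z - R) \<le> E (Suc i)" "norm (ap' (Suc i) x z - R') \<le> n * E (Suc i)"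
        unfolding R_def R'_def using x0U z1 X_in_U [OF x] by (auto intro: ap_base_diff ap'_base_diff)
      then show "norm (ap (Suc i) x z - R) \<le> e" "norm (ap' (Suc i) x z - R') \<le> e'"
        unfolding e_def e'_def using a(1) H0 n_ge_1 mult_nonneg_nonneg [of n "E i"] by linarith+
    next
      show "norm (G i z - R) \<le> e"
        unfolding e_def using g E_nonneg [of "Suc i"] by linarith
      show "norm (G' i z - R') \<le> e'"
        unfolding e'_def using g' E_nonneg [of "Suc i"] n_ge_1 by (auto intro: add_increasing2)
    qed (auto simp: bump_bounds norm_bump' sc_pos)
    have e: "0 \<le> e" "e \<le> 6 * E i"
      unfolding e_def using E_nonneg [of i] E_nonneg [of "Suc i"] E_Suc [of i] by linarith+
    have "norm (G (Suc i) z - G i z) \<le> e + 2 * E i"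
      using norm_triangle_ineq4 [of "G (Suc i) z - R" "G i z - R"] B g by simp
    also have "\<dots> \<le> 12 * E i"
      using e a by linarith
    also have "\<dots> \<le> Cb * ?a"
      using Cb n_ge_1 a by (intro mult_mono) auto
    finally have 1: "norm (G (Suc i) z - G i z) \<le> w i"
      by (simp add: w_def)
    have "norm (G' (Suc i) z - G' i z) \<le> e' + cn (Suc i) * (5 / sc (Suc i) * (2 * e)) + (H i + n * E i)"
    proof -
      have "real (length (X (Suc i))) * (5 / sc (Suc i) * (2 * e)) \<le> cn (Suc i) * (5 / sc (Suc i) * (2 * e))"
        using e sc_pos [of "Suc i"] by (intro mult_right_mono length_X) auto
      then show ?thesis
        using norm_triangle_ineq4 [of "G' (Suc i) z - R'" "G' i z - R'"] B g' by simp
    qed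
    also have "\<dots> = 2 * H i + 2 * (n * E i) + n * E (Suc i) + 10 * CN * e / sc (Suc i) ^ (CARD('n) + 1)"
      unfolding cn_eq by (simp add: e'_def)
    also have "\<dots> \<le> 2 * (n * ?a + 10 * CN * ?a) + 2 * (n * ?a) + n * (4 * ?a) + 240 * 4 ^ CARD('n) * CN * ?a"
    proof (intro add_mono mult_left_mono)
      show "H i \<le> n * ?a + 10 * CN * ?a"
        unfolding H_def cn_eq using n_ge_1 a by (intro add_mono mult_left_mono) auto
      have "10 * CN * e / sc (Suc i) ^ (CARD('n) + 1) \<le> 10 * CN * (6 * E i) / sc (Suc i) ^ (CARD('n) + 1)"
        using e CN sc_pos [of "Suc i"] by (intro divide_right_mono mult_left_mono) auto
      also have "\<dots> = 240 * 4 ^ CARD('n) * CN * ?a"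
        by (simp add: sc_Suc power_divide)
      finally show "10 * CN * e / sc (Suc i) ^ (CARD('n) + 1) \<le> 240 * 4 ^ CARD('n) * CN * ?a" .
    qed (use a n_ge_1 E_Suc [of i] in auto)
    also have "\<dots> \<le> Cb * ?a"
    proof -
      have "2 * (n * t + 10 * CN * t) + 2 * (n * t) + n * (4 * t) + 240 * 4 ^ CARD('n) * CN * t \<le> Cb * t"
        if "t \<ge> 0" for t
        using mult_nonneg_nonneg [of n t] n_ge_1 that by (simp add: Cb_def algebra_simps)
      then show ?thesis using a(3) .
    qed
    finally have 2: "norm (G' (Suc i) z - G' i z) \<le> w i"
      by (simp add: w_def)
    show "norm (G (Suc i) z - G i z) \<le> w i \<and> norm (G' (Suc i) z - G' i z) \<le> w i"
      using 1 2 by blast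
  qed
qed

definition C1 where "C1 = Cb * (2 * n * A) * (E0 * \<tau> ^ (CARD('n) + 3))"

lemma C1_nonneg: "C1 \<ge> 0"
  unfolding C1_def Cb_def using n_ge_1 CN A E0 \<tau> by simp

text \<open>Of the \<open>CARD('n) + 3\<close> extra powers of the scale, \<open>w\<close> divides
  by \<open>CARD('n) + 1\<close> and \<open>err\<close> by one. The last one stays as the factor
  \<open>sc i\<close>.\<close>

lemma w_le: "w i \<le> C1 * (mm j * (D * \<tau> * sc i) ^ j) * sc i"
proof -
  let ?d = "CARD('n)" and ?s = "sc i"
  have s: "?s > 0" by (rule sc_pos)
  have "opt_val (\<tau> * ?s) \<le> l (j + (?d + 3)) * (\<tau> * ?s) ^ (j + (?d + 3))"
    using \<tau> s by (intro opt_val_le) auto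
  also have "\<dots> \<le> (E0 * D ^ j * mm j) * (\<tau> * ?s) ^ (j + (?d + 3))"
    using \<tau> s by (intro mult_right_mono l_mm) auto
  finally have "w i \<le> Cb * (2 * n * A / ?s * ((E0 * D ^ j * mm j) * (\<tau> * ?s) ^ (j + (?d + 3)))) / ?s ^ (?d + 1)"
    unfolding w_def E_def err_def Cb_def using n_ge_1 CN A s
    by (intro divide_right_mono mult_left_mono) auto
  also have "\<dots> = C1 * (mm j * (D * \<tau> * sc i) ^ j) * sc i"
    using s by (simp add: C1_def power_mult_distrib power_add field_simps power3_eq_cube)
  finally show ?thesis .
qed

section \<open>Passage to the limit\<close>

definition F where "F z = lim (\<lambda>i. G i z)"
definition F' where "F' z = lim (\<lambda>i. G' i z)"

text \<open>Stated in a Banach space to serve values and derivatives alike. The exponent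
  \<open>j\<close> is free at each scale; choosing it optimally produces \<open>h_fun\<close> in the
  end.\<close>

lemma limit_of_increments:
  fixes Y :: "nat \<Rightarrow> 'z::banach"
  assumes Y: "\<And>i. norm (Y (Suc i) - Y i) \<le> w i"
  shows "Y \<longlonglongrightarrow> lim Y" "norm (Y I - lim Y) \<le> 2 * C1 * (mm j * (D * \<tau> * sc I) ^ j) * sc I"
proof -
  define c where "c I = C1 * (mm j * (D * \<tau> * sc I) ^ j) * sc I" for I
  have inc: "norm (Y (I + i) - Y (I + Suc i)) \<le> c I * (1/2) ^ i" for I i
  proof -
    have le: "sc (I + i) \<le> sc I * (1/2) ^ i" by (rule sc_add_le)
    also have "\<dots> \<le> sc I * 1" using sc_pos [of I] by (intro mult_left_mono power_le_one) auto
    finally have le': "sc (I + i) \<le> sc I" by simp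
    have "norm (Y (I + i) - Y (I + Suc i)) \<le> w (I + i)"
      using Y [of "I + i"] by (simp add: norm_minus_commute)
    also have "\<dots> \<le> C1 * (mm j * (D * \<tau> * sc (I + i)) ^ j) * sc (I + i)"
      by (rule w_le)
    also have "\<dots> \<le> C1 * (mm j * (D * \<tau> * sc I) ^ j) * (sc I * (1/2) ^ i)"
      using C1_nonneg mm [of j] D \<tau> sc_pos [of I] sc_pos [of "I + i"] le le'
      by (intro mult_mono mult_left_mono power_mono) auto
    finally show ?thesis by (simp add: c_def)
  qed
  show L: "Y \<longlonglongrightarrow> lim Y"
    using geometric_increments_limit(1) [of Y "c 0"] inc [of 0] by simp
  have "(\<lambda>i. Y (I + i)) \<longlonglongrightarrow> lim Y"
    using LIMSEQ_ignore_initial_segment [OF L, of I] by (simp add: add.commute)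
  then have "lim (\<lambda>i. Y (I + i)) = lim Y"
    by (rule limI)
  then show "norm (Y I - lim Y) \<le> 2 * C1 * (mm j * (D * \<tau> * sc I) ^ j) * sc I"
    using geometric_increments_limit(2) [of "\<lambda>i. Y (I + i)" "c I" 0] inc [of I] by (simp add: c_def)
qed

lemma G_limit:
  "(\<lambda>i. G i z) \<longlonglongrightarrow> F z" "norm (G I z - F z) \<le> 2 * C1 * (mm j * (D * \<tau> * sc I) ^ j) * sc I"
  unfolding F_def by (intro limit_of_increments G_increment)+

lemma G'_limit: "norm (G' I z - F' z) \<le> 2 * C1 * (mm j * (D * \<tau> * sc I) ^ j) * sc I"
  unfolding F'_def by (intro limit_of_increments G_increment)

lemma sc_tendsto_0: "sc \<longlonglongrightarrow> 0"
proof -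
  have "(\<lambda>i. \<delta>0 * (1/4) ^ i) \<longlonglongrightarrow> \<delta>0 * 0"
    by (intro tendsto_intros LIMSEQ_power_zero) auto
  then show ?thesis by (simp add: sc_def [abs_def] power_divide)
qed

lemma eventually_sc_less: "e > 0 \<Longrightarrow> \<forall>\<^sub>F i in sequentially. c * sc i < e"
  using tendsto_mult [OF tendsto_const sc_tendsto_0, of c] by (auto dest: order_tendstoD(2))

lemma C1_with_F: "C1_with F F'"
proof -
  let ?c = "2 * C1 * mm 0"
  have r: "norm (G' i z - F' z) \<le> ?c * sc i" for i z
    using G'_limit [of i z 0] by simp
  have "\<exists>g. \<forall>z\<in>UNIV. (\<lambda>i. G i z) \<longlonglongrightarrow> g z \<and> (g has_derivative blinfun_apply (F' z)) (at z within UNIV)"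
  proof (rule has_derivative_sequence [OF _ C1_withD(1) [OF C1_with_G]])
    show "(\<lambda>i. G i 0) \<longlonglongrightarrow> F 0" by (rule G_limit)
    fix e :: real assume "e > 0"
    from eventually_sc_less [OF this, of ?c]
    show "\<forall>\<^sub>F i in sequentially. \<forall>z\<in>UNIV. \<forall>h. norm (G' i z h - F' z h) \<le> e * norm h"
    proof eventually_elim
      case (elim i)
      show ?case
      proof (intro ballI allI)
        fix z h
        have "norm (G' i z h - F' z h) \<le> norm (G' i z - F' z) * norm h"
          using norm_blinfun [of "G' i z - F' z" h] by (simp add: blinfun.diff_left)
        also have "\<dots> \<le> e * norm h"
          using r [of i z] elim by (intro mult_right_mono) auto
        finally show "norm (G' i z h - F' z h) \<le> e * norm h" .
      qed
    qed
  qed auto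
  then obtain g where g: "\<And>z. (\<lambda>i. G i z) \<longlonglongrightarrow> g z" "\<And>z. (g has_derivative blinfun_apply (F' z)) (at z)"
    by auto
  have "g = F"
    using LIMSEQ_unique [OF g(1) G_limit(1)] by (simp add: fun_eq_iff)
  moreover have "continuous_on UNIV F'"
  proof (rule uniform_limit_theorem)
    show "uniform_limit UNIV G' F' sequentially"
      unfolding uniform_limit_iff
    proof (intro allI impI)
      fix e :: real assume "e > 0"
      from eventually_sc_less [OF this, of ?c]
      show "\<forall>\<^sub>F i in sequentially. \<forall>z\<in>UNIV. dist (G' i z) (F' z) < e"
        by eventually_elim (auto simp: dist_norm intro: le_less_trans [OF r])
    qed
    show "\<forall>\<^sub>F i in sequentially. continuous_on UNIV (G' i)"
      by (intro always_eventually allI C1_withD(2) [OF C1_with_G])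
  qed auto
  ultimately show ?thesis
    using g(2) by (simp add: C1_with_def)
qed

end

section \<open>Properties of the limit function\<close>

lemma norm_le_sum_components: "norm (x :: complex ^ 'n::finite) \<le> (\<Sum>j\<in>UNIV. norm (x $ j))"
  unfolding norm_vec_def by (rule L2_set_le_sum) auto

lemma taylor_at_base: "taylor p [] f x (embed_real x) = complex_of_real (f x)"
proof -
  have "taylor p [] f x (embed_real x) = (\<Sum>k\<le>p. if k = 0 then complex_of_real (f x) else 0)"
    unfolding taylor_def by (rule sum.cong [OF refl]) (auto simp: gr0_conv_Suc)
  then show ?thesis by simp
qed

context extension
begin

abbreviation K where "K \<equiv> embed_real ` closure U"

lemma E_le_w: "E i \<le> w i"
proof -
  have "1 * E i \<le> Cb * E i"
    using E_nonneg n_ge_1 CN by (intro mult_right_mono) (auto simp: Cb_def intro: add_increasing2)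
  also have "\<dots> \<le> w i"
    unfolding w_def using E_nonneg n_ge_1 CN
    by (intro div_sc_power_ge mult_nonneg_nonneg) (auto simp: Cb_def)
  finally show ?thesis by simp
qed

lemma F_restrict:
  assumes x: "x \<in> U"
  shows "F (embed_real x) = complex_of_real (f x)"
proof -
  have "(\<lambda>i. G i (embed_real x) - complex_of_real (f x)) \<longlonglongrightarrow> 0"
  proof (rule Lim_null_comparison [OF always_eventually [OF allI]])
    fix i
    have "norm (G i (embed_real x) - ap i x (embed_real x)) \<le> E i"
      using sc_pos [of i] by (intro G_near_ap(1) [OF x _ x]) auto
    also have "\<dots> \<le> C1 * mm 0 * sc i"
      using E_le_w [of i] w_le [of i 0] by simp
    finally show "norm (G i (embed_real x) - complex_of_real (f x)) \<le> C1 * mm 0 * sc i"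
      by (simp add: ap_def approx_def taylor_at_base)
    show "(\<lambda>i. C1 * mm 0 * sc i) \<longlonglongrightarrow> 0"
      using tendsto_mult [OF tendsto_const sc_tendsto_0, of "C1 * mm 0"] by simp
  qed
  then have "(\<lambda>i. G i (embed_real x)) \<longlonglongrightarrow> complex_of_real (f x)"
    using LIM_zero_iff by blast
  then show ?thesis
    using LIMSEQ_unique [OF G_limit(1)] by blast
qed

text \<open>The derivative \<open>ap' I u z\<close> is complex-linear, so dbar sees only its
  distance to \<open>F' z\<close>: one unit \<open>t\<close> to stage \<open>I\<close> and two from
  there to the limit.\<close>

lemma dbar_F_near:
  assumes "infdist z K < sc I"
  shows "norm (dbar_comp k (F' z)) \<le> 3 * C1 * (mm j * (D * \<tau> * sc I) ^ j) * sc I"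
proof -
  obtain u where u: "u \<in> U" "norm (z - embed_real u) < sc I"
    using infdist_lt_embed_closure [OF U_ne assms] by blast
  define t where "t = C1 * (mm j * (D * \<tau> * sc I) ^ j) * sc I"
  have "norm (G' I z - ap' I u z) \<le> H I"
    using u sc_pos [of I] by (intro G_near_ap(2) [OF u u(1)]) auto
  also have "\<dots> \<le> t"
    using H_le_w [of I] w_le [of I j] by (simp add: t_def)
  finally have 1: "norm (G' I z - ap' I u z) \<le> t" .
  have 2: "norm (G' I z - F' z) \<le> 2 * t"
    using G'_limit [of I z j] by (simp add: t_def mult.assoc)
  have "F' z - ap' I u z = (G' I z - ap' I u z) - (G' I z - F' z)"
    by simp
  then have "norm (F' z - ap' I u z) \<le> 3 * t"
    using norm_triangle_ineq4 [of "G' I z - ap' I u z" "G' I z - F' z"] 1 2 by simp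
  moreover have "dbar_comp k (F' z) = dbar_comp k (F' z - ap' I u z)"
    by (simp add: dbar_comp_diff ap'_def dbar_comp_coord_form)
  ultimately show ?thesis
    using norm_dbar_comp_le_norm [of k "F' z - ap' I u z"] by (simp add: t_def mult.assoc)
qed

lemma F_compact_support: "\<exists>R. \<forall>z. R \<le> norm z \<longrightarrow> F z = 0 \<and> F' z = 0"
proof -
  obtain R where R: "\<And>x. x \<in> U \<Longrightarrow> norm x \<le> R"
    using bounded_U unfolding bounded_iff by blast
  have "F z = 0 \<and> F' z = 0" if z: "R + 3 \<le> norm z" for z
  proof -
    have inactive: "bm i x z = 0 \<and> bm' i x z = 0" if x: "x \<in> set (X i)" for i x
    proof (rule ccontr)
      assume "\<not> (bm i x z = 0 \<and> bm' i x z = 0)"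
      then have "norm (z - embed_real x) < 3 * sc i"
        by (intro active_near) blast
      then have "norm z < 3 + norm x"
        using norm_triangle_sub [of z "embed_real x"] sc_le_1 [of i] by (simp add: norm_embed_real)
      then show False
        using z R [OF X_in_U [OF x]] by simp
    qed
    have G0: "G i z = 0 \<and> G' i z = 0" for i
    proof (induction i)
      case 0
      show ?case
        using overwrite_unchanged [of "X 0" "bm 0" z "bm' 0"] inactive by simp
    next
      case (Suc i)
      then show ?case
        using overwrite_unchanged [of "X (Suc i)" "bm (Suc i)" z "bm' (Suc i)"] inactive by simp
    qed
    have "F' z = 0"
      by (simp add: F'_def G0)
    then show ?thesis
      by (simp add: F_def G0)
  qed
  then show ?thesis by blast
qed

lemma F_C1c: "C1c F"
proof -
  obtain R where R: "\<And>z. R \<le> norm z \<Longrightarrow> F z = 0"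
    using F_compact_support by blast
  then have "{z. F z \<noteq> 0} \<subseteq> ball 0 R"
    by (auto simp: not_le [symmetric])
  then have "bounded {z. F z \<noteq> 0}"
    using bounded_ball bounded_subset by blast
  then show ?thesis
    unfolding C1c_def using C1_with_F by (auto simp: C1_with_def compact_closure)
qed

lemma F'_bounded: "\<exists>B. \<forall>z. norm (F' z) \<le> B"
proof -
  obtain R where R: "\<And>z. R \<le> norm z \<Longrightarrow> F' z = 0"
    using F_compact_support by blast
  have "bounded (F' ` cball 0 R)"
    by (intro compact_imp_bounded compact_continuous_image C1_withD(2) [OF C1_with_F]) auto
  then obtain B where B: "\<And>z. z \<in> cball 0 R \<Longrightarrow> norm (F' z) \<le> B"
    unfolding bounded_iff by blast
  have "norm (F' z) \<le> max B 0" for z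
    using B [of z] R [of z] by (cases "norm z \<le> R") auto
  then show ?thesis by blast
qed

lemma F_almost_analytic:
  assumes mm_pos: "\<And>k. 0 < mm k" and mm_lim: "filterlim (\<lambda>k. root k (mm k)) at_top sequentially"
    and \<rho>: "4 * D * \<tau> \<le> \<rho>"
  shows "almost_analytic_ext (h_fun mm) \<rho> U f"
proof -
  have \<rho>0: "\<rho> > 0"
    using D \<tau> by (intro less_le_trans [OF _ \<rho>]) auto
  have att: "\<exists>k. h_fun mm t = mm k * t ^ k" if "t > 0" for t
    by (rule h_fun_attained [OF mm_pos mm_lim that])
  have h_pos: "h_fun mm t > 0" if "t > 0" for t
    using att [OF that] mm_pos that by auto
  have h_mono: "h_fun mm s \<le> h_fun mm t" if st: "0 < s" "s \<le> t" for s t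
  proof -
    obtain k where k: "h_fun mm t = mm k * t ^ k"
      using att [of t] st by auto
    have "h_fun mm s \<le> mm k * s ^ k"
      using st mm by (intro h_fun_le) auto
    also have "\<dots> \<le> mm k * t ^ k"
      using st mm by (intro mult_left_mono power_mono) auto
    finally show ?thesis by (simp add: k)
  qed
  obtain B where B: "\<And>z. norm (F' z) \<le> B"
    using F'_bounded by blast
  have B0: "0 \<le> B" by (rule order_trans [OF norm_ge_zero B])
  \<comment> \<open>The second argument handles points at distance at least
    \<open>\<delta>0\<close>, where boundedness of \<open>F'\<close> and monotonicity of
    \<open>h_fun\<close> suffice.\<close>
  define c where "c = max (3 * C1) (B / h_fun mm (\<rho> * \<delta>0))"
  have comp: "norm (dbar_comp k (F' z)) \<le> c * h_fun mm (\<rho> * infdist z K)" for z k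
  proof -
    let ?d = "infdist z K"
    consider "?d = 0" | "0 < ?d" "?d < \<delta>0" | "\<delta>0 \<le> ?d"
      using infdist_nonneg [of z K] by linarith
    then show ?thesis
    proof cases
      \<comment> \<open>Here \<open>h_fun\<close> is 0, so dbar has to vanish exactly; the estimate
        with \<open>j = 0\<close> holds at all scales.\<close>
      case 1
      have "(\<lambda>I. 3 * C1 * mm 0 * sc I) \<longlonglongrightarrow> 3 * C1 * mm 0 * 0"
        by (intro tendsto_intros sc_tendsto_0)
      then have "norm (dbar_comp k (F' z)) \<le> 3 * C1 * mm 0 * 0"
      proof (rule tendsto_lowerbound [OF _ always_eventually [OF allI]])
        fix I
        have "infdist z K < sc I" using 1 sc_pos by simp
        from dbar_F_near [OF this, of k 0] show "norm (dbar_comp k (F' z)) \<le> 3 * C1 * mm 0 * sc I"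
          by simp
      qed simp
      then show ?thesis
        using 1 by (simp add: h_fun_def)
    next
      case 2
      obtain i where i: "sc i < ?d"
        using eventually_sc_less [OF 2(1), of 1] unfolding eventually_sequentially by auto
      \<comment> \<open>The stage before \<open>i0\<close> has the scale matched to the distance:
        \<open>?d < sc I \<le> 4 * ?d\<close>. The second bound is the origin of the 4 in
        \<open>4 * D * \<tau>\<close>.\<close>
      define i0 where "i0 = (LEAST i. sc i \<le> ?d)"
      have i0: "sc i0 \<le> ?d"
        unfolding i0_def by (rule LeastI [of _ i]) (use i in simp)
      have "i0 \<noteq> 0"
        using i0 2 by (auto simp: sc_def intro: ccontr)
      then obtain I where I: "i0 = Suc I"
        using not0_implies_Suc by blast
      have dI: "?d < sc I"
        using not_less_Least [of I "\<lambda>i. sc i \<le> ?d"] I unfolding i0_def by simp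
      have Id: "sc I \<le> 4 * ?d"
        using i0 by (simp add: I sc_Suc)
      \<comment> \<open>The exponent at which the infimum defining \<open>h_fun\<close> is
        attained.\<close>
      obtain j where j: "h_fun mm (\<rho> * ?d) = mm j * (\<rho> * ?d) ^ j"
        using att [of "\<rho> * ?d"] \<rho>0 2 by auto
      have "D * \<tau> * sc I \<le> D * \<tau> * (4 * ?d)"
        using Id D \<tau> by (intro mult_left_mono) auto
      also have "\<dots> \<le> \<rho> * ?d"
        using mult_right_mono [OF \<rho>, of ?d] 2 by (simp add: mult_ac)
      finally have le: "D * \<tau> * sc I \<le> \<rho> * ?d" .
      have "norm (dbar_comp k (F' z)) \<le> 3 * C1 * (mm j * (D * \<tau> * sc I) ^ j) * sc I"
        by (rule dbar_F_near [OF dI])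
      also have "\<dots> \<le> 3 * C1 * (mm j * (\<rho> * ?d) ^ j) * 1"
      proof -
        have "(D * \<tau> * sc I) ^ j \<le> (\<rho> * ?d) ^ j"
          using D \<tau> sc_pos [of I] by (intro power_mono le) auto
        then have "3 * C1 * (mm j * (D * \<tau> * sc I) ^ j) \<le> 3 * C1 * (mm j * (\<rho> * ?d) ^ j)"
          using C1_nonneg mm by (intro mult_left_mono) auto
        then show ?thesis
          by (rule mult_mono) (use C1_nonneg mm [of j] \<rho>0 2 sc_pos [of I] sc_le_1 [of I] in auto)
      qed
      also have "\<dots> \<le> c * h_fun mm (\<rho> * ?d)"
        unfolding j using mm \<rho>0 2 by (auto simp: c_def intro!: mult_right_mono)
      finally show ?thesis .
    next
      case 3
      have "norm (dbar_comp k (F' z)) \<le> B"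
        using norm_dbar_comp_le_norm B order_trans by blast
      also have "\<dots> = B / h_fun mm (\<rho> * \<delta>0) * h_fun mm (\<rho> * \<delta>0)"
        using h_pos [of "\<rho> * \<delta>0"] \<rho>0 \<delta>0 by simp
      also have "\<dots> \<le> c * h_fun mm (\<rho> * ?d)"
        using h_pos [of "\<rho> * \<delta>0"] \<rho>0 \<delta>0 3 B0
        by (intro mult_mono h_mono) (auto simp: c_def less_imp_le le_max_iff_disj)
      finally show ?thesis .
    qed
  qed
  have h_nonneg: "0 \<le> h_fun mm (\<rho> * infdist z K)" for z
    using h_pos [of "\<rho> * infdist z K"] by (cases "\<rho> * infdist z K > 0") (auto simp: h_fun_def)
  have "norm (dbar F z) \<le> max 1 (n * c) * h_fun mm (\<rho> * infdist z K)" for z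
  proof -
    have "norm (dbar F z) \<le> (\<Sum>j\<in>UNIV. norm (dbar F z $ j))"
      by (rule norm_le_sum_components)
    also have "\<dots> \<le> (\<Sum>j\<in>(UNIV :: 'n set). c * h_fun mm (\<rho> * infdist z K))"
      by (rule sum_mono) (use comp in \<open>simp add: dbar_comp_nth [OF C1_with_F]\<close>)
    also have "\<dots> = (n * c) * h_fun mm (\<rho> * infdist z K)"
      by (simp add: n)
    also have "\<dots> \<le> max 1 (n * c) * h_fun mm (\<rho> * infdist z K)"
      using h_nonneg by (intro mult_right_mono) auto
    finally show ?thesis .
  qed
  then show ?thesis
    unfolding almost_analytic_ext_def using F_C1c F_restrict
    by (intro exI [of _ F] exI [of _ "max 1 (n * c)"]) auto
qed

end

section \<open>From the class to the extension, and the equivalence\<close>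

lemma B_class_partials_bound:
  fixes U :: "(real ^ 'n::finite) set"
  assumes f: "f \<in> B_class W U" and U: "open U" and N: "N \<in> W" and \<rho>: "\<rho> > 0"
  shows "\<exists>C. \<forall>x\<in>U. \<forall>js. \<bar>partials js f x\<bar> \<le> C * (\<rho> ^ length js * N (length js))"
proof -
  have sm: "smooth_on U f"
    using f by (simp add: B_class_def)
  obtain C where C: "\<And>x \<alpha>. x \<in> U \<Longrightarrow> \<bar>pderiv_mi \<alpha> f x\<bar> \<le> C * (\<rho> ^ mi_order \<alpha> * N (mi_order \<alpha>))"
    using f N \<rho> unfolding B_class_def by blast
  have "\<bar>partials js f x\<bar> \<le> C * (\<rho> ^ length js * N (length js))" if x: "x \<in> U" for x js
  proof -
    let ?\<alpha> = "count (mset js)"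
    define js' where "js' = (SOME js'. \<forall>j. count (mset js') j = ?\<alpha> j)"
    have "\<forall>j. count (mset js') j = ?\<alpha> j"
      unfolding js'_def by (rule someI [of _ js]) simp
    then have "mset js = mset js'"
      by (simp add: multiset_eq_iff)
    then have "partials js f x = pderiv_mi ?\<alpha> f x"
      unfolding pderiv_mi_def js'_def [symmetric] by (rule partials_permute [OF sm U x])
    moreover have "mi_order ?\<alpha> = length js"
      by (rule length_of_count [symmetric]) simp
    ultimately show ?thesis
      using C [OF x, of ?\<alpha>] by simp
  qed
  then show ?thesis by blast
qed

lemma B_class_imp_extendable:
  fixes U :: "(real ^ 'n::finite) set"
  assumes W: "B_regular W" and U: "quasiconvex_domain U" and fB: "f \<in> B_class W U"
  shows "M_almost_analytic_extendable W U f"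
  unfolding M_almost_analytic_extendable_def
proof (intro ballI allI impI)
  fix M and \<rho> :: real assume M: "M \<in> W" and \<rho>: "\<rho> > 0"
  have U': "U \<noteq> {}" "open U" "bounded U"
    using U by (auto simp: quasiconvex_domain_def)
  have sm: "smooth_on U f"
    using fB by (simp add: B_class_def)
  obtain l N C D E where N: "N \<in> W" and C: "C > 0" and D: "D > 0" and E: "E > 0"
    and l: "l 0 = 1" "\<forall>k. 0 < l k" "mono (\<lambda>k. l (Suc k) / l k)" "\<forall>R. \<exists>k. R \<le> l (Suc k) / l k"
    and Nl: "\<forall>k. N k \<le> C ^ k * fact k * l k" and lM: "\<forall>j. l (j + (CARD('n) + 3)) \<le> E * D ^ j * small_seq M j"
    using regular_log_convex_minorant [OF W M, of "CARD('n) + 3"] by (elim exE bexE conjE)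
  interpret log_convex_seq l
    using l by unfold_locales auto
  obtain Q0 where Q0: "\<And>x y. x \<in> U \<Longrightarrow> y \<in> U \<Longrightarrow> \<exists>g. rectifiable_path g \<and> path_image g \<subseteq> U \<and>
        pathstart g = x \<and> pathfinish g = y \<and> path_length g \<le> Q0 * dist x y"
    using U unfolding quasiconvex_domain_def by blast
  define Q where "Q = max 1 Q0"
  define n where "n = real CARD('n)"
  \<comment> \<open>\<open>\<tau>\<close> and \<open>\<sigma>\<close> are as large as
    \<open>F_almost_analytic\<close> and the locale \<open>jet_estimates\<close> permit.\<close>
  define \<tau> where "\<tau> = \<rho> / (4 * D)"
  define \<sigma> where "\<sigma> = \<tau> / (64 * n * (8 * Q + 5))"
  have Q: "Q \<ge> 1" by (simp add: Q_def)
  have n: "n > 0" by (simp add: n_def)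
  have \<tau>: "\<tau> > 0" using \<rho> D by (simp add: \<tau>_def)
  have \<sigma>: "\<sigma> > 0" using \<tau> n Q by (simp add: \<sigma>_def)
  \<comment> \<open>The class condition is used with \<open>\<sigma> / C\<close> to cancel the
    factor \<open>C ^ k\<close> in the bound of \<open>N k\<close> by \<open>l k\<close>.\<close>
  obtain A where A: "\<And>x js. x \<in> U \<Longrightarrow> \<bar>partials js f x\<bar> \<le> A * ((\<sigma> / C) ^ length js * N (length js))"
    using B_class_partials_bound [OF fB U'(2) N, of "\<sigma> / C"] \<sigma> C by auto
  have N0: "N k \<ge> 0" for k
    using B_regularD(1) [OF W N] by (simp add: weight_sequence_def less_imp_le)
  have partials: "\<bar>partials js f x\<bar> \<le> max 0 A * \<sigma> ^ length js * fact (length js) * l (length js)" if "x \<in> U" for x js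
  proof -
    let ?k = "length js"
    have "\<bar>partials js f x\<bar> \<le> A * ((\<sigma> / C) ^ ?k * N ?k)"
      by (rule A [OF that])
    also have "\<dots> \<le> max 0 A * ((\<sigma> / C) ^ ?k * N ?k)"
      using \<sigma> C N0 by (intro mult_right_mono) auto
    also have "\<dots> \<le> max 0 A * ((\<sigma> / C) ^ ?k * (C ^ ?k * fact ?k * l ?k))"
      using \<sigma> C Nl by (intro mult_left_mono) auto
    also have "\<dots> = max 0 A * \<sigma> ^ ?k * fact ?k * l ?k"
      using C by (simp add: power_divide)
    finally show ?thesis .
  qed
  \<comment> \<open>Small enough that the ratio \<open>l 2 / l 1\<close> is still below
    \<open>1 / (\<tau> * \<delta>0)\<close>, so that \<open>opt\<close> is at least 2; the factor 2
    makes this strict.\<close>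
  define \<delta>0 where "\<delta>0 = min 1 (l 1 / (2 * \<tau> * l 2))"
  have \<delta>0: "0 < \<delta>0" "\<delta>0 \<le> 1"
    using l_pos \<tau> by (auto simp: \<delta>0_def)
  have opt: "2 \<le> opt (\<tau> * \<delta>0)"
  proof -
    have "\<tau> * \<delta>0 \<le> \<tau> * (l 1 / (2 * \<tau> * l 2))"
      using \<tau> by (intro mult_left_mono) (auto simp: \<delta>0_def)
    also have "\<dots> = l 1 / l 2 / 2"
      using \<tau> by simp
    also have "\<dots> < l 1 / l 2"
    proof -
      have "x / 2 < x" if "0 < x" for x :: real
        using that by simp
      then show ?thesis
        using l_pos [of 1] l_pos [of 2] divide_pos_pos by blast
    qed
    finally have "l 2 / l 1 < 1 / (\<tau> * \<delta>0)"
      using l_pos [of 1] l_pos [of 2] \<tau> \<delta>0 by (simp add: field_simps)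
    then have "Suc 1 \<le> opt (\<tau> * \<delta>0)"
      using \<tau> \<delta>0 by (intro opt_ge) (auto simp: numeral_2_eq_2)
    then show ?thesis by simp
  qed
  obtain CN where CN: "CN > 0" and net: "\<And>\<delta>. 0 < \<delta> \<Longrightarrow> \<delta> \<le> 1 \<Longrightarrow>
    \<exists>xs. set xs \<subseteq> U \<and> (\<forall>u\<in>U. \<exists>x\<in>set xs. dist u x < \<delta>) \<and> real (length xs) \<le> CN / \<delta> ^ CARD('n)"
    using finite_net_card [OF U'(3)] by blast
  let ?net = "\<lambda>i xs. set xs \<subseteq> U \<and> (\<forall>u\<in>U. \<exists>x\<in>set xs. dist u x < \<delta>0 / 4 ^ i)
      \<and> real (length xs) \<le> CN / (\<delta>0 / 4 ^ i) ^ CARD('n)"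
  have "\<exists>xs. ?net i xs" for i
  proof (rule net)
    have "\<delta>0 / 4 ^ i \<le> \<delta>0 / 1"
      using \<delta>0 by (intro divide_left_mono) auto
    then show "\<delta>0 / 4 ^ i \<le> 1" using \<delta>0(2) by linarith
  qed (use \<delta>0 in auto)
  then have "\<forall>i. \<exists>xs. ?net i xs"
    by (rule allI)
  from choice [OF this] obtain X where X: "\<forall>i. ?net i (X i)"
    by (rule exE)
  have mpos: "0 < small_seq M k" for k
    by (rule small_seq_pos [OF B_regularD(1) [OF W M]])
  interpret extension l f U n Q "max 0 A" \<sigma> \<tau> \<delta>0 CN E D X "small_seq M"
  proof
    show "n = real CARD('n)" by (rule n_def)
    fix x y assume xy: "x \<in> U" "y \<in> U"
    obtain g where g: "rectifiable_path g" "path_image g \<subseteq> U" "pathstart g = x" "pathfinish g = y" "path_length g \<le> Q0 * dist x y"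
      using Q0 [OF xy] by blast
    moreover have "Q0 * dist x y \<le> Q * dist x y"
      by (intro mult_right_mono) (auto simp: Q_def)
    ultimately show "\<exists>g. rectifiable_path g \<and> path_image g \<subseteq> U \<and>
        pathstart g = x \<and> pathfinish g = y \<and> path_length g \<le> Q * dist x y"
      by (intro exI [of _ g]) auto
  next
    show "64 * n * (8 * Q + 5) * \<sigma> \<le> \<tau>"
      using n Q by (simp add: \<sigma>_def)
  next
    fix u i assume "u \<in> U"
    then show "\<exists>x\<in>set (X i). dist u x < \<delta>0 / 4 ^ i"
      using X by blast
  next
    fix i
    show "set (X i) \<subseteq> U" "real (length (X i)) \<le> CN / (\<delta>0 / 4 ^ i) ^ CARD('n)"
      using X by blast+
  next
    fix j
    show "0 \<le> small_seq M j"
      using mpos [of j] by simp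
    show "l (j + (CARD('n) + 3)) \<le> E * D ^ j * small_seq M j"
      using lM by blast
  qed (use sm U' Q \<sigma> \<tau> partials \<delta>0 opt CN E D in auto)
  show "almost_analytic_ext (h_fun (small_seq M)) \<rho> U f"
    using D by (intro F_almost_analytic mpos B_regularD(2) [OF W M]) (simp add: \<tau>_def)
qed

theorem theorem3p4:
  fixes W :: "(nat \<Rightarrow> real) set" and U :: "(real ^ 'n) set" and f :: "real ^ 'n \<Rightarrow> real"
  assumes "B_regular W" and "quasiconvex_domain U"
  shows "f \<in> B_class W U \<longleftrightarrow> M_almost_analytic_extendable W U f"
proof
  show "M_almost_analytic_extendable W U f" if "f \<in> B_class W U"
    using B_class_imp_extendable [OF assms that] .
  show "f \<in> B_class W U" if "M_almost_analytic_extendable W U f"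
  proof (rule extendable_imp_B_class [OF _ _ _ that])
    show "weight_matrix W"
      using assms(1) by (simp add: B_regular_def)
    show "open U" "U \<noteq> {}"
      using assms(2) by (auto simp: quasiconvex_domain_def)
  qed
qed

end
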